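(* Let $0<a<M$ and let $(K,g)$ be the domain of outer communication (DOC) of the Kerr spacetime of mass $M$ and rotation parameter $a$. Then the spherical photons are the only trapped photons in $(K,g)$; that is, every trapped photon in $K$ has constant Boyer--Lindquist radial coordinate $r$.
   Context: Kerr DOC: For $0\le a<M$ put $r_+=M+\sqrt{M^2-a^2}$, $\rho^2=r^2+a^2\cos^2\vartheta$, $\Delta=r^2-2Mr+a^2$, $\mathscr A=(r^2+a^2)^2-\Delta a^2\sin^2\vartheta$. The domain of outer communication $K$ is the manifold $\mathbb R\times(r_+,\infty)\times\mathbb S^2$ with Boyer--Lindquist coordinates $(t,r,\vartheta,\varphi)$ ($\vartheta\in[0,\pi]$, $\varphi\in[0,2\pi]$ spherical coordinates on $\mathbb S^2$), with the Lorentzian metric $$g=-\Big(1-\frac{2Mr}{\rho^2}\Big)dt^2+\frac{\rho^2}{\Delta}dr^2+\rho^2d\vartheta^2-\frac{4Mra\sin^2\vartheta}{\rho^2}\,dt\,d\varphi+\frac{\mathscr A}{\rho^2}\sin^2\vartheta\,d\varphi^2,$$ which extends smoothly over the axis $\{\sin\vartheta=0\}$. A photon is an inextendible (in $K$) null geodesic with nonvanishing tangent vector. A photon in the DOC of a stationary spacetime is called trapped if its orbit in the quotient of the DOC under the action (flow) of the stationary Killing vector field $\partial_t$ is contained in a compact set. In the Kerr spacetime this means: the range of its radial coordinate $r$ is a relatively compact subset of $(r_+,\infty)$. A spherical photon is a photon along which $r$ is constant. *)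

theory Defs
  imports "HOL-Analysis.Analysis"
begin

section \<open>Pseudo-Riemannian geometry on open subsets of Euclidean space\<close>

type_synonym 'n metric = "real ^ 'n \<Rightarrow> real ^ 'n \<Rightarrow> real ^ 'n \<Rightarrow> real"

definition metric_matrix :: "'n::finite metric \<Rightarrow> real ^ 'n \<Rightarrow> real ^ 'n ^ 'n" where
  "metric_matrix g p = (\<chi> i j. g p (axis i 1) (axis j 1))"

definition partial_deriv :: "'n::finite \<Rightarrow> (real ^ 'n \<Rightarrow> real) \<Rightarrow> real ^ 'n \<Rightarrow> real" where
  "partial_deriv i f p = deriv (\<lambda>h. f (p + h *\<^sub>R axis i 1)) 0"

definition christoffel ::
    "'n::finite metric \<Rightarrow> 'n \<Rightarrow> 'n \<Rightarrow> 'n \<Rightarrow> real ^ 'n \<Rightarrow> real" where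
  "christoffel g k i j p =
     (\<Sum>l\<in>UNIV. matrix_inv (metric_matrix g p) $ k $ l *
        (partial_deriv i (\<lambda>q. metric_matrix g q $ j $ l) p
         + partial_deriv j (\<lambda>q. metric_matrix g q $ i $ l) p
         - partial_deriv l (\<lambda>q. metric_matrix g q $ i $ j) p)) / 2"

definition velocity :: "(real \<Rightarrow> real ^ 'n::finite) \<Rightarrow> real \<Rightarrow> real ^ 'n" where
  "velocity \<gamma> s = vector_derivative \<gamma> (at s)"

text \<open>Affinely parametrized geodesics on an open interval, with values in the open set \<open>U\<close>.
  Only the restriction of \<open>\<gamma>\<close> to \<open>I\<close> matters.\<close>

definition geodesic ::
    "'n::finite metric \<Rightarrow> (real ^ 'n) set \<Rightarrow> real set \<Rightarrow> (real \<Rightarrow> real ^ 'n) \<Rightarrow> bool" where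
  "geodesic g U I \<gamma> \<longleftrightarrow>
     open I \<and> is_interval I \<and> I \<noteq> {} \<and> \<gamma> ` I \<subseteq> U \<and>
     (\<forall>s\<in>I. \<gamma> differentiable (at s) \<and> velocity \<gamma> differentiable (at s) \<and>
        (\<forall>k. vector_derivative (velocity \<gamma>) (at s) $ k
              + (\<Sum>i\<in>UNIV. \<Sum>j\<in>UNIV.
                   christoffel g k i j (\<gamma> s) * velocity \<gamma> s $ i * velocity \<gamma> s $ j) = 0))"

definition inextendible_geodesic ::
    "'n::finite metric \<Rightarrow> (real ^ 'n) set \<Rightarrow> real set \<Rightarrow> (real \<Rightarrow> real ^ 'n) \<Rightarrow> bool" where
  "inextendible_geodesic g U I \<gamma> \<longleftrightarrow>
     geodesic g U I \<gamma> \<and>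
     (\<forall>J \<delta>. geodesic g U J \<delta> \<and> I \<subseteq> J \<and> (\<forall>s\<in>I. \<delta> s = \<gamma> s) \<longrightarrow> J = I)"

definition photon ::
    "'n::finite metric \<Rightarrow> (real ^ 'n) set \<Rightarrow> real set \<Rightarrow> (real \<Rightarrow> real ^ 'n) \<Rightarrow> bool" where
  "photon g U I \<gamma> \<longleftrightarrow>
     inextendible_geodesic g U I \<gamma> \<and>
     (\<forall>s\<in>I. velocity \<gamma> s \<noteq> 0 \<and> g (\<gamma> s) (velocity \<gamma> s) (velocity \<gamma> s) = 0)"


section \<open>The Kerr domain of outer communication\<close>

definition r_plus :: "real \<Rightarrow> real \<Rightarrow> real" where
  "r_plus M a = M + sqrt (M\<^sup>2 - a\<^sup>2)"

definition Kerr_rho2 :: "real \<Rightarrow> real \<Rightarrow> real \<Rightarrow> real" where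
  "Kerr_rho2 a r c = r\<^sup>2 + a\<^sup>2 * c\<^sup>2"  \<comment> \<open>\<open>c\<close> stands for \<open>cos \<vartheta>\<close>\<close>

definition Kerr_Delta :: "real \<Rightarrow> real \<Rightarrow> real \<Rightarrow> real" where
  "Kerr_Delta M a r = r\<^sup>2 - 2 * M * r + a\<^sup>2"

text \<open>The Boyer--Lindquist line element, at \<open>q = (t, r, \<vartheta>, \<phi>)\<close>. It degenerates on the axis
  \<open>sin \<vartheta> = 0\<close>.\<close>

definition Kerr_BL :: "real \<Rightarrow> real \<Rightarrow> 4 metric" where
  "Kerr_BL M a q v w =
     (let r = q $ 2; \<theta> = q $ 3; \<rho>2 = Kerr_rho2 a r (cos \<theta>); \<Delta> = Kerr_Delta M a r;
          A = (r\<^sup>2 + a\<^sup>2)\<^sup>2 - \<Delta> * a\<^sup>2 * (sin \<theta>)\<^sup>2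
      in - (1 - 2 * M * r / \<rho>2) * (v $ 1 * w $ 1)
         + \<rho>2 / \<Delta> * (v $ 2 * w $ 2)
         + \<rho>2 * (v $ 3 * w $ 3)
         - 4 * M * r * a * (sin \<theta>)\<^sup>2 / \<rho>2 * ((v $ 1 * w $ 4 + v $ 4 * w $ 1) / 2)
         + A / \<rho>2 * (sin \<theta>)\<^sup>2 * (v $ 4 * w $ 4))"

text \<open>
  The manifold \<open>\<real> \<times> (r\<^sub>+, \<infinity>) \<times> S\<^sup>2\<close> is covered by one global chart: the point \<open>(t, r, n)\<close> with
  \<open>n \<in> S\<^sup>2 \<subseteq> \<real>\<^sup>3\<close> is represented by \<open>(t, r n) \<in> \<real>\<^sup>4\<close>. The Boyer--Lindquist radius is then
  the Euclidean norm of the last three components.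
\<close>

definition BL_r :: "real ^ 4 \<Rightarrow> real" where
  "BL_r p = sqrt ((p $ 2)\<^sup>2 + (p $ 3)\<^sup>2 + (p $ 4)\<^sup>2)"

definition Kerr_DOC :: "real \<Rightarrow> real \<Rightarrow> (real ^ 4) set" where
  "Kerr_DOC M a = {p. r_plus M a < BL_r p}"

text \<open>
  The Kerr metric in the global chart, with the coframe regular on the axis:
  \<open>dr\<close>, \<open>\<sigma> = sin\<^sup>2 \<vartheta> d\<phi>\<close> and the round metric \<open>d\<Omega>\<^sup>2 = d\<vartheta>\<^sup>2 + sin\<^sup>2 \<vartheta> d\<phi>\<^sup>2\<close>.
  Substituting \<open>d\<vartheta>\<^sup>2 = d\<Omega>\<^sup>2 - sin\<^sup>2 \<vartheta> d\<phi>\<^sup>2\<close> in the line element leaves the coefficient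
  \<open>A / \<rho>\<^sup>2 - \<rho>\<^sup>2 = a\<^sup>2 sin\<^sup>2 \<vartheta> (1 + 2 M r / \<rho>\<^sup>2)\<close> of \<open>sin\<^sup>2 \<vartheta> d\<phi>\<^sup>2\<close>. All coefficients are smooth on
  the whole domain; agreement with the Boyer--Lindquist line element is
  \<open>Kerr_metric_BL_chart\<close> below.
\<close>

definition Kerr_metric :: "real \<Rightarrow> real \<Rightarrow> 4 metric" where
  "Kerr_metric M a p v w =
     (let r = BL_r p; \<rho>2 = Kerr_rho2 a r (p $ 4 / r); \<Delta> = Kerr_Delta M a r;
          dr = (\<lambda>u :: real ^ 4. (p $ 2 * u $ 2 + p $ 3 * u $ 3 + p $ 4 * u $ 4) / r);
          \<sigma> = (\<lambda>u :: real ^ 4. (p $ 2 * u $ 3 - p $ 3 * u $ 2) / r\<^sup>2);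
          d\<Omega>2 = (v $ 2 * w $ 2 + v $ 3 * w $ 3 + v $ 4 * w $ 4 - dr v * dr w) / r\<^sup>2
      in - (1 - 2 * M * r / \<rho>2) * (v $ 1 * w $ 1)
         + \<rho>2 / \<Delta> * (dr v * dr w)
         + \<rho>2 * d\<Omega>2
         - 4 * M * r * a / \<rho>2 * ((v $ 1 * \<sigma> w + \<sigma> v * w $ 1) / 2)
         + a\<^sup>2 * (1 + 2 * M * r / \<rho>2) * (\<sigma> v * \<sigma> w))"

definition BL_chart :: "real ^ 4 \<Rightarrow> real ^ 4" where
  "BL_chart q = vector
     [q $ 1, q $ 2 * sin (q $ 3) * cos (q $ 4), q $ 2 * sin (q $ 3) * sin (q $ 4),
      q $ 2 * cos (q $ 3)]"

definition BL_chart_deriv :: "real ^ 4 \<Rightarrow> real ^ 4 \<Rightarrow> real ^ 4" where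
  "BL_chart_deriv q u = vector
     [u $ 1,
      u $ 2 * (sin (q $ 3) * cos (q $ 4)) + u $ 3 * (q $ 2 * cos (q $ 3) * cos (q $ 4))
        - u $ 4 * (q $ 2 * sin (q $ 3) * sin (q $ 4)),
      u $ 2 * (sin (q $ 3) * sin (q $ 4)) + u $ 3 * (q $ 2 * cos (q $ 3) * sin (q $ 4))
        + u $ 4 * (q $ 2 * sin (q $ 3) * cos (q $ 4)),
      u $ 2 * cos (q $ 3) - u $ 3 * (q $ 2 * sin (q $ 3))]"

lemma vector_4_nth:
  "(vector [x, y, z, w] :: real ^ 4) $ 1 = x"
  "(vector [x, y, z, w] :: real ^ 4) $ 2 = y"
  "(vector [x, y, z, w] :: real ^ 4) $ 3 = z"
  "(vector [x, y, z, w] :: real ^ 4) $ 4 = w"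
  by (simp_all add: vector_def)

lemma BL_r_BL_chart:
  assumes "q $ 2 > 0"
  shows "BL_r (BL_chart q) = q $ 2"
proof -
  have "(q $ 2 * sin (q $ 3) * cos (q $ 4))\<^sup>2 + (q $ 2 * sin (q $ 3) * sin (q $ 4))\<^sup>2
          + (q $ 2 * cos (q $ 3))\<^sup>2
        = (q $ 2)\<^sup>2 * ((sin (q $ 3))\<^sup>2 * ((cos (q $ 4))\<^sup>2 + (sin (q $ 4))\<^sup>2) + (cos (q $ 3))\<^sup>2)"
    by (simp only: power_mult_distrib distrib_left distrib_right mult.assoc)
  also have "\<dots> = (q $ 2)\<^sup>2"
    by simp
  finally show ?thesis
    using assms by (simp add: BL_r_def BL_chart_def vector_4_nth)
qed

lemma BL_chart_has_derivative: "(BL_chart has_derivative BL_chart_deriv q) (at q)"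
proof (subst has_derivative_componentwise_within, rule ballI)
  fix b :: "real ^ 4"
  assume "b \<in> Basis"
  then obtain i where b: "b = axis i 1"
    by (auto simp: Basis_vec_def)
  have nth: "((\<lambda>q :: real ^ 4. q $ j) has_derivative (\<lambda>u. u $ j)) (at q)" for j
    by (rule bounded_linear_imp_has_derivative[OF bounded_linear_vec_nth])
  have "((\<lambda>x. BL_chart x $ i) has_derivative (\<lambda>x. BL_chart_deriv q x $ i)) (at q)"
    using exhaust_4[of i]
    by (elim disjE; simp add: BL_chart_def BL_chart_deriv_def vector_4_nth)
       (auto intro!: derivative_eq_intros nth simp: algebra_simps)
  then show "((\<lambda>x. BL_chart x \<bullet> b) has_derivative (\<lambda>x. BL_chart_deriv q x \<bullet> b)) (at q)"
    by (simp add: b inner_axis)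
qed

lemma r_plus_pos:
  assumes "0 \<le> a" "a < M"
  shows "r_plus M a > 0"
  using assms power_mono[of a M 2] by (auto simp: r_plus_def intro!: add_pos_nonneg)

lemma Kerr_metric_BL_chart:
  assumes "0 \<le> a" "a < M" "q $ 2 > r_plus M a"
  shows "Kerr_metric M a (BL_chart q) (BL_chart_deriv q v) (BL_chart_deriv q w)
           = Kerr_BL M a q v w"
proof -
  define r where "r = q $ 2"
  define s where "s = sin (q $ 3)"
  define c where "c = cos (q $ 3)"
  define S where "S = sin (q $ 4)"
  define C where "C = cos (q $ 4)"
  define \<rho>2 where "\<rho>2 = Kerr_rho2 a r c"
  have sc: "s\<^sup>2 = 1 - c\<^sup>2" and SC: "S\<^sup>2 = 1 - C\<^sup>2"
    by (simp_all add: s_def c_def S_def C_def sin_squared_eq)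
  have r: "r > 0"
    using assms r_plus_pos[of a M] by (simp add: r_def)
  have \<rho>2: "\<rho>2 > 0"
    using r by (simp add: \<rho>2_def Kerr_rho2_def add_pos_nonneg)
  have BLr: "BL_r (BL_chart q) = r"
    using BL_r_BL_chart[of q] r by (simp add: r_def)
  define p where "p = BL_chart q"
  define D where "D = BL_chart_deriv q"
  have p: "p $ 2 = r * s * C" "p $ 3 = r * s * S" "p $ 4 = r * c"
    by (simp_all add: p_def BL_chart_def vector_4_nth r_def s_def c_def S_def C_def)
  have D: "D u $ 1 = u $ 1"
    "D u $ 2 = u $ 2 * (s * C) + u $ 3 * (r * c * C) - u $ 4 * (r * s * S)"
    "D u $ 3 = u $ 2 * (s * S) + u $ 3 * (r * c * S) + u $ 4 * (r * s * C)"
    "D u $ 4 = u $ 2 * c - u $ 3 * (r * s)" for u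
    by (simp_all add: D_def BL_chart_deriv_def vector_4_nth r_def s_def c_def S_def C_def)
  have SC1: "C\<^sup>2 + S\<^sup>2 = 1" and sc1: "s\<^sup>2 + c\<^sup>2 = 1"
    using sc SC by simp_all
  have dr: "(p $ 2 * D u $ 2 + p $ 3 * D u $ 3 + p $ 4 * D u $ 4) / r = u $ 2" for u
  proof -
    have "p $ 2 * D u $ 2 + p $ 3 * D u $ 3 + p $ 4 * D u $ 4
        = r * (u $ 2 * (s\<^sup>2 * (C\<^sup>2 + S\<^sup>2) + c\<^sup>2) + u $ 3 * r * s * c * ((C\<^sup>2 + S\<^sup>2) - 1))"
      unfolding p D by (simp add: algebra_simps power2_eq_square)
    also have "\<dots> = r * u $ 2"
      by (simp add: SC1 sc1)
    finally show ?thesis using r by simp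
  qed
  have \<sigma>: "(p $ 2 * D u $ 3 - p $ 3 * D u $ 2) / r\<^sup>2 = s\<^sup>2 * u $ 4" for u
  proof -
    have "p $ 2 * D u $ 3 - p $ 3 * D u $ 2 = r\<^sup>2 * (s\<^sup>2 * u $ 4 * (C\<^sup>2 + S\<^sup>2))"
      unfolding p D by (simp add: algebra_simps power2_eq_square)
    then show ?thesis using r by (simp add: SC1)
  qed
  have d\<Omega>2: "(D v $ 2 * D w $ 2 + D v $ 3 * D w $ 3 + D v $ 4 * D w $ 4 - v $ 2 * w $ 2) / r\<^sup>2
      = v $ 3 * w $ 3 + s\<^sup>2 * (v $ 4 * w $ 4)"
  proof -
    have "D v $ 2 * D w $ 2 + D v $ 3 * D w $ 3 + D v $ 4 * D w $ 4 =
        (C\<^sup>2 + S\<^sup>2) * ((v $ 2 * s + v $ 3 * r * c) * (w $ 2 * s + w $ 3 * r * c)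
                    + v $ 4 * w $ 4 * (r\<^sup>2 * s\<^sup>2))
        + (v $ 2 * c - v $ 3 * r * s) * (w $ 2 * c - w $ 3 * r * s)"
      unfolding D by (simp add: algebra_simps power2_eq_square)
    also have "\<dots> = (s\<^sup>2 + c\<^sup>2) * (v $ 2 * w $ 2 + r\<^sup>2 * (v $ 3 * w $ 3)) + r\<^sup>2 * (s\<^sup>2 * (v $ 4 * w $ 4))"
      unfolding SC1 by (simp add: algebra_simps power2_eq_square)
    finally have "D v $ 2 * D w $ 2 + D v $ 3 * D w $ 3 + D v $ 4 * D w $ 4 - v $ 2 * w $ 2
        = r\<^sup>2 * (v $ 3 * w $ 3 + s\<^sup>2 * (v $ 4 * w $ 4))"
      unfolding sc1 by (simp add: distrib_left)
    then show ?thesis using r by simp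
  qed
  define A where "A = (r\<^sup>2 + a\<^sup>2)\<^sup>2 - Kerr_Delta M a r * a\<^sup>2 * s\<^sup>2"
  have "A = \<rho>2 * \<rho>2 + s\<^sup>2 * (a\<^sup>2 * (\<rho>2 + 2 * M * r))"
    unfolding A_def \<rho>2_def Kerr_rho2_def Kerr_Delta_def sc by algebra
  then have A: "A / \<rho>2 = \<rho>2 + s\<^sup>2 * (a\<^sup>2 * (1 + 2 * M * r / \<rho>2))"
    using \<rho>2 by (simp add: field_simps)
  have "Kerr_metric M a p (D v) (D w) =
      - (1 - 2 * M * r / \<rho>2) * (v $ 1 * w $ 1) + \<rho>2 / Kerr_Delta M a r * (v $ 2 * w $ 2)
      + \<rho>2 * (v $ 3 * w $ 3 + s\<^sup>2 * (v $ 4 * w $ 4))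
      - 4 * M * r * a / \<rho>2 * ((v $ 1 * (s\<^sup>2 * w $ 4) + s\<^sup>2 * v $ 4 * w $ 1) / 2)
      + a\<^sup>2 * (1 + 2 * M * r / \<rho>2) * (s\<^sup>2 * v $ 4 * (s\<^sup>2 * w $ 4))"
  proof -
    have "p $ 4 / r = c"
      using r by (simp add: p)
    then show ?thesis
      unfolding Kerr_metric_def Let_def BLr[folded p_def] dr \<sigma> d\<Omega>2 D(1) by (simp add: \<rho>2_def)
  qed
  also have "\<dots> =
      - (1 - 2 * M * r / \<rho>2) * (v $ 1 * w $ 1) + \<rho>2 / Kerr_Delta M a r * (v $ 2 * w $ 2)
      + \<rho>2 * (v $ 3 * w $ 3)
      - 4 * M * r * a * s\<^sup>2 / \<rho>2 * ((v $ 1 * w $ 4 + v $ 4 * w $ 1) / 2)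
      + A / \<rho>2 * s\<^sup>2 * (v $ 4 * w $ 4)"
    unfolding A by (simp add: algebra_simps add_divide_distrib)
  also have "\<dots> = Kerr_BL M a q v w"
    by (simp add: Kerr_BL_def Let_def r_def s_def c_def \<rho>2_def A_def)
  finally show ?thesis
    by (simp add: p_def D_def)
qed

lemma Kerr_DOC_eq_BL_chart_image:
  assumes "0 \<le> a" "a < M"
  shows "Kerr_DOC M a = BL_chart ` {q. r_plus M a < q $ 2 \<and> q $ 3 \<in> {0..pi} \<and> q $ 4 \<in> {0..2*pi}}"
proof
  have rp: "r_plus M a > 0"
    by (rule r_plus_pos[OF assms])
  show "BL_chart ` {q. r_plus M a < q $ 2 \<and> q $ 3 \<in> {0..pi} \<and> q $ 4 \<in> {0..2*pi}}
          \<subseteq> Kerr_DOC M a"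
    using rp by (auto simp: Kerr_DOC_def BL_r_BL_chart)
  show "Kerr_DOC M a
          \<subseteq> BL_chart ` {q. r_plus M a < q $ 2 \<and> q $ 3 \<in> {0..pi} \<and> q $ 4 \<in> {0..2*pi}}"
  proof
    fix p assume p: "p \<in> Kerr_DOC M a"
    define r where "r = BL_r p"
    define b where "b = sqrt ((p $ 2)\<^sup>2 + (p $ 3)\<^sup>2)"
    have r: "r > r_plus M a" "r > 0"
      using p rp by (auto simp: Kerr_DOC_def r_def)
    have b2: "b\<^sup>2 = (p $ 2)\<^sup>2 + (p $ 3)\<^sup>2" and r2: "r\<^sup>2 = b\<^sup>2 + (p $ 4)\<^sup>2" and b0: "b \<ge> 0"
      by (simp_all add: b_def r_def BL_r_def)
    have "(p $ 4 / r)\<^sup>2 + (b / r)\<^sup>2 = 1"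
      using r by (simp add: power_divide add_divide_distrib[symmetric] add.commute flip: r2)
    then obtain \<theta> where \<theta>: "0 \<le> \<theta>" "\<theta> \<le> pi" "p $ 4 / r = cos \<theta>" "b / r = sin \<theta>"
      using sincos_total_pi[of "b / r" "p $ 4 / r"] b0 r by auto
    have b': "b = r * sin \<theta>" and p4: "p $ 4 = r * cos \<theta>"
      using \<theta>(3,4) r by (simp_all add: field_simps)
    obtain \<phi> where \<phi>: "0 \<le> \<phi>" "\<phi> \<le> 2 * pi" "p $ 2 = b * cos \<phi>" "p $ 3 = b * sin \<phi>"
    proof (cases "b = 0")
      case True
      then show ?thesis using b2 that[of 0] by (simp add: sum_power2_eq_zero_iff)
    next
      case False
      then have "(p $ 2 / b)\<^sup>2 + (p $ 3 / b)\<^sup>2 = 1"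
        by (simp add: power_divide add_divide_distrib[symmetric] flip: b2)
      then obtain \<phi> where "0 \<le> \<phi>" "\<phi> \<le> 2 * pi" "p $ 2 / b = cos \<phi>" "p $ 3 / b = sin \<phi>"
        using sincos_total_2pi_le by blast
      then show ?thesis using that[of \<phi>] False by (simp add: field_simps)
    qed
    have "p = BL_chart (vector [p $ 1, r, \<theta>, \<phi>])"
      by (simp add: vec_eq_iff forall_4 BL_chart_def vector_4_nth \<phi>(3,4) b' p4)
    then show "p \<in> BL_chart ` {q. r_plus M a < q $ 2 \<and> q $ 3 \<in> {0..pi} \<and> q $ 4 \<in> {0..2*pi}}"
      using r \<theta> \<phi> by (auto intro!: image_eqI simp: vector_4_nth)
  qed
qed


section \<open>Trapped and spherical photons\<close>

definition Kerr_photon :: "real \<Rightarrow> real \<Rightarrow> real set \<Rightarrow> (real \<Rightarrow> real ^ 4) \<Rightarrow> bool" where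
  "Kerr_photon M a I \<gamma> \<longleftrightarrow> photon (Kerr_metric M a) (Kerr_DOC M a) I \<gamma>"

definition Kerr_trapped :: "real \<Rightarrow> real \<Rightarrow> real set \<Rightarrow> (real \<Rightarrow> real ^ 4) \<Rightarrow> bool" where
  "Kerr_trapped M a I \<gamma> \<longleftrightarrow>
     (\<exists>C. compact C \<and> C \<subseteq> {r_plus M a<..} \<and> (\<lambda>s. BL_r (\<gamma> s)) ` I \<subseteq> C)"

definition spherical :: "real set \<Rightarrow> (real \<Rightarrow> real ^ 4) \<Rightarrow> bool" where
  "spherical I \<gamma> \<longleftrightarrow> (\<exists>c. \<forall>s\<in>I. BL_r (\<gamma> s) = c)"

text \<open>In terms of the orbit space: the compact subsets of the quotient of the domain by the flow of
  \<open>\<partial>\<^sub>t\<close> are the images of compact subsets of the domain.\<close>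

definition time_flow :: "real \<Rightarrow> real ^ 4 \<Rightarrow> real ^ 4" where
  "time_flow \<tau> p = p + \<tau> *\<^sub>R axis 1 1"

lemma Kerr_trapped_iff_orbit_space:
  "Kerr_trapped M a I \<gamma> \<longleftrightarrow>
     (\<exists>C. compact C \<and> C \<subseteq> Kerr_DOC M a \<and> \<gamma> ` I \<subseteq> (\<Union>\<tau>. time_flow \<tau> ` C))"
proof
  have cont: "continuous_on A BL_r" for A
    unfolding BL_r_def by (intro continuous_intros)
  have flow: "BL_r (time_flow \<tau> p) = BL_r p" for \<tau> p
    by (simp add: BL_r_def time_flow_def axis_def)
  {
    assume "Kerr_trapped M a I \<gamma>"
    then obtain C where C: "compact C" "C \<subseteq> {r_plus M a<..}" "(\<lambda>s. BL_r (\<gamma> s)) ` I \<subseteq> C"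
      by (auto simp: Kerr_trapped_def)
    define D where "D = {p. p $ 1 = 0} \<inter> BL_r -` C"
    have "closed D"
      unfolding D_def
      by (intro closed_Int closed_Collect_eq continuous_closed_vimage compact_imp_closed C(1)
            continuous_intros) (use cont[of UNIV] in \<open>simp add: continuous_on_eq_continuous_at\<close>)
    moreover have "bounded D"
    proof -
      obtain B where B: "\<And>x. x \<in> C \<Longrightarrow> norm x \<le> B"
        using compact_imp_bounded[OF C(1)] by (auto simp: bounded_iff)
      have "norm p \<le> B" if "p \<in> D" for p
      proof -
        have "norm p = BL_r p"
          using that by (simp add: D_def norm_vec_def L2_set_def sum_4 BL_r_def)
        moreover have "BL_r p \<ge> 0" by (simp add: BL_r_def)
        ultimately show ?thesis using that B[of "BL_r p"] by (simp add: D_def)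
      qed
      then show ?thesis by (auto simp: bounded_iff)
    qed
    ultimately have "compact D" by (simp add: compact_eq_bounded_closed)
    moreover have "D \<subseteq> Kerr_DOC M a"
      using C(2) by (auto simp: D_def Kerr_DOC_def)
    moreover have "\<gamma> ` I \<subseteq> (\<Union>\<tau>. time_flow \<tau> ` D)"
    proof
      fix p assume "p \<in> \<gamma> ` I"
      then have "BL_r p \<in> C" using C(3) by auto
      then have "time_flow (- (p $ 1)) p \<in> D"
        by (simp add: D_def flow) (simp add: time_flow_def)
      moreover have "p = time_flow (p $ 1) (time_flow (- (p $ 1)) p)"
        by (simp add: time_flow_def)
      ultimately show "p \<in> (\<Union>\<tau>. time_flow \<tau> ` D)" by blast
    qed
    ultimately show "\<exists>C. compact C \<and> C \<subseteq> Kerr_DOC M a \<and> \<gamma> ` I \<subseteq> (\<Union>\<tau>. time_flow \<tau> ` C)"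
      by blast
  }
  assume "\<exists>C. compact C \<and> C \<subseteq> Kerr_DOC M a \<and> \<gamma> ` I \<subseteq> (\<Union>\<tau>. time_flow \<tau> ` C)"
  then obtain C where C: "compact C" "C \<subseteq> Kerr_DOC M a" "\<gamma> ` I \<subseteq> (\<Union>\<tau>. time_flow \<tau> ` C)"
    by blast
  have "BL_r (\<gamma> s) \<in> BL_r ` C" if s: "s \<in> I" for s
  proof -
    obtain \<tau> p where "p \<in> C" "\<gamma> s = time_flow \<tau> p" using C(3) s by blast
    then show ?thesis by (simp add: flow)
  qed
  then have "(\<lambda>s. BL_r (\<gamma> s)) ` I \<subseteq> BL_r ` C" by blast
  moreover have "BL_r ` C \<subseteq> {r_plus M a<..}" using C(2) by (auto simp: Kerr_DOC_def)
  moreover have "compact (BL_r ` C)" by (intro compact_continuous_image cont C(1))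
  ultimately show "Kerr_trapped M a I \<gamma>" unfolding Kerr_trapped_def by blast
qed

end

theory Submission
  imports Defs
begin

text \<open>
  A null geodesic of the Kerr metric has, besides \<open>p\<^sub>t\<close> and \<open>L = p\<^sub>\<phi>\<close>, Carter's constant \<open>K\<close> as a
  constant of motion, and its radius obeys the energy equation
  \<open>(\<rho>\<^sup>2 r')\<^sup>2 = R r\<close> with \<open>R r = ((r\<^sup>2 + a\<^sup>2) p\<^sub>t + a L)\<^sup>2 - \<Delta> K\<close> of one-dimensional motion in a potential.
  Two properties of the quartic polynomial \<open>R\<close> matter: its cubic coefficient vanishes while its leading
  coefficient \<open>p\<^sub>t\<^sup>2\<close> is nonnegative, and \<open>R\<close> is nonnegative at \<open>r\<^sub>+\<close>, because \<open>\<Delta>\<close> vanishes there.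

  If a trapped photon is defined for all parameter values, then \<open>R\<close> vanishes at the infimum and at the
  supremum of \<open>r\<close>: otherwise \<open>r'\<close> would stay away from \<open>0\<close> near this value, and \<open>r\<close> would run past it
  in the future or in the past (\<open>potential_vanishes_at_Sup\<close>). If \<open>r\<close> is not constant, then it takes
  a value between these two zeros at which \<open>r'\<close> does not vanish, and there \<open>R\<close> is positive. But a quartic
  with such coefficients that is positive between two zeros beyond \<open>r\<^sub>+ > 0\<close> is negative at \<open>r\<^sub>+\<close>
  (\<open>depressed_quartic_no_bump\<close>), a contradiction.

  Two facts have to be established first.

  \<^item> \<^emph>\<open>Constants of motion.\<close> In the chart \<open>(t, x, y, z)\<close> the equations of motion are those of the
    Hamiltonian \<open>g\<^sup>-\<^sup>1(\<pi>, \<pi>) / 2\<close> (\<open>Hamilton_equation\<close>), and \<open>\<rho>\<^sup>2 g\<^sup>-\<^sup>1(\<pi>, \<pi>)\<close> splits into a part that depends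
    on \<open>r\<close>, the radial momentum, \<open>p\<^sub>t\<close> and \<open>L\<close>, and the remainder \<open>K\<close>. Since
    \<open>g\<^sup>-\<^sup>1(\<pi>, \<pi>)\<close> is zero on a null geodesic, the factor \<open>\<rho>\<^sup>2\<close> only rescales time. The
    remainder \<open>K\<close> Poisson-commutes with the four quantities of the first part, hence it is constant
    (\<open>conserved\<close>). The Cartesian chart makes the
    axis \<open>sin \<theta> = 0\<close> an ordinary set of points.

  \<^item> \<^emph>\<open>Completeness.\<close> On a compact range of radii beyond \<open>r\<^sub>+\<close> the constants of motion bound the
    momentum, hence the velocity. If the parameter interval had an end, position and velocity would converge
    there to a point of the tangent bundle of the domain, and Picard's theorem would continue the geodesic
    beyond the end, contrary to inextendibility (\<open>inextendible_bounded_velocity_complete\<close>).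
\<close>


section \<open>One-dimensional motion in a potential\<close>

text \<open>Two roots \<open>x1\<close>, \<open>x2\<close> and the missing cubic term force
  \<open>R x = (x - x1) (x - x2) (e x\<^sup>2 + e (x1 + x2) x + k)\<close>. The last factor is nondecreasing for positive
  \<open>x\<close> and negative at \<open>m\<close>, so it is negative at \<open>x0\<close> as well, where the other two have a positive product.\<close>

lemma depressed_quartic_no_bump:
  fixes e b c d x0 x1 x2 m :: real
  assumes "0 \<le> e" and ord: "0 < x0" "x0 < x1" "x1 < m" "m < x2"
    and R: "\<And>x. R x = e * x ^ 4 + b * x\<^sup>2 + c * x + d"
    and roots: "R x1 = 0" "R x2 = 0" and "0 < R m"
  shows "R x0 < 0"
proof -
  define k where "k = b + e * (x1\<^sup>2 + x1 * x2 + x2\<^sup>2)"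
  \<comment> \<open>The cofactor of \<open>(x - x1) (x - x2)\<close>: the vanishing cubic coefficient makes its linear coefficient
    \<open>e (x1 + x2)\<close>; comparing the coefficients of \<open>x\<^sup>2\<close> gives \<open>k\<close>.\<close>
  define q where "q x = e * x\<^sup>2 + e * (x1 + x2) * x + k" for x
  have "R x2 - R x1 = (x2 - x1) * (c + b * (x1 + x2) + e * (x1 + x2) * (x1\<^sup>2 + x2\<^sup>2))"
    unfolding R by algebra
  then have c: "c = - b * (x1 + x2) - e * (x1 + x2) * (x1\<^sup>2 + x2\<^sup>2)"
    using roots ord by simp
  have d: "d = - (e * x1 ^ 4 + b * x1\<^sup>2 + c * x1)"
    using roots(1) unfolding R by simp
  have fact: "R x = (x - x1) * (x - x2) * q x" for x
    unfolding R d c q_def k_def by algebra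
  have "(m - x1) * (m - x2) < 0"
    using ord by (simp add: mult_pos_neg)
  then have "q m < 0"
    using \<open>0 < R m\<close> fact[of m] by (metis mult_nonpos_nonpos mult_neg_neg not_less linorder_not_less mult_nonneg_nonpos2 mult.commute less_imp_le)
  moreover have "q x0 \<le> q m"
    unfolding q_def using ord \<open>0 \<le> e\<close> by (intro add_mono mult_left_mono power_mono) auto
  ultimately have "q x0 < 0" by simp
  moreover have "0 < (x0 - x1) * (x0 - x2)"
    using ord by (simp add: mult_neg_neg)
  ultimately show ?thesis
    unfolding fact by (simp add: mult_pos_neg)
qed

text \<open>Starting upwards at \<open>s0\<close>, the function can never turn: on every interval \<open>{s0..t}\<close> its maximum has
  to be at the right end, since at an inner maximum the derivative would vanish above the level \<open>y\<close>. So it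
  increases at least linearly.\<close>

lemma unbounded_if_deriv_away_from_0:
  fixes f f' :: "real \<Rightarrow> real"
  assumes der: "\<And>s. (f has_real_derivative f' s) (at s)"
    and c: "0 < c" "\<And>s. y < f s \<Longrightarrow> c \<le> \<bar>f' s\<bar>"
    and s0: "y < f s0" "0 < f' s0"
  obtains s where "B < f s"
proof -
  have cont: "continuous_on A f" for A
    using der by (meson DERIV_continuous continuous_at_imp_continuous_on)
  have max_end: "f s \<le> f t" if "s0 \<le> s" "s \<le> t" for s t
  proof (cases "s0 < t")
    case True
    obtain m where m: "m \<in> {s0..t}" "\<And>x. x \<in> {s0..t} \<Longrightarrow> f x \<le> f m"
      using continuous_attains_sup[of "{s0..t}" f] cont True by auto
    have "m \<noteq> s0"
    proof
      assume "m = s0"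
      obtain d where d: "d > 0" "\<And>h. 0 < h \<Longrightarrow> h < d \<Longrightarrow> f s0 < f (s0 + h)"
        using DERIV_pos_inc_right[OF der s0(2)] by blast
      define h where "h = min (d / 2) (t - s0)"
      have "0 < h" "h < d" "s0 + h \<in> {s0..t}"
        using d(1) True by (auto simp: h_def)
      then show False
        using d(2)[of h] m(2)[of "s0 + h"] \<open>m = s0\<close> by simp
    qed
    moreover have "\<not> (s0 < m \<and> m < t)"
    proof
      assume "s0 < m \<and> m < t"
      then have "f' m = 0"
        using m(2) by (intro DERIV_local_max[OF der, of "min (m - s0) (t - m)"]) (auto simp: abs_if split: if_splits)
      moreover have "y < f m"
        using m(2)[of s0] s0(1) True by simp
      ultimately show False using c(2)[of m] c(1) by simp
    qed
    ultimately have "m = t" using m(1) by auto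
    then show ?thesis using m(2) that by simp
  qed (use that in \<open>auto intro!: eq_refl arg_cong[of _ _ f]\<close>)
  have lower: "c \<le> f' s" if "s0 < s" for s
  proof -
    have "0 \<le> f' s"
    proof (rule ccontr)
      assume "\<not> 0 \<le> f' s"
      then obtain d where d: "d > 0" "\<And>h. 0 < h \<Longrightarrow> h < d \<Longrightarrow> f (s + h) < f s"
        using DERIV_neg_dec_right[OF der, of s] by force
      have "f (s + d / 2) < f s" using d by simp
      then show False
        using max_end[of s "s + d / 2"] d(1) that by simp
    qed
    then show ?thesis using c(2)[of s] max_end[of s0 s] s0(1) that by simp
  qed
  \<comment> \<open>The time after which a slope of at least \<open>c\<close> carries the function from \<open>f s0\<close> past \<open>B\<close>.\<close>
  define T where "T = \<bar>B - f s0\<bar> / c + 1"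
  have "T > 0" using c(1) by (simp add: T_def add_nonneg_pos)
  then obtain z where z: "s0 < z" "f (s0 + T) - f s0 = T * f' z"
    using MVT2[of s0 "s0 + T" f f'] der by auto
  have "B - f s0 < T * c"
    using c(1) by (simp add: T_def distrib_right)
  also have "\<dots> \<le> T * f' z"
    using lower[OF z(1)] \<open>T > 0\<close> by simp
  finally have "B < f (s0 + T)" using z(2) by simp
  then show ?thesis by (rule that)
qed

text \<open>A particle that moves with energy equation \<open>(w f')\<^sup>2 = R f\<close> for all times cannot stay below a level
  at which \<open>R\<close> is not zero: near that level it has a minimal speed. If it moves downwards there, the
  argument applies to the time-reversed motion.\<close>

lemma potential_vanishes_at_Sup:
  fixes f f' w R :: "real \<Rightarrow> real"
  assumes der: "\<And>s. (f has_real_derivative f' s) (at s)"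
    and bdd: "bdd_above (range f)"
    and energy: "\<And>s. (w s * f' s)\<^sup>2 = R (f s)"
    and w: "\<And>s. \<bar>w s\<bar> \<le> W"
    and cont: "isCont R (Sup (range f))"
  shows "R (Sup (range f)) = 0"
proof (rule ccontr)
  define S where "S = Sup (range f)"
  assume "R (Sup (range f)) \<noteq> 0"
  then have pos: "0 < \<bar>R S\<bar> / 2" by (simp add: S_def)
  have le_S: "f s \<le> S" for s
    unfolding S_def using bdd by (intro cSup_upper) auto
  obtain d where d: "d > 0" "\<And>x. \<bar>x - S\<bar> < d \<Longrightarrow> \<bar>R x - R S\<bar> < \<bar>R S\<bar> / 2"
    using cont pos unfolding S_def[symmetric] continuous_at_eps_delta dist_real_def by blast
  define c where "c = sqrt (\<bar>R S\<bar> / 2) / (\<bar>W\<bar> + 1)"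
  have c: "c > 0" using pos by (simp add: c_def)
  have low: "c \<le> \<bar>f' s\<bar>" if "S - d < f s" for s
  proof -
    have "\<bar>R S\<bar> / 2 \<le> \<bar>R (f s)\<bar>"
    proof -
      have "\<bar>f s - S\<bar> < d" using that le_S[of s] by linarith
      then show ?thesis using d(2)[of "f s"] by linarith
    qed
    then have "sqrt (\<bar>R S\<bar> / 2) \<le> sqrt ((w s * f' s)\<^sup>2)"
      using energy[of s] by (metis abs_of_nonneg real_sqrt_le_mono zero_le_power2)
    also have "\<dots> = \<bar>w s\<bar> * \<bar>f' s\<bar>" by (simp add: abs_mult)
    also have "\<dots> \<le> (\<bar>W\<bar> + 1) * \<bar>f' s\<bar>"
      using w[of s] by (intro mult_right_mono) auto
    finally show ?thesis unfolding c_def by (simp add: field_simps)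
  qed
  obtain s0 where s0: "S - d < f s0"
    using less_cSup_iff[of "range f" "S - d"] bdd d(1) unfolding S_def by auto
  have "f' s0 \<noteq> 0" using low[OF s0] c by auto
  then consider "0 < f' s0" | "0 < - f' (- (- s0))" by force
  then show False
  proof cases
    case 1
    then obtain s where "S < f s"
      using unbounded_if_deriv_away_from_0[OF der c low, where y = "S - d" and B = S] s0 by blast
    then show False using le_S[of s] by simp
  next
    case 2
    have "((\<lambda>s. f (- s)) has_real_derivative - f' (- s)) (at s)" for s
    proof -
      have "(uminus has_real_derivative - 1) (at s)" by (auto intro!: derivative_eq_intros)
      from DERIV_chain2[OF der this] show ?thesis by simp
    qed
    then obtain s where "S < f (- s)"
      by (rule unbounded_if_deriv_away_from_0[where c = c and y = "S - d" and ?s0.0 = "- s0"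
            and B = S]) (use low 2 s0 c in auto)
    then show False using le_S[of "- s"] by simp
  qed
qed


section \<open>Continuation of solutions of autonomous differential equations\<close>

text \<open>The integral operator is a contraction of the space of bounded continuous functions on the whole line;
  clamping the upper limit of integration to \<open>{b..b+h}\<close> makes it act on functions defined everywhere.\<close>

lemma Picard_integral_equation:
  fixes F :: "'a::euclidean_space \<Rightarrow> 'a"
  assumes F: "L-lipschitz_on UNIV F" and h: "0 < h" "L * h < 1"
  obtains u where "continuous_on {b..b+h} u"
    "\<And>s. s \<in> {b..b+h} \<Longrightarrow> u s = x0 + integral {b..s} (\<lambda>t. F (u t))"
proof -
  define clamp where "clamp s = max b (min (b + h) s)" for s
  have clamp: "clamp s \<in> {b..b+h}" for s using h by (auto simp: clamp_def)
  have L0: "0 \<le> L" using F by (rule lipschitz_on_nonneg)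
  have contF: "continuous_on A F" for A
    using lipschitz_on_continuous_on[OF F] continuous_on_subset by blast
  define T where "T u s = x0 + integral {b..clamp s} (\<lambda>t. F (apply_bcontfun u t))" for u s
  have contFu: "continuous_on A (\<lambda>t. F (apply_bcontfun u t))" for A and u :: "real \<Rightarrow>\<^sub>C 'a"
    by (rule continuous_on_compose2[OF contF[of UNIV]]) auto
  have int: "(\<lambda>t. F (apply_bcontfun u t)) integrable_on {x..y}" for x y and u :: "real \<Rightarrow>\<^sub>C 'a"
    by (rule integrable_continuous_real[OF contFu])
  have T: "T u \<in> bcontfun" for u
  proof -
    let ?J = "\<lambda>s. x0 + integral {b..s} (\<lambda>t. F (apply_bcontfun u t))"
    have J: "continuous_on {b..b+h} ?J"
      by (intro continuous_intros indefinite_integral_continuous_1 int)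
    have "continuous_on UNIV clamp"
      unfolding clamp_def by (intro continuous_intros)
    then have "continuous_on UNIV (T u)"
      unfolding T_def by (rule continuous_on_compose2[OF J]) (use clamp in auto)
    moreover have "bounded (range (T u))"
    proof (rule bounded_subset)
      show "bounded (?J ` {b..b+h})"
        by (intro compact_imp_bounded compact_continuous_image J) simp
      show "range (T u) \<subseteq> ?J ` {b..b+h}" unfolding T_def using clamp by auto
    qed
    ultimately show ?thesis by (simp add: bcontfun_def)
  qed
  have "dist (Bcontfun (T u)) (Bcontfun (T v)) \<le> (L * h) * dist u v" for u v
  proof (rule dist_bound)
    fix s
    have "dist (T u s) (T v s)
        = norm (integral {b..clamp s} (\<lambda>t. F (apply_bcontfun u t) - F (apply_bcontfun v t)))"
      by (simp add: T_def dist_norm integral_diff int)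
    also have "\<dots> \<le> (L * dist u v) * (clamp s - b)"
    proof (rule integral_bound)
      show "b \<le> clamp s" using clamp[of s] by simp
      show "continuous_on {b..clamp s} (\<lambda>t. F (apply_bcontfun u t) - F (apply_bcontfun v t))"
        by (intro continuous_intros contFu)
      fix t
      have "norm (F (apply_bcontfun u t) - F (apply_bcontfun v t))
          \<le> L * dist (apply_bcontfun u t) (apply_bcontfun v t)"
        using lipschitz_onD[OF F] by (simp add: dist_norm)
      also have "\<dots> \<le> L * dist u v"
        by (intro mult_left_mono dist_bounded L0)
      finally show "norm (F (apply_bcontfun u t) - F (apply_bcontfun v t)) \<le> L * dist u v" .
    qed
    also have "\<dots> \<le> (L * dist u v) * h"
      using clamp[of s] L0 by (intro mult_left_mono) auto
    finally show "dist (apply_bcontfun (Bcontfun (T u)) s) (apply_bcontfun (Bcontfun (T v)) s)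
        \<le> (L * h) * dist u v"
      by (simp add: Bcontfun_inverse T mult_ac)
  qed
  then obtain u where u: "Bcontfun (T u) = u"
    using banach_fix_type[of "L * h" "\<lambda>u. Bcontfun (T u)"] h L0 by auto
  show ?thesis
  proof
    show "continuous_on {b..b+h} (apply_bcontfun u)" by simp
    fix s assume "s \<in> {b..b+h}"
    then have "clamp s = s" by (auto simp: clamp_def)
    then show "apply_bcontfun u s = x0 + integral {b..s} (\<lambda>t. F (apply_bcontfun u t))"
      using arg_cong[OF u, of "\<lambda>u. apply_bcontfun u s"] by (simp add: Bcontfun_inverse T T_def)
  qed
qed

lemma lipschitz_on_closest_point:
  fixes S :: "'a::euclidean_space set"
  assumes "convex S" "closed S" "S \<noteq> {}"
  shows "1-lipschitz_on UNIV (closest_point S)"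
  by (rule lipschitz_onI) (use closest_point_lipschitz[OF assms] in auto)

text \<open>Composing \<open>F\<close> with the nearest-point projection onto the ball gives a globally Lipschitz field, for which
  Picard's theorem provides a solution to the right of \<open>b\<close>; it agrees with a solution for \<open>F\<close> as long as
  it stays in the ball. The two branches fit together differentiably at \<open>b\<close> because the continuous
  concatenation satisfies the integral equation across \<open>b\<close>.\<close>

lemma ODE_solution_extends:
  fixes F :: "'a::euclidean_space \<Rightarrow> 'a" and u :: "real \<Rightarrow> 'a"
  assumes sol: "\<And>s. s \<in> {\<alpha><..<b} \<Longrightarrow> (u has_vector_derivative F (u s)) (at s)"
    and "\<alpha> < b" and lim: "(u \<longlongrightarrow> x0) (at_left b)"
    and e: "0 < e" "L-lipschitz_on (cball x0 e) F"
  obtains w h where "0 < h" "\<And>s. s < b \<Longrightarrow> w s = u s"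
    "\<And>s. s \<in> {\<alpha><..<b+h} \<Longrightarrow> (w has_vector_derivative F (w s)) (at s)"
    "\<And>s. s \<in> {b..<b+h} \<Longrightarrow> w s \<in> cball x0 e"
proof -
  define G where "G x = F (closest_point (cball x0 e) x)" for x
  have ne: "cball x0 e \<noteq> {}" using e by simp
  have proj: "closest_point (cball x0 e) x \<in> cball x0 e" for x
    by (rule closest_point_in_set) (use ne in auto)
  have G: "L-lipschitz_on UNIV G"
  proof -
    have "L-lipschitz_on (range (closest_point (cball x0 e))) F"
      by (rule lipschitz_on_subset[OF e(2)]) (use proj in auto)
    then show ?thesis
      using lipschitz_on_compose2[OF lipschitz_on_closest_point[of "cball x0 e"]] ne
      unfolding G_def by simp
  qed
  have L0: "0 \<le> L" using G by (rule lipschitz_on_nonneg)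
  \<comment> \<open>The summand \<open>1\<close> is there because \<open>L\<close> may be zero; the factor \<open>2\<close> makes the operator contract.\<close>
  define h where "h = 1 / (2 * (L + 1))"
  have h: "0 < h" "L * h < 1" using L0 by (auto simp: h_def divide_simps)
  obtain v where v: "continuous_on {b..b+h} v"
    "\<And>s. s \<in> {b..b+h} \<Longrightarrow> v s = x0 + integral {b..s} (\<lambda>t. G (v t))"
    using Picard_integral_equation[OF G h] by blast
  have contG: "continuous_on A G" for A
    using lipschitz_on_continuous_on[OF G] continuous_on_subset by blast
  have contGv: "continuous_on {b..b+h} (\<lambda>t. G (v t))"
    by (rule continuous_on_compose2[OF contG[of UNIV] v(1)]) auto
  have vb: "v b = x0" using v(2)[of b] h by simp
  have "\<exists>d>0. \<forall>s\<in>{b..b+h}. dist s b < d \<longrightarrow> dist (v s) (v b) < e"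
    using v(1) e(1) h(1) unfolding continuous_on_iff by auto
  then obtain d where d: "d > 0" "\<And>s. s \<in> {b..b+h} \<Longrightarrow> \<bar>s - b\<bar> < d \<Longrightarrow> dist (v s) x0 < e"
    unfolding vb dist_real_def by auto
  define k where "k = min d h"
  have k: "0 < k" "k \<le> h" "k \<le> d" using d h by (auto simp: k_def)
  have v_in: "v s \<in> cball x0 e" if "s \<in> {b..<b+k}" for s
    using d(2)[of s] that k by (auto simp: dist_commute less_imp_le)
  have v_der: "(v has_vector_derivative F (v s)) (at s)" if s: "s \<in> {b<..<b+k}" for s
  proof -
    have "((\<lambda>s. x0 + integral {b..s} (\<lambda>t. G (v t))) has_vector_derivative 0 + G (v s)) (at s within {b..b+h})"
      by (intro has_vector_derivative_add has_vector_derivative_const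
          integral_has_vector_derivative[OF contGv]) (use s k in auto)
    then have "((\<lambda>s. x0 + integral {b..s} (\<lambda>t. G (v t))) has_vector_derivative G (v s)) (at s)"
      using s k by (simp add: at_within_Icc_at)
    moreover have "G (v s) = F (v s)"
      unfolding G_def using v_in[of s] s by (simp add: closest_point_self)
    ultimately have der: "((\<lambda>s. x0 + integral {b..s} (\<lambda>t. G (v t))) has_vector_derivative F (v s)) (at s)"
      by simp
    show ?thesis
      by (rule has_vector_derivative_transform_within_open[OF der, of "{b<..<b+k}"])
         (use s k v(2) in auto)
  qed
  define w where "w s = (if s < b then u s else v s)" for s
  have w_der: "(w has_vector_derivative F (w s)) (at s)" if "s \<in> {\<alpha><..<b+k}" "s \<noteq> b" for s
  proof (cases "s < b")
    case True
    have "(w has_vector_derivative F (u s)) (at s)"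
      by (rule has_vector_derivative_transform_within_open[OF sol[of s], of "{\<alpha><..<b}"])
         (use True that in \<open>auto simp: w_def\<close>)
    then show ?thesis using True by (simp add: w_def)
  next
    case False
    have "(w has_vector_derivative F (v s)) (at s)"
      by (rule has_vector_derivative_transform_within_open[OF v_der[of s], of "{b<..<b+k}"])
         (use False that in \<open>auto simp: w_def\<close>)
    then show ?thesis using False by (simp add: w_def)
  qed
  \<comment> \<open>Across \<open>b\<close> only continuity is clear. Near \<open>b\<close> the curve stays in the ball, where \<open>F\<close> agrees with
    the continuous field \<open>G\<close>; the fundamental theorem of calculus with the exceptional point \<open>b\<close> then
    gives the integral equation, and differentiating it gives the derivative at \<open>b\<close>.\<close>
  have w_b: "isCont w b"
    unfolding continuous_within
  proof (rule filterlim_split_at_real)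
    have "(w \<longlongrightarrow> x0) (at_left b)"
      by (rule Lim_transform_eventually[OF lim]) (auto simp: w_def eventually_at_filter)
    then show "(w \<longlongrightarrow> w b) (at_left b)" by (simp add: w_def vb)
    have "(v \<longlongrightarrow> v b) (at b within {b..b+h})"
      using v(1) h(1) by (simp add: continuous_on)
    then have "(v \<longlongrightarrow> v b) (at_right b)"
      using h(1) by (simp add: at_within_Icc_at_right)
    then have "(w \<longlongrightarrow> v b) (at_right b)"
      by (rule Lim_transform_eventually) (auto simp: w_def eventually_at_filter)
    then show "(w \<longlongrightarrow> w b) (at_right b)" by (simp add: w_def)
  qed
  obtain d' where d': "d' > 0" "\<And>s. \<bar>s - b\<bar> < d' \<Longrightarrow> dist (w s) x0 < e"
    using w_b e(1) unfolding continuous_at_eps_delta dist_real_def by (auto simp: w_def vb)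
  define p where "p = b - min d' (b - \<alpha>) / 2"
  define q where "q = b + min d' k / 2"
  have pq: "p < b" "b < q" "\<alpha> < p" "q < b + k" "b - p < d'" "q - b < d'"
    using d'(1) \<open>\<alpha> < b\<close> k by (auto simp: p_def q_def min_def field_simps)
  have w_in: "w s \<in> cball x0 e" if "s \<in> {p..q}" for s
    using d'(2)[of s] that pq by (auto simp: dist_commute less_imp_le abs_if)
  have w_cont: "continuous_on {p..q} w"
    using w_b w_der pq
    by (intro continuous_at_imp_continuous_on)
       (metis atLeastAtMost_iff greaterThanLessThan_iff has_vector_derivative_continuous
         le_less_trans less_le_trans)
  have Gw_cont: "continuous_on {p..q} (\<lambda>s. G (w s))"
    by (rule continuous_on_compose2[OF contG[of UNIV] w_cont]) auto
  have Gw: "G (w s) = F (w s)" if "s \<in> {p..q}" for s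
    unfolding G_def using w_in[OF that] by (simp add: closest_point_self)
  have w_int: "w s = w p + integral {p..s} (\<lambda>t. G (w t))" if s: "s \<in> {p..q}" for s
  proof -
    have "((\<lambda>t. G (w t)) has_integral (w s - w p)) {p..s}"
    proof (rule fundamental_theorem_of_calculus_interior_strong[of "{b}"])
      show "continuous_on {p..s} w"
        using w_cont by (rule continuous_on_subset) (use s in auto)
      fix t assume t: "t \<in> {p<..<s} - {b}"
      show "(w has_vector_derivative G (w t)) (at t)"
        using w_der[of t] Gw[of t] t s pq by auto
    qed (use s in auto)
    then show ?thesis by (simp add: integral_unique)
  qed
  have "(w has_vector_derivative F (w b)) (at b)"
  proof -
    have "((\<lambda>s. w p + integral {p..s} (\<lambda>t. G (w t))) has_vector_derivative 0 + G (w b)) (at b within {p..q})"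
      by (intro has_vector_derivative_add has_vector_derivative_const
          integral_has_vector_derivative[OF Gw_cont]) (use pq in auto)
    then have der: "((\<lambda>s. w p + integral {p..s} (\<lambda>t. G (w t))) has_vector_derivative F (w b)) (at b)"
      using pq Gw[of b] at_within_Icc_at[of p b q] by simp
    show ?thesis
    proof (rule has_vector_derivative_transform_within_open[OF der, of "{p<..<q}"])
      fix s assume "s \<in> {p<..<q}"
      then show "w p + integral {p..s} (\<lambda>t. G (w t)) = w s"
        by (intro w_int[symmetric]) simp
    qed (use pq in auto)
  qed
  then have "(w has_vector_derivative F (w s)) (at s)" if "s \<in> {\<alpha><..<b+k}" for s
    using w_der[of s] that by (cases "s = b") simp_all
  moreover have "w s = u s" if "s < b" for s
    using that by (simp add: w_def)
  moreover have "w s \<in> cball x0 e" if "s \<in> {b..<b+k}" for s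
    using v_in[OF that] that by (simp add: w_def)
  ultimately show ?thesis
    using that[of k w] k(1) by blast
qed


section \<open>Geodesics in Hamiltonian form\<close>

lemma has_derivative_expand_axes:
  fixes f :: "real ^ 'n::finite \<Rightarrow> real"
  assumes "(f has_derivative D) (at p)"
  shows "partial_deriv i f p = D (axis i 1)"
    and "D h = (\<Sum>i\<in>UNIV. partial_deriv i f p * h $ i)"
proof -
  have lin: "linear D" using assms by (rule has_derivative_linear)
  have pd: "partial_deriv i f p = D (axis i 1)" for i
  proof -
    have "((\<lambda>t. p + t *\<^sub>R axis i 1) has_derivative (\<lambda>t. t *\<^sub>R axis i 1)) (at 0)"
      by (auto intro!: derivative_eq_intros)
    moreover have "(f has_derivative D) (at (p + 0 *\<^sub>R axis i 1))" using assms by simp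
    ultimately have "((\<lambda>t. f (p + t *\<^sub>R axis i 1)) has_derivative (\<lambda>t. D (t *\<^sub>R axis i 1))) (at 0)"
      by (rule has_derivative_compose)
    moreover have "(\<lambda>t. D (t *\<^sub>R axis i 1)) = (*) (D (axis i 1))"
      using lin by (auto simp: linear_cmul mult.commute)
    ultimately have "((\<lambda>t. f (p + t *\<^sub>R axis i 1)) has_field_derivative D (axis i 1)) (at 0)"
      by (simp add: has_field_derivative_def)
    then show ?thesis unfolding partial_deriv_def by (rule DERIV_imp_deriv)
  qed
  show "partial_deriv i f p = D (axis i 1)" by (rule pd)
  have "D h = D (\<Sum>i\<in>UNIV. h $ i *s axis i 1)" by (simp add: basis_expansion)
  also have "\<dots> = (\<Sum>i\<in>UNIV. partial_deriv i f p * h $ i)"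
    by (simp add: linear_sum[OF lin] linear_cmul[OF lin] scalar_mult_eq_scaleR pd mult.commute)
  finally show "D h = (\<Sum>i\<in>UNIV. partial_deriv i f p * h $ i)" .
qed

lemma derivative_along_curve:
  fixes f :: "real ^ 'n::finite \<Rightarrow> real"
  assumes "f differentiable (at (\<gamma> s))" and "(\<gamma> has_vector_derivative v) (at s)"
  shows "((\<lambda>s. f (\<gamma> s)) has_real_derivative (\<Sum>i\<in>UNIV. partial_deriv i f (\<gamma> s) * v $ i)) (at s)"
proof -
  obtain D where D: "(f has_derivative D) (at (\<gamma> s))"
    using assms(1) by (auto simp: differentiable_def)
  have "((\<lambda>s. f (\<gamma> s)) has_derivative (\<lambda>t. D (t *\<^sub>R v))) (at s)"
    using has_derivative_compose[OF assms(2)[unfolded has_vector_derivative_def] D] .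
  moreover have "(\<lambda>t. D (t *\<^sub>R v)) = (*) (D v)"
    using has_derivative_linear[OF D] by (auto simp: linear_cmul mult.commute)
  ultimately show ?thesis
    unfolding has_field_derivative_def has_derivative_expand_axes(2)[OF D] by simp
qed

lemma geodesic_velocity:
  assumes "geodesic g U I \<gamma>" "s \<in> I"
  shows "(\<gamma> has_vector_derivative velocity \<gamma> s) (at s)"
    and "(velocity \<gamma> has_vector_derivative
      (\<chi> k. - (\<Sum>i\<in>UNIV. \<Sum>j\<in>UNIV.
                   christoffel g k i j (\<gamma> s) * velocity \<gamma> s $ i * velocity \<gamma> s $ j))) (at s)"
proof -
  show "(\<gamma> has_vector_derivative velocity \<gamma> s) (at s)"
    using assms unfolding geodesic_def velocity_def by (simp add: vector_derivative_works)
  have "(velocity \<gamma> has_vector_derivative vector_derivative (velocity \<gamma>) (at s)) (at s)"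
    using assms unfolding geodesic_def by (simp add: vector_derivative_works)
  moreover have "vector_derivative (velocity \<gamma>) (at s) =
      (\<chi> k. - (\<Sum>i\<in>UNIV. \<Sum>j\<in>UNIV.
                   christoffel g k i j (\<gamma> s) * velocity \<gamma> s $ i * velocity \<gamma> s $ j))"
    using assms unfolding geodesic_def by (simp add: vec_eq_iff eq_neg_iff_add_eq_0)
  ultimately show "(velocity \<gamma> has_vector_derivative
      (\<chi> k. - (\<Sum>i\<in>UNIV. \<Sum>j\<in>UNIV.
                   christoffel g k i j (\<gamma> s) * velocity \<gamma> s $ i * velocity \<gamma> s $ j))) (at s)"
    by simp
qed

lemma has_real_derivative_vec_nth:
  assumes "(f has_vector_derivative v) (at s)"
  shows "((\<lambda>s. f s $ i) has_real_derivative v $ i) (at s)"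
  using bounded_linear.has_vector_derivative[OF bounded_linear_vec_nth assms, of i]
  by (simp add: has_real_derivative_iff_has_vector_derivative)

definition momentum :: "'n::finite metric \<Rightarrow> (real \<Rightarrow> real ^ 'n) \<Rightarrow> real \<Rightarrow> real ^ 'n" where
  "momentum g \<gamma> s = metric_matrix g (\<gamma> s) *v velocity \<gamma> s"

text \<open>This is the geodesic equation with lowered index (the Euler--Lagrange equation of \<open>g(v, v) / 2\<close>): two of the
  three derivatives of the metric in the Christoffel symbol cancel against the derivative of the metric
  coefficients in the momentum.\<close>

lemma momentum_derivative:
  fixes g :: "'n::finite metric"
  assumes geo: "geodesic g U I \<gamma>" "s \<in> I"
    and sym: "\<And>q i j. metric_matrix g q $ i $ j = metric_matrix g q $ j $ i"
    and diff: "\<And>i j. (\<lambda>q. metric_matrix g q $ i $ j) differentiable (at (\<gamma> s))"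
    and inv: "metric_matrix g (\<gamma> s) ** matrix_inv (metric_matrix g (\<gamma> s)) = mat 1"
  shows "((\<lambda>s. momentum g \<gamma> s $ m) has_real_derivative
     (\<Sum>i\<in>UNIV. \<Sum>j\<in>UNIV. partial_deriv m (\<lambda>q. metric_matrix g q $ i $ j) (\<gamma> s)
        * velocity \<gamma> s $ i * velocity \<gamma> s $ j) / 2) (at s)"
proof -
  define v where "v = velocity \<gamma> s"
  define d where "d l i j = partial_deriv l (\<lambda>q. metric_matrix g q $ i $ j) (\<gamma> s)" for l i j
  define A where "A = metric_matrix g (\<gamma> s)"
  define acc where "acc k = - (\<Sum>i\<in>UNIV. \<Sum>j\<in>UNIV. christoffel g k i j (\<gamma> s) * v $ i * v $ j)" for k
  have dsym: "d l i j = d l j i" for l i j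
    unfolding d_def using sym by simp
  have lower: "(\<Sum>k\<in>UNIV. A $ m $ k * christoffel g k i j (\<gamma> s)) = (d i j m + d j i m - d m i j) / 2"
    for i j
  proof -
    have "(\<Sum>k\<in>UNIV. A $ m $ k * matrix_inv A $ k $ l) = (if m = l then 1 else 0)" for l
      using inv unfolding A_def[symmetric] by (simp add: matrix_matrix_mult_def mat_def vec_eq_iff)
    moreover have "(\<Sum>k\<in>UNIV. A $ m $ k * christoffel g k i j (\<gamma> s))
        = (\<Sum>l\<in>UNIV. (\<Sum>k\<in>UNIV. A $ m $ k * matrix_inv A $ k $ l) * (d i j l + d j i l - d l i j)) / 2"
      unfolding christoffel_def A_def[symmetric] d_def[symmetric] sum_distrib_left sum_distrib_right
        sum_divide_distrib
      by (subst sum.swap) (simp add: mult_ac)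
    ultimately show ?thesis by (simp add: mult_delta_left)
  qed
  have "(\<Sum>k\<in>UNIV. A $ m $ k * acc k)
      = - (\<Sum>i\<in>UNIV. \<Sum>j\<in>UNIV. (\<Sum>k\<in>UNIV. A $ m $ k * christoffel g k i j (\<gamma> s)) * v $ i * v $ j)"
  proof -
    have "(\<Sum>k\<in>UNIV. A $ m $ k * (\<Sum>i\<in>UNIV. \<Sum>j\<in>UNIV. christoffel g k i j (\<gamma> s) * v $ i * v $ j))
        = (\<Sum>i\<in>UNIV. \<Sum>k\<in>UNIV. \<Sum>j\<in>UNIV. A $ m $ k * christoffel g k i j (\<gamma> s) * v $ i * v $ j)"
      unfolding sum_distrib_left by (subst sum.swap) (simp add: mult_ac)
    also have "\<dots> = (\<Sum>i\<in>UNIV. \<Sum>j\<in>UNIV. \<Sum>k\<in>UNIV. A $ m $ k * christoffel g k i j (\<gamma> s) * v $ i * v $ j)"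
      by (intro sum.cong[OF refl] sum.swap)
    finally show ?thesis
      by (simp add: acc_def sum_negf sum_distrib_right)
  qed
  also have "\<dots> = (\<Sum>i\<in>UNIV. \<Sum>j\<in>UNIV. d m i j * v $ i * v $ j) / 2
        - ((\<Sum>i\<in>UNIV. \<Sum>j\<in>UNIV. d i j m * v $ i * v $ j)
           + (\<Sum>i\<in>UNIV. \<Sum>j\<in>UNIV. d j i m * v $ i * v $ j)) / 2"
    unfolding lower
    by (simp add: sum_divide_distrib algebra_simps diff_divide_distrib add_divide_distrib
        sum.distrib sum_subtractf sum_negf)
  also have "(\<Sum>i\<in>UNIV. \<Sum>j\<in>UNIV. d j i m * v $ i * v $ j) = (\<Sum>i\<in>UNIV. \<Sum>j\<in>UNIV. d i j m * v $ i * v $ j)"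
    by (subst sum.swap) (simp add: mult_ac)
  finally have acc: "(\<Sum>k\<in>UNIV. A $ m $ k * acc k)
      = (\<Sum>i\<in>UNIV. \<Sum>j\<in>UNIV. d m i j * v $ i * v $ j) / 2
        - (\<Sum>i\<in>UNIV. \<Sum>j\<in>UNIV. d i j m * v $ i * v $ j)" by simp
  have "((\<lambda>s. momentum g \<gamma> s $ m) has_real_derivative
     (\<Sum>k\<in>UNIV. (\<Sum>i\<in>UNIV. d i m k * v $ i) * v $ k + acc k * A $ m $ k)) (at s)"
    unfolding momentum_def matrix_vector_mult_def vec_lambda_beta
  proof (rule DERIV_sum)
    fix k
    have 1: "((\<lambda>s. velocity \<gamma> s $ k) has_real_derivative acc k) (at s)"
      using has_real_derivative_vec_nth[OF geodesic_velocity(2)[OF geo], of k]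
      by (simp add: acc_def v_def)
    have 2: "((\<lambda>s. metric_matrix g (\<gamma> s) $ m $ k) has_real_derivative
        (\<Sum>i\<in>UNIV. d i m k * v $ i)) (at s)"
      unfolding d_def v_def by (rule derivative_along_curve[OF diff geodesic_velocity(1)[OF geo]])
    show "((\<lambda>s. metric_matrix g (\<gamma> s) $ m $ k * velocity \<gamma> s $ k) has_real_derivative
        (\<Sum>i\<in>UNIV. d i m k * v $ i) * v $ k + acc k * A $ m $ k) (at s)"
      using DERIV_mult[OF 2 1] by (simp add: A_def v_def)
  qed
  also have "(\<Sum>k\<in>UNIV. (\<Sum>i\<in>UNIV. d i m k * v $ i) * v $ k + acc k * A $ m $ k)
      = (\<Sum>i\<in>UNIV. \<Sum>j\<in>UNIV. d m i j * v $ i * v $ j) / 2"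
  proof -
    have "(\<Sum>k\<in>UNIV. (\<Sum>i\<in>UNIV. d i m k * v $ i) * v $ k)
        = (\<Sum>i\<in>UNIV. \<Sum>j\<in>UNIV. d i j m * v $ i * v $ j)"
      unfolding sum_distrib_right by (subst sum.swap) (simp add: dsym[of _ m])
    then show ?thesis using acc by (simp add: sum.distrib mult.commute)
  qed
  finally show ?thesis by (simp add: d_def v_def)
qed

lemma matrix_inv_eqI:
  fixes A :: "real ^ 'n ^ 'n"
  assumes "B ** A = mat 1"
  shows "matrix_inv A = B"
proof -
  have AB: "A ** B = mat 1" using assms matrix_left_right_inverse by blast
  then have "\<exists>X. A ** X = mat 1 \<and> X ** A = mat 1"
    using assms by blast
  then have "A ** matrix_inv A = mat 1 \<and> matrix_inv A ** A = mat 1"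
    unfolding matrix_inv_def by (rule someI_ex)
  then show ?thesis
    by (metis assms matrix_mul_assoc matrix_mul_lid matrix_mul_rid)
qed

text \<open>It remains to replace the derivative of the metric by that of its inverse. For fixed \<open>\<pi> = g v\<close>, the functions
  \<open>\<pi> \<bullet> h \<pi>\<close> and \<open>2 \<pi> \<bullet> v - v \<bullet> g v\<close> of the base point differ by the product of two functions
  that vanish at the point of the geodesic, so their derivatives there agree (this is the Legendre transform).\<close>

lemma Hamilton_equation:
  fixes g :: "'n::finite metric" and h :: "real ^ 'n \<Rightarrow> real ^ 'n ^ 'n"
  assumes U: "open U" and geo: "geodesic g U I \<gamma>" "s \<in> I"
    and sym: "\<And>q i j. metric_matrix g q $ i $ j = metric_matrix g q $ j $ i"
    and inv: "\<And>q. q \<in> U \<Longrightarrow> h q ** metric_matrix g q = mat 1"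
    and dg: "\<And>q i j. q \<in> U \<Longrightarrow> (\<lambda>q. metric_matrix g q $ i $ j) differentiable (at q)"
    and dh: "\<And>q i j. q \<in> U \<Longrightarrow> (\<lambda>q. h q $ i $ j) differentiable (at q)"
    and H: "((\<lambda>q. momentum g \<gamma> s \<bullet> (h q *v momentum g \<gamma> s)) has_derivative D) (at (\<gamma> s))"
  shows "((\<lambda>s. momentum g \<gamma> s $ m) has_real_derivative - D (axis m 1) / 2) (at s)"
proof -
  define p where "p = \<gamma> s"
  define v where "v = velocity \<gamma> s"
  define \<pi> where "\<pi> = momentum g \<gamma> s"
  have p: "p \<in> U" using geo by (auto simp: geodesic_def p_def)
  have inv': "metric_matrix g q ** h q = mat 1" if "q \<in> U" for q
    using inv[OF that] matrix_left_right_inverse by blast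
  have \<pi>: "\<pi> = metric_matrix g p *v v" by (simp add: \<pi>_def momentum_def p_def v_def)
  have v: "v = h p *v \<pi>"
    unfolding \<pi> by (simp add: matrix_vector_mul_assoc inv[OF p])
  \<comment> \<open>Both \<open>w\<close> and \<open>u\<close> vanish at \<open>p\<close>, hence \<open>w \<bullet> u\<close> vanishes there to second order.\<close>
  define w where "w q = v - h q *v \<pi>" for q
  define u where "u q = metric_matrix g q *v v - \<pi>" for q
  define f where "f q = v \<bullet> (metric_matrix g q *v v)" for q
  have decomp: "\<pi> \<bullet> (h q *v \<pi>) - 2 * (\<pi> \<bullet> v) + f q = w q \<bullet> u q" if q: "q \<in> U" for q
  proof -
    have "transpose (metric_matrix g q) = metric_matrix g q"
      by (simp add: transpose_def vec_eq_iff sym)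
    then have "(h q *v \<pi>) \<bullet> (metric_matrix g q *v v) = (metric_matrix g q *v (h q *v \<pi>)) \<bullet> v"
      by (metis dot_lmul_matrix vector_transpose_matrix)
    also have "\<dots> = \<pi> \<bullet> v" by (simp add: matrix_vector_mul_assoc inv'[OF q])
    finally show ?thesis
      unfolding w_def u_def f_def by (simp add: inner_diff inner_commute)
  qed
  have w_diff: "w differentiable (at p)"
    unfolding differentiable_componentwise_within[of w]
    by (auto simp: w_def Basis_vec_def inner_axis matrix_vector_mult_def
        intro!: derivative_intros differentiable_sum dh[OF p])
  have u_diff: "u differentiable (at p)"
    unfolding differentiable_componentwise_within[of u]
    by (auto simp: u_def Basis_vec_def inner_axis matrix_vector_mult_def
        intro!: derivative_intros differentiable_sum dg[OF p])
  have wu0: "w p = 0" "u p = 0"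
    unfolding w_def u_def using v \<pi> by simp_all
  obtain Dw Du where "(w has_derivative Dw) (at p)" "(u has_derivative Du) (at p)"
    using w_diff u_diff by (auto simp: differentiable_def)
  from has_derivative_inner[OF this] have wu: "((\<lambda>q. w q \<bullet> u q) has_derivative (\<lambda>_. 0)) (at p)"
    by (simp add: wu0)
  have f_diff: "f differentiable (at p)"
    unfolding f_def inner_vec_def matrix_vector_mult_def
    by (auto intro!: derivative_intros differentiable_sum dg[OF p])
  then obtain Df where Df: "(f has_derivative Df) (at p)" by (auto simp: differentiable_def)
  have "((\<lambda>q. \<pi> \<bullet> (h q *v \<pi>) - 2 * (\<pi> \<bullet> v) + f q) has_derivative (\<lambda>x. D x - 0 + Df x)) (at p)"
    by (intro derivative_intros Df) (use H in \<open>simp add: \<pi>_def p_def\<close>)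
  then have "((\<lambda>q. w q \<bullet> u q) has_derivative (\<lambda>x. D x - 0 + Df x)) (at p)"
    by (rule has_derivative_transform_within_open[OF _ U p]) (rule decomp)
  then have DDf: "D x + Df x = 0" for x
    using has_derivative_unique[OF wu] by (metis diff_zero)
  have "((\<lambda>q. \<Sum>i\<in>UNIV. \<Sum>j\<in>UNIV. v $ i * (metric_matrix g q $ i $ j * v $ j)) has_derivative
     (\<lambda>x. \<Sum>i\<in>UNIV. \<Sum>j\<in>UNIV. v $ i * (frechet_derivative (\<lambda>q. metric_matrix g q $ i $ j) (at p) x * v $ j))) (at p)"
    using dg[OF p, unfolded frechet_derivative_works]
    by (auto intro!: derivative_eq_intros has_derivative_sum)
  moreover have "f = (\<lambda>q. \<Sum>i\<in>UNIV. \<Sum>j\<in>UNIV. v $ i * (metric_matrix g q $ i $ j * v $ j))"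
    unfolding f_def inner_vec_def matrix_vector_mult_def by (simp add: sum_distrib_left)
  ultimately have "Df = (\<lambda>x. \<Sum>i\<in>UNIV. \<Sum>j\<in>UNIV. v $ i *
      (frechet_derivative (\<lambda>q. metric_matrix g q $ i $ j) (at p) x * v $ j))"
    using has_derivative_unique[OF Df] by simp
  moreover have "frechet_derivative (\<lambda>q. metric_matrix g q $ i $ j) (at p) (axis m 1)
      = partial_deriv m (\<lambda>q. metric_matrix g q $ i $ j) p" for i j
    using has_derivative_expand_axes(1)[of "\<lambda>q. metric_matrix g q $ i $ j"] dg[OF p, unfolded frechet_derivative_works]
    by metis
  ultimately have "Df (axis m 1) = (\<Sum>i\<in>UNIV. \<Sum>j\<in>UNIV.
      partial_deriv m (\<lambda>q. metric_matrix g q $ i $ j) p * v $ i * v $ j)"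
    by (simp add: mult_ac)
  then have "(\<Sum>i\<in>UNIV. \<Sum>j\<in>UNIV.
      partial_deriv m (\<lambda>q. metric_matrix g q $ i $ j) p * v $ i * v $ j) / 2 = - D (axis m 1) / 2"
    using DDf[of "axis m 1"] by simp
  moreover have "metric_matrix g p ** matrix_inv (metric_matrix g p) = mat 1"
    using inv'[OF p] by (simp add: matrix_inv_eqI[OF inv[OF p]])
  ultimately show "((\<lambda>s. momentum g \<gamma> s $ m) has_real_derivative - D (axis m 1) / 2) (at s)"
    using momentum_derivative[OF geo sym, of m] dg[OF p] unfolding p_def v_def by simp
qed


section \<open>Locally Lipschitz maps\<close>

definition locally_lipschitz :: "'a::metric_space set \<Rightarrow> ('a \<Rightarrow> 'b::metric_space) \<Rightarrow> bool" where
  "locally_lipschitz U f \<longleftrightarrow> (\<forall>x\<in>U. \<exists>e>0. \<exists>L. L-lipschitz_on (cball x e) f)"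

lemma locally_lipschitzI_lipschitz:
  "L-lipschitz_on UNIV f \<Longrightarrow> locally_lipschitz U f"
  unfolding locally_lipschitz_def using lipschitz_on_subset zero_less_one by blast

lemma locally_lipschitz_bounded_linear:
  "bounded_linear f \<Longrightarrow> locally_lipschitz U f"
  using bounded_linear.lipschitz_boundE locally_lipschitzI_lipschitz by metis

lemma locally_lipschitz_common_ball:
  assumes "locally_lipschitz U f" "locally_lipschitz U g" "x \<in> U"
  obtains e K L where "0 < e" "K-lipschitz_on (cball x e) f" "L-lipschitz_on (cball x e) g"
proof -
  obtain d K where d: "0 < d" "K-lipschitz_on (cball x d) f"
    using assms(1,3) unfolding locally_lipschitz_def by blast
  obtain e L where e: "0 < e" "L-lipschitz_on (cball x e) g"
    using assms(2,3) unfolding locally_lipschitz_def by blast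
  show ?thesis
    by (rule that[of "min d e" K L])
       (use d e in \<open>auto intro: lipschitz_on_subset\<close>)
qed

lemma locally_lipschitz_add:
  fixes f g :: "_ \<Rightarrow> 'b::real_normed_vector"
  assumes "locally_lipschitz U f" "locally_lipschitz U g"
  shows "locally_lipschitz U (\<lambda>x. f x + g x)"
  unfolding locally_lipschitz_def
proof
  fix x assume "x \<in> U"
  then obtain e K L where "0 < e" "K-lipschitz_on (cball x e) f" "L-lipschitz_on (cball x e) g"
    using locally_lipschitz_common_ball[OF assms] by blast
  then show "\<exists>e>0. \<exists>L. L-lipschitz_on (cball x e) (\<lambda>x. f x + g x)"
    using lipschitz_on_add by blast
qed

lemma locally_lipschitz_Pair:
  assumes "locally_lipschitz U f" "locally_lipschitz U g"
  shows "locally_lipschitz U (\<lambda>x. (f x, g x))"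
  unfolding locally_lipschitz_def
proof
  fix x assume "x \<in> U"
  then obtain e K L where "0 < e" "K-lipschitz_on (cball x e) f" "L-lipschitz_on (cball x e) g"
    using locally_lipschitz_common_ball[OF assms] by blast
  then show "\<exists>e>0. \<exists>L. L-lipschitz_on (cball x e) (\<lambda>x. (f x, g x))"
    using lipschitz_on_Pair by blast
qed

lemma locally_lipschitz_scaleR:
  fixes f :: "'a::metric_space \<Rightarrow> real" and g :: "'a \<Rightarrow> 'b::real_normed_vector"
  assumes "locally_lipschitz U f" "locally_lipschitz U g"
  shows "locally_lipschitz U (\<lambda>x. f x *\<^sub>R g x)"
  unfolding locally_lipschitz_def
proof
  fix x assume "x \<in> U"
  then obtain e K L where e: "0 < e" "K-lipschitz_on (cball x e) f" "L-lipschitz_on (cball x e) g"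
    using locally_lipschitz_common_ball[OF assms] by blast
  have KL: "0 \<le> K" "0 \<le> L" using e lipschitz_on_nonneg by blast+
  define A where "A = \<bar>f x\<bar> + K * e"
  define B where "B = norm (g x) + L * e"
  have A: "\<bar>f y\<bar> \<le> A" if "y \<in> cball x e" for y
  proof -
    have "\<bar>f y\<bar> \<le> \<bar>f x\<bar> + \<bar>f y - f x\<bar>" by simp
    also have "\<bar>f y - f x\<bar> \<le> K * dist y x"
      using lipschitz_onD[OF e(2), of y x] that e(1) by (simp add: dist_real_def)
    also have "\<dots> \<le> K * e" using that KL by (intro mult_left_mono) (auto simp: dist_commute)
    finally show ?thesis by (simp add: A_def)
  qed
  have B: "norm (g y) \<le> B" if "y \<in> cball x e" for y
  proof -
    have "norm (g y) \<le> norm (g x) + norm (g y - g x)" by (rule norm_triangle_sub)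
    also have "norm (g y - g x) \<le> L * dist y x"
      using lipschitz_onD[OF e(3), of y x] that e(1) by (simp add: dist_norm)
    also have "\<dots> \<le> L * e" using that KL by (intro mult_left_mono) (auto simp: dist_commute)
    finally show ?thesis by (simp add: B_def)
  qed
  have AB: "0 \<le> A" "0 \<le> B" using KL e(1) by (auto simp: A_def B_def)
  have "(A * L + B * K)-lipschitz_on (cball x e) (\<lambda>x. f x *\<^sub>R g x)"
  proof (rule lipschitz_onI)
    fix y z assume yz: "y \<in> cball x e" "z \<in> cball x e"
    have "f y *\<^sub>R g y - f z *\<^sub>R g z = f y *\<^sub>R (g y - g z) + (f y - f z) *\<^sub>R g z"
      by (simp add: algebra_simps)
    then have "dist (f y *\<^sub>R g y) (f z *\<^sub>R g z) \<le> \<bar>f y\<bar> * dist (g y) (g z) + dist (f y) (f z) * norm (g z)"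
      by (metis dist_norm norm_scaleR norm_triangle_ineq real_norm_def)
    also have "\<dots> \<le> A * (L * dist y z) + (K * dist y z) * B"
      using A[OF yz(1)] B[OF yz(2)] lipschitz_onD[OF e(2) yz] lipschitz_onD[OF e(3) yz] AB KL
      by (intro add_mono mult_mono) auto
    finally show "dist (f y *\<^sub>R g y) (f z *\<^sub>R g z) \<le> (A * L + B * K) * dist y z"
      by (simp add: algebra_simps)
  qed (use AB KL in simp)
  then show "\<exists>e>0. \<exists>L. L-lipschitz_on (cball x e) (\<lambda>x. f x *\<^sub>R g x)"
    using e(1) by blast
qed

lemma locally_lipschitz_sum:
  fixes f :: "'i \<Rightarrow> 'a::metric_space \<Rightarrow> 'b::real_normed_vector"
  assumes "\<And>i. i \<in> A \<Longrightarrow> locally_lipschitz U (f i)"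
  shows "locally_lipschitz U (\<lambda>x. \<Sum>i\<in>A. f i x)"
  using assms
proof (induction A rule: infinite_finite_induct)
  case (insert i A)
  then show ?case by (simp add: locally_lipschitz_add)
qed (simp_all add: locally_lipschitzI_lipschitz[OF lipschitz_on_constant])

lemma locally_lipschitz_fst:
  assumes "locally_lipschitz U f"
  shows "locally_lipschitz (U \<times> V) (\<lambda>q. f (fst q))"
  unfolding locally_lipschitz_def
proof
  fix q assume "q \<in> U \<times> V"
  then have "fst q \<in> U" by auto
  then obtain e L where e: "0 < e" "L-lipschitz_on (cball (fst q) e) f"
    using assms unfolding locally_lipschitz_def by blast
  have "fst ` cball q e \<subseteq> cball (fst q) e"
  proof
    fix x assume "x \<in> fst ` cball q e"
    then obtain q' where "x = fst q'" "dist q q' \<le> e" by auto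
    then show "x \<in> cball (fst q) e" using dist_fst_le[of q q'] by simp
  qed
  then have "L-lipschitz_on (fst ` cball q e) f"
    by (rule lipschitz_on_subset[OF e(2)])
  moreover have "1-lipschitz_on (cball q e) fst"
    by (rule lipschitz_onI) (simp_all add: dist_fst_le)
  ultimately have "L-lipschitz_on (cball q e) (\<lambda>q. f (fst q))"
    using lipschitz_on_compose2[of 1 "cball q e" fst L f] by simp
  then show "\<exists>e>0. \<exists>L. L-lipschitz_on (cball q e) (\<lambda>q. f (fst q))"
    using e(1) by blast
qed

lemma locally_lipschitz_continuous_on:
  assumes "locally_lipschitz U f"
  shows "continuous_on U f"
proof -
  have "isCont f x" if x: "x \<in> U" for x
  proof -
    obtain e L where e: "0 < e" "L-lipschitz_on (cball x e) f"
      using assms x unfolding locally_lipschitz_def by blast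
    then have "continuous_on (ball x e) f"
      using lipschitz_on_continuous_on lipschitz_on_subset ball_subset_cball by blast
    then show ?thesis using e(1) by (simp add: continuous_on_eq_continuous_at)
  qed
  then show ?thesis by (simp add: continuous_at_imp_continuous_on)
qed

lemma locally_lipschitz_cong:
  assumes "locally_lipschitz U f" "open U" and eq: "\<And>x. x \<in> U \<Longrightarrow> f x = g x"
  shows "locally_lipschitz U g"
  unfolding locally_lipschitz_def
proof
  fix x assume "x \<in> U"
  then obtain d e L where d: "0 < d" "cball x d \<subseteq> U" and e: "0 < e" "L-lipschitz_on (cball x e) f"
    using assms(1,2) unfolding open_contains_cball locally_lipschitz_def by meson
  have "L-lipschitz_on (cball x (min d e)) f"
    by (rule lipschitz_on_subset[OF e(2)]) auto
  moreover have "f y = g y" if "y \<in> cball x (min d e)" for y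
    using eq d(2) that by auto
  ultimately have "L-lipschitz_on (cball x (min d e)) g"
    by (simp add: lipschitz_on_def)
  then show "\<exists>e>0. \<exists>L. L-lipschitz_on (cball x e) g"
    using d(1) e(1) by (intro exI[of _ "min d e"]) auto
qed


section \<open>Completeness of geodesics with bounded velocity\<close>

text \<open>The first-order form of the geodesic equation, on pairs of a position and a velocity.\<close>

definition geodesic_field :: "'n::finite metric \<Rightarrow> (real ^ 'n) \<times> (real ^ 'n) \<Rightarrow> (real ^ 'n) \<times> (real ^ 'n)" where
  "geodesic_field g q = (snd q, \<chi> k. - (\<Sum>i\<in>UNIV. \<Sum>j\<in>UNIV.
       christoffel g k i j (fst q) * snd q $ i * snd q $ j))"

lemma geodesic_field_locally_lipschitz:
  fixes g :: "'n::finite metric"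
  assumes "\<And>k i j. locally_lipschitz U (christoffel g k i j)"
  shows "locally_lipschitz (U \<times> UNIV) (geodesic_field g)"
proof -
  have nth: "locally_lipschitz (U \<times> UNIV) (\<lambda>q :: (real ^ 'n) \<times> (real ^ 'n). snd q $ i)" for i
    by (rule locally_lipschitz_bounded_linear[OF
          bounded_linear_compose[OF bounded_linear_vec_nth bounded_linear_snd]])
  have const: "locally_lipschitz (U \<times> UNIV) (\<lambda>_. c)" for c :: "real ^ 'n"
    by (rule locally_lipschitzI_lipschitz[OF lipschitz_on_constant])
  have field: "geodesic_field g = (\<lambda>q. (snd q, \<Sum>k\<in>UNIV. (\<Sum>i\<in>UNIV. \<Sum>j\<in>UNIV.
      christoffel g k i j (fst q) *\<^sub>R (snd q $ i *\<^sub>R snd q $ j)) *\<^sub>R - axis k 1))"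
  proof -
    have "(\<chi> k. - f k) = (\<Sum>k\<in>UNIV. f k *\<^sub>R - axis k 1)" for f :: "'n \<Rightarrow> real"
      using basis_expansion[of "\<chi> k. - f k"] by (simp add: scalar_mult_eq_scaleR)
    then show ?thesis by (simp add: geodesic_field_def fun_eq_iff mult.assoc)
  qed
  show ?thesis
    unfolding field
    by (intro locally_lipschitz_Pair locally_lipschitz_bounded_linear bounded_linear_snd locally_lipschitz_sum
        locally_lipschitz_scaleR locally_lipschitz_fst assms nth const)
qed

lemma geodesic_imp_field:
  assumes "geodesic g U I \<gamma>" "s \<in> I"
  shows "((\<lambda>s. (\<gamma> s, velocity \<gamma> s)) has_vector_derivative geodesic_field g (\<gamma> s, velocity \<gamma> s)) (at s)"
  using has_vector_derivative_Pair[OF geodesic_velocity[OF assms]] by (simp add: geodesic_field_def)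

lemma field_imp_geodesic:
  assumes J: "open J" "is_interval J" "J \<noteq> {}"
    and w: "\<And>s. s \<in> J \<Longrightarrow> (w has_vector_derivative geodesic_field g (w s)) (at s)"
    and U: "\<And>s. s \<in> J \<Longrightarrow> fst (w s) \<in> U"
  shows "geodesic g U J (\<lambda>s. fst (w s))"
proof -
  have 1: "((\<lambda>s. fst (w s)) has_vector_derivative snd (w s)) (at s)" if "s \<in> J" for s
    using bounded_linear.has_vector_derivative[OF bounded_linear_fst w[OF that]]
    by (simp add: geodesic_field_def)
  have vel: "velocity (\<lambda>s. fst (w s)) s = snd (w s)" if "s \<in> J" for s
    unfolding velocity_def using vector_derivative_at[OF 1[OF that]] .
  have 2: "(velocity (\<lambda>s. fst (w s)) has_vector_derivative snd (geodesic_field g (w s))) (at s)"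
    if "s \<in> J" for s
    by (rule has_vector_derivative_transform_within_open[OF
          bounded_linear.has_vector_derivative[OF bounded_linear_snd w[OF that]] J(1) that])
       (simp add: vel)
  show ?thesis
    unfolding geodesic_def
  proof (intro conjI ballI allI J)
    show "(\<lambda>s. fst (w s)) ` J \<subseteq> U" using U by auto
    fix s k assume s: "s \<in> J"
    show "(\<lambda>s. fst (w s)) differentiable at s"
      using 1[OF s] by (rule differentiableI_vector)
    show "velocity (\<lambda>s. fst (w s)) differentiable at s"
      using 2[OF s] by (rule differentiableI_vector)
    show "vector_derivative (velocity (\<lambda>s. fst (w s))) (at s) $ k
        + (\<Sum>i\<in>UNIV. \<Sum>j\<in>UNIV. christoffel g k i j (fst (w s))
            * velocity (\<lambda>s. fst (w s)) s $ i * velocity (\<lambda>s. fst (w s)) s $ j) = 0"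
      using vector_derivative_at[OF 2[OF s]] by (simp add: vel[OF s] geodesic_field_def)
  qed
qed

text \<open>The solution of the first-order system through the limit \<open>(p, v)\<close> would continue the geodesic beyond
  \<open>b\<close>.\<close>

lemma inextendible_geodesic_no_limit:
  fixes g :: "'n::finite metric"
  assumes inext: "inextendible_geodesic g U I \<gamma>" and "open U"
    and field: "locally_lipschitz (U \<times> UNIV) (geodesic_field g)"
    and I: "s0 < b" "{s0<..<b} \<subseteq> I" "\<And>s. s \<in> I \<Longrightarrow> s < b"
    and lim: "(\<gamma> \<longlongrightarrow> p) (at_left b)" "p \<in> U" "(velocity \<gamma> \<longlongrightarrow> v) (at_left b)"
  shows False
proof -
  have geo: "geodesic g U I \<gamma>" using inext by (simp add: inextendible_geodesic_def)
  then have opI: "open I" and intI: "is_interval I" and neI: "I \<noteq> {}" and rangeI: "\<gamma> ` I \<subseteq> U"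
    by (auto simp: geodesic_def)
  define u where "u s = (\<gamma> s, velocity \<gamma> s)" for s
  have u: "(u has_vector_derivative geodesic_field g (u s)) (at s)" if "s \<in> I" for s
    unfolding u_def using geodesic_imp_field[OF geo that] .
  have limu: "(u \<longlongrightarrow> (p, v)) (at_left b)"
    unfolding u_def by (intro tendsto_Pair lim)
  obtain e1 L where e1: "0 < e1" "L-lipschitz_on (cball (p, v) e1) (geodesic_field g)"
    using field lim(2) unfolding locally_lipschitz_def by (metis SigmaI UNIV_I)
  obtain e2 where e2: "0 < e2" "cball (p, v) e2 \<subseteq> U \<times> UNIV"
    using open_contains_cball[of "U \<times> (UNIV :: (real ^ 'n) set)"] \<open>open U\<close> lim(2)
    by (metis SigmaI UNIV_I open_Times open_UNIV)
  define e where "e = min e1 e2"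
  have e: "0 < e" "L-lipschitz_on (cball (p, v) e) (geodesic_field g)" "cball (p, v) e \<subseteq> U \<times> UNIV"
    using e1 e2 by (auto simp: e_def intro: lipschitz_on_subset)
  have usol: "(u has_vector_derivative geodesic_field g (u s)) (at s)" if "s \<in> {s0<..<b}" for s
    using u that I(2) by blast
  obtain w h where wh: "0 < h" "\<And>s. s < b \<Longrightarrow> w s = u s"
    "\<And>s. s \<in> {s0<..<b+h} \<Longrightarrow> (w has_vector_derivative geodesic_field g (w s)) (at s)"
    "\<And>s. s \<in> {b..<b+h} \<Longrightarrow> w s \<in> cball (p, v) e"
    by (rule ODE_solution_extends[OF usol I(1) limu e(1,2)]) blast+
  define J where "J = I \<union> {s0<..<b+h}"
  have "geodesic g U J (\<lambda>s. fst (w s))"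
  proof (rule field_imp_geodesic)
    show "open J" unfolding J_def using opI by auto
    show "J \<noteq> {}" unfolding J_def using neI by auto
    have "(s0 + b) / 2 \<in> I \<inter> {s0<..<b+h}" using I(1,2) wh(1) by auto
    then have "connected (I \<union> {s0<..<b+h})"
      using intI by (intro connected_Un) (auto simp: is_interval_connected)
    then show "is_interval J" by (simp add: J_def is_interval_connected_1)
    fix s assume s: "s \<in> J"
    show "(w has_vector_derivative geodesic_field g (w s)) (at s)"
    proof (cases "s \<in> {s0<..<b+h}")
      case False
      then have sI: "s \<in> I" using s unfolding J_def by blast
      have "(w has_vector_derivative geodesic_field g (u s)) (at s)"
        by (rule has_vector_derivative_transform_within_open[OF u[OF sI] opI sI])
           (use wh(2) I(3) in auto)
      then show ?thesis using wh(2) I(3) sI by simp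
    qed (rule wh(3))
    show "fst (w s) \<in> U"
    proof (cases "s < b")
      case True
      then have "s \<in> I" using s I(2) by (auto simp: J_def)
      then show ?thesis using True rangeI by (auto simp: wh(2) u_def)
    next
      case False
      then have "w s \<in> cball (p, v) e" using s I(3) by (intro wh(4)) (auto simp: J_def)
      then show ?thesis using e(3) by auto
    qed
  qed
  moreover have "I \<subseteq> J" by (simp add: J_def)
  moreover have "\<forall>s\<in>I. fst (w s) = \<gamma> s" using wh(2) I(3) by (simp add: u_def)
  ultimately have "J = I" using inext unfolding inextendible_geodesic_def by blast
  moreover have "b \<in> J" unfolding J_def using I(1) wh(1) by simp
  ultimately show False using I(3) by blast
qed

lemma bounded_derivative_imp_limit_at_left:
  fixes f :: "real \<Rightarrow> 'a::euclidean_space"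
  assumes "a < b" and der: "\<And>s. s \<in> {a<..<b} \<Longrightarrow> (f has_vector_derivative f' s) (at s)"
    and bnd: "\<And>s. s \<in> {a<..<b} \<Longrightarrow> norm (f' s) \<le> B"
  obtains l where "(f \<longlongrightarrow> l) (at_left b)"
proof -
  have "norm (f' ((a + b) / 2)) \<le> B" using \<open>a < b\<close> by (intro bnd) auto
  then have B: "0 \<le> B" using norm_ge_zero order_trans by blast
  have "B-lipschitz_on {a<..<b} f"
  proof (rule bounded_derivative_imp_lipschitz)
    show "(f has_derivative (\<lambda>t. t *\<^sub>R f' s)) (at s within {a<..<b})" if "s \<in> {a<..<b}" for s
      using has_vector_derivative_at_within[OF der[OF that]] by (simp add: has_vector_derivative_def)
    show "onorm (\<lambda>t. t *\<^sub>R f' s) \<le> B" if "s \<in> {a<..<b}" for s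
      using bnd[OF that] B by (intro onorm_le) (simp add: mult.commute[of B] mult_left_mono)
  qed (use B in auto)
  then have "uniformly_continuous_on {a<..<b} f" by (rule lipschitz_on_uniformly_continuous)
  moreover have "b \<in> closure {a<..<b}" using \<open>a < b\<close> by simp
  ultimately obtain l where "(f \<longlongrightarrow> l) (at b within {a<..<b})"
    by (rule uniformly_continuous_on_extension_at_closure)
  moreover have "at b within {a<..<b} = at_left b"
    using \<open>a < b\<close> by (intro at_within_nhd[of _ "{a<..}"]) auto
  ultimately show ?thesis using that by simp
qed

text \<open>A bounded velocity gives a limit of the position at the end \<open>b\<close> of the interval. Near this limit the
  position and the velocity range over a compact set, so the acceleration is bounded as well, and the velocity
  converges too.\<close>

lemma bounded_velocity_imp_not_bdd_above:
  fixes g :: "'n::finite metric"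
  assumes inext: "inextendible_geodesic g U I \<gamma>" and U: "open U"
    and field: "locally_lipschitz (U \<times> UNIV) (geodesic_field g)"
    and Z: "closed Z" "Z \<subseteq> U" "\<gamma> ` I \<subseteq> Z"
    and B: "\<And>s. s \<in> I \<Longrightarrow> norm (velocity \<gamma> s) \<le> B"
  shows "\<not> bdd_above I"
proof
  assume bdd: "bdd_above I"
  have geo: "geodesic g U I \<gamma>" using inext by (simp add: inextendible_geodesic_def)
  then have opI: "open I" and intI: "is_interval I" and neI: "I \<noteq> {}"
    by (auto simp: geodesic_def)
  define b where "b = Sup I"
  have le_b: "s \<le> b" if "s \<in> I" for s unfolding b_def using that bdd by (rule cSup_upper)
  have less_b: "s < b" if s: "s \<in> I" for s
  proof -
    obtain e where "e > 0" "ball s e \<subseteq> I" using openE[OF opI s] .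
    then have "s + e / 2 \<in> I" by (auto simp: dist_real_def)
    then show ?thesis using le_b[of "s + e / 2"] \<open>e > 0\<close> by simp
  qed
  obtain s0 where s0: "s0 \<in> I" using neI by blast
  have sub: "{s0<..<b} \<subseteq> I"
  proof
    fix s assume "s \<in> {s0<..<b}"
    moreover then obtain t where "t \<in> I" "s < t"
      using less_cSup_iff[OF neI bdd] by (auto simp: b_def)
    ultimately show "s \<in> I" using mem_is_interval_1_I[OF intI s0, of t s] by simp
  qed
  note vel = geodesic_velocity[OF geo]
  obtain p where p: "(\<gamma> \<longlongrightarrow> p) (at_left b)"
    using bounded_derivative_imp_limit_at_left[OF less_b[OF s0], of \<gamma> "velocity \<gamma>" B] vel(1) B sub
    by blast
  have evI: "\<forall>\<^sub>F s in at_left b. s \<in> {s0<..<b}"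
    unfolding eventually_at_left[OF less_b[OF s0]] using less_b[OF s0] by auto
  have "\<forall>\<^sub>F s in at_left b. \<gamma> s \<in> Z"
    by (rule eventually_mono[OF evI]) (use sub Z(3) in blast)
  then have "p \<in> Z"
    by (rule Lim_in_closed_set[OF Z(1) _ _ p]) simp
  then have "p \<in> U" using Z(2) by blast
  then obtain e where e: "e > 0" "cball p e \<subseteq> U"
    using U open_contains_cball by blast
  have "continuous_on (cball p e \<times> cball 0 B) (geodesic_field g)"
    using e(2) by (intro continuous_on_subset[OF locally_lipschitz_continuous_on[OF field]]) auto
  then have "compact (geodesic_field g ` (cball p e \<times> cball 0 B))"
    by (intro compact_continuous_image compact_Times compact_cball)
  then have "bounded (geodesic_field g ` (cball p e \<times> cball 0 B))"
    by (rule compact_imp_bounded)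
  then obtain A where A: "\<And>q. q \<in> cball p e \<times> cball 0 B \<Longrightarrow> norm (geodesic_field g q) \<le> A"
    unfolding bounded_iff by blast
  have "\<forall>\<^sub>F s in at_left b. dist (\<gamma> s) p < e" using p e(1) by (rule tendstoD)
  then obtain s1 where s1: "s1 < b" "\<And>s. s1 < s \<Longrightarrow> s < b \<Longrightarrow> dist (\<gamma> s) p < e"
    unfolding eventually_at_left[OF less_b[OF s0]] by blast
  define s2 where "s2 = max s0 s1"
  have s2: "s2 < b" using s1(1) less_b[OF s0] by (simp add: s2_def)
  obtain q where q: "((\<lambda>s. (\<gamma> s, velocity \<gamma> s)) \<longlongrightarrow> q) (at_left b)"
  proof (rule bounded_derivative_imp_limit_at_left[OF s2])
    fix s assume s: "s \<in> {s2<..<b}"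
    then have "s \<in> I" using sub by (auto simp: s2_def)
    then show "((\<lambda>s. (\<gamma> s, velocity \<gamma> s)) has_vector_derivative geodesic_field g (\<gamma> s, velocity \<gamma> s)) (at s)"
      by (rule geodesic_imp_field[OF geo])
    show "norm (geodesic_field g (\<gamma> s, velocity \<gamma> s)) \<le> A"
      using B[OF \<open>s \<in> I\<close>] s1(2)[of s] s by (intro A) (auto simp: s2_def dist_commute less_imp_le)
  qed
  have "(velocity \<gamma> \<longlongrightarrow> snd q) (at_left b)"
    using tendsto_snd[OF q] by simp
  then show False
    using inextendible_geodesic_no_limit[OF inext U field less_b[OF s0] sub less_b p \<open>p \<in> U\<close>] by blast
qed

lemma velocity_reverse:
  assumes "geodesic g U I \<gamma>" "s \<in> uminus ` I"
  shows "velocity (\<lambda>s. \<gamma> (- s)) s = - velocity \<gamma> (- s)"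
proof -
  have "(uminus has_vector_derivative - 1) (at s)"
    by (auto intro!: derivative_eq_intros)
  moreover have "(\<gamma> has_vector_derivative velocity \<gamma> (- s)) (at (- s))"
    using assms by (intro geodesic_velocity(1)) auto
  ultimately show ?thesis
    unfolding velocity_def[of "\<lambda>s. \<gamma> (- s)"]
    using vector_diff_chain_at[of uminus "-1" s \<gamma>] by (auto intro!: vector_derivative_at simp: o_def)
qed

lemma geodesic_reverse:
  assumes geo: "geodesic g U I \<gamma>"
  shows "geodesic g U (uminus ` I) (\<lambda>s. \<gamma> (- s))"
proof -
  let ?w = "\<lambda>s. (\<gamma> (- s), - velocity \<gamma> (- s))"
  have "geodesic g U (uminus ` I) (\<lambda>s. fst (?w s))"
  proof (rule field_imp_geodesic)
    show "open (uminus ` I)" "is_interval (uminus ` I)" "uminus ` I \<noteq> {}"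
      using geo by (auto simp: geodesic_def open_negations)
    fix s assume "s \<in> uminus ` I"
    then have s: "- s \<in> I" by auto
    show "fst (?w s) \<in> U" using geo s by (auto simp: geodesic_def)
    have neg: "(uminus has_vector_derivative - 1) (at s)"
      by (auto intro!: derivative_eq_intros)
    have "((\<gamma> \<circ> uminus) has_vector_derivative - 1 *\<^sub>R velocity \<gamma> (- s)) (at s)"
      by (rule vector_diff_chain_at[OF neg geodesic_velocity(1)[OF geo s]])
    moreover have "((velocity \<gamma> \<circ> uminus) has_vector_derivative
        - 1 *\<^sub>R snd (geodesic_field g (\<gamma> (- s), velocity \<gamma> (- s)))) (at s)"
      using vector_diff_chain_at[OF neg geodesic_velocity(2)[OF geo s]] by (simp add: geodesic_field_def)
    ultimately show "(?w has_vector_derivative geodesic_field g (?w s)) (at s)"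
      by (auto simp: geodesic_field_def o_def intro!: derivative_eq_intros)
  qed
  then show ?thesis by simp
qed

lemma inextendible_geodesic_reverse:
  assumes "inextendible_geodesic g U I \<gamma>"
  shows "inextendible_geodesic g U (uminus ` I) (\<lambda>s. \<gamma> (- s))"
  unfolding inextendible_geodesic_def
proof (intro conjI allI impI)
  show "geodesic g U (uminus ` I) (\<lambda>s. \<gamma> (- s))"
    using assms by (simp add: inextendible_geodesic_def geodesic_reverse)
  fix J \<delta>
  assume "geodesic g U J \<delta> \<and> uminus ` I \<subseteq> J \<and> (\<forall>s\<in>uminus ` I. \<delta> s = \<gamma> (- s))"
  then have \<delta>: "geodesic g U J \<delta>" "uminus ` I \<subseteq> J" "\<forall>s\<in>I. \<delta> (- s) = \<gamma> s"
    by auto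
  have "x \<in> uminus ` J" if "x \<in> I" for x
    using \<delta>(2) that by (intro image_eqI[of _ _ "- x"]) auto
  then have "I \<subseteq> uminus ` J" by blast
  then have "uminus ` J = I"
    using assms geodesic_reverse[OF \<delta>(1)] \<delta>(3) unfolding inextendible_geodesic_def by blast
  then show "J = uminus ` I" by (auto simp: image_image)
qed

text \<open>The lower end of the interval is the upper end for the reversed geodesic.\<close>

lemma inextendible_bounded_velocity_complete:
  fixes g :: "'n::finite metric"
  assumes inext: "inextendible_geodesic g U I \<gamma>" and U: "open U"
    and field: "locally_lipschitz (U \<times> UNIV) (geodesic_field g)"
    and Z: "closed Z" "Z \<subseteq> U" "\<gamma> ` I \<subseteq> Z"
    and B: "\<And>s. s \<in> I \<Longrightarrow> norm (velocity \<gamma> s) \<le> B"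
  shows "I = UNIV"
proof -
  have geo: "geodesic g U I \<gamma>" using inext by (simp add: inextendible_geodesic_def)
  have above: "\<not> bdd_above I"
    by (rule bounded_velocity_imp_not_bdd_above[OF assms])
  have "\<not> bdd_above (uminus ` I)"
    by (rule bounded_velocity_imp_not_bdd_above[OF inextendible_geodesic_reverse[OF inext] U field Z(1,2),
          of B])
       (use Z(3) B in \<open>auto simp: velocity_reverse[OF geo]\<close>)
  then have below: "\<not> bdd_below I" by simp
  have "s \<in> I" for s
  proof -
    obtain x y where "x \<in> I" "y \<in> I" "x < s" "s < y"
      using above below unfolding bdd_above_def bdd_below_def by (meson not_le)
    then show ?thesis using mem_is_interval_1_I[of I x y s] geo by (simp add: geodesic_def)
  qed
  then show ?thesis by auto
qed


section \<open>Elementary functions of the coordinates and the radius\<close>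

text \<open>The class is closed under partial derivatives, and its members are locally Lipschitz. So as soon as the
  coefficients of the metric and of its inverse belong to it, the Christoffel symbols have the regularity that
  Picard's theorem asks for, without any of them being computed.\<close>

inductive elementary :: "(real ^ 4) set \<Rightarrow> (real ^ 4 \<Rightarrow> real) \<Rightarrow> bool" for U where
  elementary_const: "elementary U (\<lambda>_. c)"
| elementary_nth: "elementary U (\<lambda>p. p $ i)"
| elementary_BL_r: "elementary U BL_r"
| elementary_add: "elementary U f \<Longrightarrow> elementary U g \<Longrightarrow> elementary U (\<lambda>p. f p + g p)"
| elementary_mult: "elementary U f \<Longrightarrow> elementary U g \<Longrightarrow> elementary U (\<lambda>p. f p * g p)"
| elementary_inverse: "elementary U f \<Longrightarrow> (\<And>p. p \<in> U \<Longrightarrow> f p \<noteq> 0) \<Longrightarrow> elementary U (\<lambda>p. inverse (f p))"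

lemma elementary_uminus: "elementary U f \<Longrightarrow> elementary U (\<lambda>p. - f p)"
  using elementary_mult[OF elementary_const[of U "-1"], of f] by simp

lemma elementary_diff: "elementary U f \<Longrightarrow> elementary U g \<Longrightarrow> elementary U (\<lambda>p. f p - g p)"
  using elementary_add[OF _ elementary_uminus, of U f g] by simp

lemma elementary_divide:
  "elementary U f \<Longrightarrow> elementary U g \<Longrightarrow> (\<And>p. p \<in> U \<Longrightarrow> g p \<noteq> 0) \<Longrightarrow> elementary U (\<lambda>p. f p / g p)"
  using elementary_mult[OF _ elementary_inverse, of U f g] by (simp add: divide_inverse)

lemma elementary_power: "elementary U f \<Longrightarrow> elementary U (\<lambda>p. f p ^ n)"
  by (induction n) (simp_all add: elementary_const elementary_mult)

lemma elementary_sum: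
  "(\<And>i. i \<in> A \<Longrightarrow> elementary U (f i)) \<Longrightarrow> elementary U (\<lambda>p. \<Sum>i\<in>A. f i p)"
  by (induction A rule: infinite_finite_induct) (simp_all add: elementary_const elementary_add)

lemmas elementary_intros = elementary_const elementary_nth elementary_BL_r elementary_add
  elementary_diff elementary_uminus elementary_mult elementary_divide elementary_power elementary_sum

lemma has_derivative_vec_nth: "((\<lambda>q :: real ^ 'n. q $ i) has_derivative (\<lambda>h. h $ i)) F"
  by (rule bounded_linear_imp_has_derivative[OF bounded_linear_vec_nth])

lemma has_derivative_BL_r:
  assumes "0 < BL_r p"
  shows "(BL_r has_derivative (\<lambda>h. (p $ 2 * h $ 2 + p $ 3 * h $ 3 + p $ 4 * h $ 4) / BL_r p)) (at p)"
proof -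
  have pos: "0 < (p $ 2)\<^sup>2 + (p $ 3)\<^sup>2 + (p $ 4)\<^sup>2"
    using assms by (simp add: BL_r_def)
  have "((\<lambda>q. (q $ 2)\<^sup>2 + (q $ 3)\<^sup>2 + (q $ 4)\<^sup>2) has_derivative
      (\<lambda>h. 2 * (p $ 2 * h $ 2 + p $ 3 * h $ 3 + p $ 4 * h $ 4))) (at p)"
    by (auto intro!: derivative_eq_intros has_derivative_vec_nth simp: algebra_simps)
  from has_derivative_real_sqrt[OF pos this]
  show ?thesis
    unfolding BL_r_def[abs_def]
  proof (rule has_derivative_eq_rhs, intro ext)
    fix h :: "real ^ 4"
    have cancel: "2 * x * (inverse s / 2) = x / s" for x s :: real
      by (simp add: field_simps)
    show "2 * (p $ 2 * h $ 2 + p $ 3 * h $ 3 + p $ 4 * h $ 4)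
          * (inverse (sqrt ((p $ 2)\<^sup>2 + (p $ 3)\<^sup>2 + (p $ 4)\<^sup>2)) / 2)
        = (p $ 2 * h $ 2 + p $ 3 * h $ 3 + p $ 4 * h $ 4)
          / sqrt ((p $ 2)\<^sup>2 + (p $ 3)\<^sup>2 + (p $ 4)\<^sup>2)"
      by (rule cancel)
  qed
qed

lemma elementary_has_derivative:
  assumes "elementary U f" and pos: "\<And>p. p \<in> U \<Longrightarrow> 0 < BL_r p"
  shows "\<exists>D. (\<forall>i. elementary U (D i)) \<and>
    (\<forall>p\<in>U. (f has_derivative (\<lambda>h. \<Sum>i\<in>UNIV. D i p * h $ i)) (at p))"
  using assms(1)
proof induction
  case (elementary_const c)
  show ?case
    by (rule exI[of _ "\<lambda>_ _. 0"]) (simp add: elementary_intros)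
next
  case (elementary_nth j)
  have "(\<Sum>i\<in>UNIV. (if i = j then 1 else 0) * h $ i) = h $ j" for h :: "real ^ 4"
    by (simp add: mult_delta_left)
  then show ?case
    by (intro exI[of _ "\<lambda>i _. if i = j then 1 else 0"])
       (auto intro: has_derivative_vec_nth elementary_intros)
next
  case elementary_BL_r
  let ?D = "\<lambda>i p. (if i = 1 then 0 else p $ i) / BL_r p"
  have "(\<Sum>i\<in>UNIV. ?D i p * h $ i) = (p $ 2 * h $ 2 + p $ 3 * h $ 3 + p $ 4 * h $ 4) / BL_r p"
    for p h :: "real ^ 4"
    by (simp add: sum_4 add_divide_distrib)
  moreover have "elementary U (?D i)" for i
    using pos by (cases "i = 1") (force intro: elementary_intros)+
  ultimately show ?case
    using has_derivative_BL_r pos by (intro exI[of _ ?D]) auto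
next
  case (elementary_add f g)
  then obtain D E where "\<And>i. elementary U (D i)" "\<And>i. elementary U (E i)"
    "\<And>p. p \<in> U \<Longrightarrow> (f has_derivative (\<lambda>h. \<Sum>i\<in>UNIV. D i p * h $ i)) (at p)"
    "\<And>p. p \<in> U \<Longrightarrow> (g has_derivative (\<lambda>h. \<Sum>i\<in>UNIV. E i p * h $ i)) (at p)"
    by blast
  then show ?case
    by (intro exI[of _ "\<lambda>i p. D i p + E i p"])
       (auto intro!: elementary_intros derivative_eq_intros simp: sum.distrib distrib_right)
next
  case (elementary_mult f g)
  then obtain D E where "\<And>i. elementary U (D i)" "\<And>i. elementary U (E i)"
    "\<And>p. p \<in> U \<Longrightarrow> (f has_derivative (\<lambda>h. \<Sum>i\<in>UNIV. D i p * h $ i)) (at p)"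
    "\<And>p. p \<in> U \<Longrightarrow> (g has_derivative (\<lambda>h. \<Sum>i\<in>UNIV. E i p * h $ i)) (at p)"
    by blast
  then show ?case
    using elementary_mult.hyps
    by (intro exI[of _ "\<lambda>i p. f p * E i p + D i p * g p"])
       (auto intro!: elementary_intros derivative_eq_intros
         simp: sum.distrib distrib_right distrib_left sum_distrib_left sum_distrib_right mult_ac)
next
  case (elementary_inverse f)
  then obtain D where D: "\<And>i. elementary U (D i)"
    "\<And>p. p \<in> U \<Longrightarrow> (f has_derivative (\<lambda>h. \<Sum>i\<in>UNIV. D i p * h $ i)) (at p)"
    by blast
  show ?case
  proof (intro exI conjI allI ballI)
    show "elementary U (\<lambda>p. - (inverse (f p) * D i p * inverse (f p)))" for i
      by (intro elementary_intros elementary.elementary_inverse D elementary_inverse.hyps)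
    fix p assume p: "p \<in> U"
    show "((\<lambda>p. inverse (f p)) has_derivative
        (\<lambda>h. \<Sum>i\<in>UNIV. - (inverse (f p) * D i p * inverse (f p)) * h $ i)) (at p)"
      using Deriv.has_derivative_inverse[OF elementary_inverse.hyps(2)[OF p] D(2)[OF p]]
      by (simp add: sum_distrib_left sum_distrib_right sum_negf mult_ac)
  qed
qed

lemma elementary_differentiable:
  assumes "elementary U f" "\<And>p. p \<in> U \<Longrightarrow> 0 < BL_r p" "p \<in> U"
  shows "f differentiable (at p)"
  using elementary_has_derivative[OF assms(1,2)] assms(3) unfolding differentiable_def by blast

lemma elementary_continuous_on:
  assumes "elementary U f" "\<And>p. p \<in> U \<Longrightarrow> 0 < BL_r p"
  shows "continuous_on U f"
  using elementary_differentiable[OF assms]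
  by (intro continuous_at_imp_continuous_on ballI differentiable_imp_continuous_within)

lemma elementary_partial_deriv:
  assumes "elementary U f" "\<And>p. p \<in> U \<Longrightarrow> 0 < BL_r p"
  obtains f' where "elementary U f'" "\<And>p. p \<in> U \<Longrightarrow> partial_deriv i f p = f' p"
proof -
  obtain D where D: "\<And>i. elementary U (D i)"
    "\<And>p. p \<in> U \<Longrightarrow> (f has_derivative (\<lambda>h. \<Sum>i\<in>UNIV. D i p * h $ i)) (at p)"
    using elementary_has_derivative[OF assms] by blast
  have "partial_deriv i f p = D i p" if "p \<in> U" for p
    using has_derivative_expand_axes(1)[OF D(2)[OF that], of i]
    by (simp add: axis_def mult_delta_right)
  then show ?thesis using that D(1) by blast
qed

text \<open>The partial derivatives are elementary again, hence continuous and bounded on compact balls.\<close>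

lemma elementary_locally_lipschitz:
  assumes f: "elementary U f" and pos: "\<And>p. p \<in> U \<Longrightarrow> 0 < BL_r p" and U: "open U"
  shows "locally_lipschitz U f"
  unfolding locally_lipschitz_def
proof
  fix p assume "p \<in> U"
  then obtain e where e: "0 < e" "cball p e \<subseteq> U"
    using U open_contains_cball by blast
  obtain D where D: "\<And>i. elementary U (D i)"
    "\<And>p. p \<in> U \<Longrightarrow> (f has_derivative (\<lambda>h. \<Sum>i\<in>UNIV. D i p * h $ i)) (at p)"
    using elementary_has_derivative[OF f pos] by blast
  have "\<exists>B. \<forall>q\<in>cball p e. \<bar>D i q\<bar> \<le> B" for i
  proof -
    have "compact (D i ` cball p e)"
      using e(2) elementary_continuous_on[OF D(1) pos]
      by (intro compact_continuous_image compact_cball) (blast intro: continuous_on_subset)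
    then have "bounded (D i ` cball p e)" by (rule compact_imp_bounded)
    then show ?thesis unfolding bounded_iff by simp
  qed
  then obtain B where B: "\<And>i q. q \<in> cball p e \<Longrightarrow> \<bar>D i q\<bar> \<le> B i" by metis
  have B0: "0 \<le> B i" for i using B[of p i] e(1) by auto
  have "(\<Sum>i\<in>UNIV. B i)-lipschitz_on (cball p e) f"
  proof (rule bounded_derivative_imp_lipschitz)
    fix q assume q: "q \<in> cball p e"
    show "(f has_derivative (\<lambda>h. \<Sum>i\<in>UNIV. D i q * h $ i)) (at q within cball p e)"
      using D(2) q e(2) has_derivative_at_withinI by blast
    show "onorm (\<lambda>h. \<Sum>i\<in>UNIV. D i q * h $ i) \<le> (\<Sum>i\<in>UNIV. B i)"
    proof (rule onorm_le)
      fix h :: "real ^ 4"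
      have "norm (\<Sum>i\<in>UNIV. D i q * h $ i) \<le> (\<Sum>i\<in>UNIV. B i * norm h)"
        using B[OF q] B0 component_le_norm_cart[of h]
        by (intro sum_norm_le) (simp add: abs_mult mult_mono)
      then show "norm (\<Sum>i\<in>UNIV. D i q * h $ i) \<le> (\<Sum>i\<in>UNIV. B i) * norm h"
        by (simp add: sum_distrib_right)
    qed
  qed (use B0 in \<open>auto intro: sum_nonneg\<close>)
  then show "\<exists>e>0. \<exists>L. L-lipschitz_on (cball p e) f" using e(1) by blast
qed

lemma christoffel_locally_lipschitz:
  fixes g :: "4 metric"
  assumes U: "open U" and pos: "\<And>p. p \<in> U \<Longrightarrow> 0 < BL_r p"
    and g: "\<And>i j. elementary U (\<lambda>q. metric_matrix g q $ i $ j)"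
    and h: "\<And>i j. elementary U (\<lambda>q. h q $ i $ j)"
    and inv: "\<And>q. q \<in> U \<Longrightarrow> matrix_inv (metric_matrix g q) = h q"
  shows "locally_lipschitz U (christoffel g k i j)"
proof -
  have "\<forall>l i j. \<exists>D. elementary U D \<and>
      (\<forall>p\<in>U. partial_deriv l (\<lambda>q. metric_matrix g q $ i $ j) p = D p)"
    using elementary_partial_deriv[OF g pos] by metis
  then obtain D where D: "\<And>l i j. elementary U (D l i j)"
    "\<And>l i j p. p \<in> U \<Longrightarrow> partial_deriv l (\<lambda>q. metric_matrix g q $ i $ j) p = D l i j p"
    by metis
  let ?c = "\<lambda>p. (\<Sum>l\<in>UNIV. h p $ k $ l * (D i j l p + D j i l p - D l i j p)) / 2"
  have "elementary U ?c"
    by (intro elementary_intros h D(1)) simp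
  then have "locally_lipschitz U ?c"
    by (rule elementary_locally_lipschitz[OF _ pos U])
  then show ?thesis
    by (rule locally_lipschitz_cong[OF _ U]) (simp add: christoffel_def inv D(2))
qed


section \<open>The Kerr metric and its inverse\<close>

text \<open>The covector \<open>g(v, \<cdot>)\<close>, as a vector of coefficients.\<close>

definition Kerr_flat :: "real \<Rightarrow> real \<Rightarrow> real ^ 4 \<Rightarrow> real ^ 4 \<Rightarrow> real ^ 4" where
  "Kerr_flat M a p v =
     (let r = BL_r p; \<rho>2 = Kerr_rho2 a r (p $ 4 / r); \<Delta> = Kerr_Delta M a r; b = 2 * M * r / \<rho>2;
          dr = (p $ 2 * v $ 2 + p $ 3 * v $ 3 + p $ 4 * v $ 4) / r;
          \<sigma> = (p $ 2 * v $ 3 - p $ 3 * v $ 2) / r\<^sup>2;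
          A = (\<rho>2 / \<Delta> - \<rho>2 / r\<^sup>2) * dr / r;
          B = (a\<^sup>2 * (1 + b) * \<sigma> - a * b * v $ 1) / r\<^sup>2
      in vector [- (1 - b) * v $ 1 - a * b * \<sigma>,
           A * p $ 2 + \<rho>2 / r\<^sup>2 * v $ 2 - B * p $ 3,
           A * p $ 3 + \<rho>2 / r\<^sup>2 * v $ 3 + B * p $ 2,
           A * p $ 4 + \<rho>2 / r\<^sup>2 * v $ 4])"

text \<open>This is \<open>r p\<^sub>r\<close>, the momentum paired with the dilation field \<open>(x, y, z)\<close>.\<close>

definition radial_momentum :: "real ^ 4 \<Rightarrow> real ^ 4 \<Rightarrow> real" where
  "radial_momentum p \<pi> = p $ 2 * \<pi> $ 2 + p $ 3 * \<pi> $ 3 + p $ 4 * \<pi> $ 4"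

text \<open>This is \<open>p\<^sub>\<phi>\<close>, the momentum paired with the rotation field \<open>(-y, x, 0)\<close>.\<close>

definition axial_momentum :: "real ^ 4 \<Rightarrow> real ^ 4 \<Rightarrow> real" where
  "axial_momentum p \<pi> = p $ 2 * \<pi> $ 3 - p $ 3 * \<pi> $ 2"

text \<open>The momentum paired with \<open>(r\<^sup>2 + a\<^sup>2) \<partial>\<^sub>t + a \<partial>\<^sub>\<phi>\<close>, which spans with \<open>\<partial>\<^sub>r\<close> the
  plane of the principal null directions.\<close>

definition Kerr_P :: "real \<Rightarrow> real \<Rightarrow> real \<Rightarrow> real \<Rightarrow> real" where
  "Kerr_P a r \<pi>t L = (r\<^sup>2 + a\<^sup>2) * \<pi>t + a * L"

text \<open>The vector with covector \<open>\<pi>\<close>, read off from the inverse metric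
  \<open>\<rho>\<^sup>2 g\<^sup>-\<^sup>1 = \<Delta> \<partial>\<^sub>r\<^sup>2 + \<partial>\<^sub>\<theta>\<^sup>2 + (\<partial>\<^sub>\<phi> + a sin\<^sup>2 \<theta> \<partial>\<^sub>t)\<^sup>2 / sin\<^sup>2 \<theta> - ((r\<^sup>2 + a\<^sup>2) \<partial>\<^sub>t + a \<partial>\<^sub>\<phi>)\<^sup>2 / \<Delta>\<close>.
  Its second and third terms combine to the inverse round metric plus
  \<open>2 a \<partial>\<^sub>t \<partial>\<^sub>\<phi> + a\<^sup>2 sin\<^sup>2 \<theta> \<partial>\<^sub>t\<^sup>2\<close>, which is regular on the axis.\<close>

definition Kerr_sharp :: "real \<Rightarrow> real \<Rightarrow> real ^ 4 \<Rightarrow> real ^ 4 \<Rightarrow> real ^ 4" where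
  "Kerr_sharp M a p \<pi> =
     (let r = BL_r p; \<rho>2 = Kerr_rho2 a r (p $ 4 / r); \<Delta> = Kerr_Delta M a r;
          S = radial_momentum p \<pi>; L = axial_momentum p \<pi>; P = Kerr_P a r (\<pi> $ 1) L;
          \<alpha> = \<Delta> / r\<^sup>2 - 1; \<beta> = a * \<pi> $ 1 - a * P / \<Delta>
      in vector [(a\<^sup>2 * (1 - (p $ 4 / r)\<^sup>2) * \<pi> $ 1 + a * L - (r\<^sup>2 + a\<^sup>2) * P / \<Delta>) / \<rho>2,
           (\<alpha> * S * p $ 2 + r\<^sup>2 * \<pi> $ 2 - \<beta> * p $ 3) / \<rho>2,
           (\<alpha> * S * p $ 3 + r\<^sup>2 * \<pi> $ 3 + \<beta> * p $ 2) / \<rho>2,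
           (\<alpha> * S * p $ 4 + r\<^sup>2 * \<pi> $ 4) / \<rho>2])"

lemma inner_4: "(x :: real ^ 4) \<bullet> y = x $ 1 * y $ 1 + x $ 2 * y $ 2 + x $ 3 * y $ 3 + x $ 4 * y $ 4"
  by (simp add: inner_vec_def sum_4)

lemma Kerr_metric_eq_inner_flat: "Kerr_metric M a p u v = u \<bullet> Kerr_flat M a p v"
proof -
  have [simp]: "x / (r * r\<^sup>2) = x / r ^ 3" "x / (r\<^sup>2 * r) = x / r ^ 3" for x r :: real
    by (simp_all add: power2_eq_square power3_eq_cube)
  show ?thesis
  unfolding Kerr_metric_def Kerr_flat_def Let_def inner_4 vector_4_nth
  by (simp add: algebra_simps add_divide_distrib diff_divide_distrib power2_eq_square)
qed

lemma linear_Kerr_flat: "linear (Kerr_flat M a p)"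
  by (rule linearI)
     (simp_all add: vec_eq_iff forall_4 Kerr_flat_def Let_def vector_4_nth algebra_simps
       add_divide_distrib diff_divide_distrib)

lemma linear_Kerr_sharp: "linear (Kerr_sharp M a p)"
  by (rule linearI)
     (simp_all add: vec_eq_iff forall_4 Kerr_sharp_def Let_def vector_4_nth algebra_simps
       add_divide_distrib diff_divide_distrib radial_momentum_def axial_momentum_def Kerr_P_def)

lemma metric_matrix_Kerr: "metric_matrix (Kerr_metric M a) p = matrix (Kerr_flat M a p)"
  by (simp add: metric_matrix_def matrix_def vec_eq_iff Kerr_metric_eq_inner_flat inner_axis')

lemma Kerr_metric_sym: "Kerr_metric M a p u v = Kerr_metric M a p v u"
  unfolding Kerr_metric_def Let_def by (simp add: algebra_simps)

lemma Kerr_Delta_pos: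
  assumes "0 \<le> a" "a < M" "r_plus M a < r"
  shows "0 < Kerr_Delta M a r"
proof -
  have "a\<^sup>2 \<le> M\<^sup>2" using assms by (intro power_mono) auto
  then have "Kerr_Delta M a r = (r - r_plus M a) * (r - M + sqrt (M\<^sup>2 - a\<^sup>2))"
    unfolding Kerr_Delta_def r_plus_def by (simp add: algebra_simps power2_eq_square)
  moreover have "0 < r - M + sqrt (M\<^sup>2 - a\<^sup>2)"
  proof -
    have "0 \<le> sqrt (M\<^sup>2 - a\<^sup>2)" using \<open>a\<^sup>2 \<le> M\<^sup>2\<close> by simp
    then show ?thesis using assms(3) unfolding r_plus_def by linarith
  qed
  ultimately show ?thesis using assms(3) by simp
qed

lemma Kerr_Delta_r_plus:
  assumes "0 \<le> a" "a < M"
  shows "Kerr_Delta M a (r_plus M a) = 0"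
proof -
  have "a\<^sup>2 \<le> M\<^sup>2" using assms by (intro power_mono) auto
  then show ?thesis
    unfolding Kerr_Delta_def r_plus_def by (simp add: algebra_simps power2_eq_square)
qed

lemma Kerr_rho2_pos: "0 < r \<Longrightarrow> 0 < Kerr_rho2 a r c"
  by (simp add: Kerr_rho2_def add_pos_nonneg)

lemma BL_r_squared: "(BL_r p)\<^sup>2 = (p $ 2)\<^sup>2 + (p $ 3)\<^sup>2 + (p $ 4)\<^sup>2"
  by (simp add: BL_r_def)

text \<open>With \<open>n = (x, y, z) / r\<close> and the rotation field \<open>e = (-y, x, 0)\<close>, the spatial part of the result is a
  combination of \<open>n\<close>, \<open>e\<close> and the spatial part of \<open>v\<close>. The first two coefficients cancel and the third is
  \<open>1\<close>; the key is the value \<open>P = - \<Delta> (v\<^sub>t - a \<sigma>(v))\<close>.\<close>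

lemma Kerr_sharp_flat:
  assumes r: "BL_r p \<noteq> 0" and \<Delta>: "Kerr_Delta M a (BL_r p) \<noteq> 0"
  shows "Kerr_sharp M a p (Kerr_flat M a p v) = v"
proof -
  define r where "r = BL_r p"
  define s2 where "s2 = 1 - (p $ 4 / r)\<^sup>2"
  define \<rho>2 where "\<rho>2 = Kerr_rho2 a r (p $ 4 / r)"
  define \<Delta> where "\<Delta> = Kerr_Delta M a r"
  define b where "b = 2 * M * r / \<rho>2"
  define dr where "dr = (p $ 2 * v $ 2 + p $ 3 * v $ 3 + p $ 4 * v $ 4) / r"
  define \<sigma> where "\<sigma> = (p $ 2 * v $ 3 - p $ 3 * v $ 2) / r\<^sup>2"
  define A where "A = (\<rho>2 / \<Delta> - \<rho>2 / r\<^sup>2) * dr / r"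
  define B where "B = (a\<^sup>2 * (1 + b) * \<sigma> - a * b * v $ 1) / r\<^sup>2"
  define \<pi> where "\<pi> = Kerr_flat M a p v"
  have \<pi>: "\<pi> $ 1 = - (1 - b) * v $ 1 - a * b * \<sigma>"
    "\<pi> $ 2 = A * p $ 2 + \<rho>2 / r\<^sup>2 * v $ 2 - B * p $ 3"
    "\<pi> $ 3 = A * p $ 3 + \<rho>2 / r\<^sup>2 * v $ 3 + B * p $ 2"
    "\<pi> $ 4 = A * p $ 4 + \<rho>2 / r\<^sup>2 * v $ 4"
    unfolding \<pi>_def Kerr_flat_def Let_def vector_4_nth
    by (simp_all add: r_def \<rho>2_def \<Delta>_def b_def dr_def \<sigma>_def A_def B_def)
  have r0: "r \<noteq> 0" and \<Delta>0: "\<Delta> \<noteq> 0" using assms by (simp_all add: r_def \<Delta>_def)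
  have \<rho>0: "\<rho>2 \<noteq> 0"
    using r0 by (simp add: \<rho>2_def Kerr_rho2_def sum_power2_eq_zero_iff flip: power_mult_distrib)
  have r2: "(p $ 2)\<^sup>2 + (p $ 3)\<^sup>2 + (p $ 4)\<^sup>2 = r\<^sup>2" by (simp add: r_def BL_r_squared)
  have s2: "(p $ 2)\<^sup>2 + (p $ 3)\<^sup>2 = r\<^sup>2 * s2"
    using r2 r0 by (simp add: s2_def power_divide right_diff_distrib)
  have \<rho>2: "\<rho>2 = r\<^sup>2 + a\<^sup>2 * (1 - s2)" by (simp add: \<rho>2_def Kerr_rho2_def s2_def)
  have b: "b * \<rho>2 = 2 * M * r" using \<rho>0 by (simp add: b_def)
  have \<Delta>: "\<Delta> = r\<^sup>2 - b * \<rho>2 + a\<^sup>2" by (simp add: \<Delta>_def Kerr_Delta_def b)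
  have S: "radial_momentum p \<pi> = \<rho>2 * r * dr / \<Delta>"
  proof -
    have "radial_momentum p \<pi> = A * ((p $ 2)\<^sup>2 + (p $ 3)\<^sup>2 + (p $ 4)\<^sup>2)
        + \<rho>2 / r\<^sup>2 * (p $ 2 * v $ 2 + p $ 3 * v $ 3 + p $ 4 * v $ 4)"
      unfolding radial_momentum_def \<pi> by algebra
    also have "\<dots> = A * r\<^sup>2 + \<rho>2 / r\<^sup>2 * (r * dr)"
      unfolding r2 dr_def using r0 by simp
    also have "\<dots> = \<rho>2 * r * dr / \<Delta>"
      unfolding A_def using r0 \<Delta>0 by (simp add: field_simps power2_eq_square)
    finally show ?thesis .
  qed
  have L: "axial_momentum p \<pi> = \<rho>2 * \<sigma> + (a\<^sup>2 * (1 + b) * \<sigma> - a * b * v $ 1) * s2"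
  proof -
    have "axial_momentum p \<pi> = \<rho>2 / r\<^sup>2 * (p $ 2 * v $ 3 - p $ 3 * v $ 2) + B * ((p $ 2)\<^sup>2 + (p $ 3)\<^sup>2)"
      unfolding axial_momentum_def \<pi> by algebra
    also have "\<dots> = \<rho>2 * \<sigma> + B * (r\<^sup>2 * s2)"
      unfolding s2 \<sigma>_def by simp
    finally show ?thesis unfolding B_def using r0 by simp
  qed
  have P: "Kerr_P a r (\<pi> $ 1) (axial_momentum p \<pi>) = - \<Delta> * (v $ 1 - a * \<sigma>)"
    unfolding Kerr_P_def L \<pi>(1) \<Delta> \<rho>2 by algebra
  have P\<Delta>: "Kerr_P a r (\<pi> $ 1) (axial_momentum p \<pi>) / \<Delta> = - (v $ 1 - a * \<sigma>)"
    unfolding P using \<Delta>0 by simp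
  define \<alpha> where "\<alpha> = \<Delta> / r\<^sup>2 - 1"
  have \<alpha>: "\<alpha> * (\<rho>2 * r * dr / \<Delta>) = - (r\<^sup>2 * A)"
    unfolding \<alpha>_def A_def using r0 \<Delta>0 by (simp add: field_simps power2_eq_square)
  have \<beta>: "a * \<pi> $ 1 - a * (- (v $ 1 - a * \<sigma>)) = - (r\<^sup>2 * B)"
  proof -
    have "r\<^sup>2 * B = a\<^sup>2 * (1 + b) * \<sigma> - a * b * v $ 1" unfolding B_def using r0 by simp
    then show ?thesis unfolding \<pi>(1) by algebra
  qed
  have t: "a\<^sup>2 * s2 * \<pi> $ 1 + a * axial_momentum p \<pi> - (r\<^sup>2 + a\<^sup>2) * - (v $ 1 - a * \<sigma>) = \<rho>2 * v $ 1"
    unfolding L \<pi>(1) \<rho>2 by algebra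
  have "Kerr_sharp M a p \<pi> = vector
      [(a\<^sup>2 * s2 * \<pi> $ 1 + a * axial_momentum p \<pi> - (r\<^sup>2 + a\<^sup>2) * - (v $ 1 - a * \<sigma>)) / \<rho>2,
       (- (r\<^sup>2 * A) * p $ 2 + r\<^sup>2 * \<pi> $ 2 + r\<^sup>2 * B * p $ 3) / \<rho>2,
       (- (r\<^sup>2 * A) * p $ 3 + r\<^sup>2 * \<pi> $ 3 - r\<^sup>2 * B * p $ 2) / \<rho>2,
       (- (r\<^sup>2 * A) * p $ 4 + r\<^sup>2 * \<pi> $ 4) / \<rho>2]"
    unfolding Kerr_sharp_def Let_def r_def[symmetric] \<rho>2_def[symmetric] \<Delta>_def[symmetric]
      s2_def[symmetric] times_divide_eq_right[symmetric] P\<Delta> S \<alpha>_def[symmetric]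
      \<alpha>[unfolded times_divide_eq_right[symmetric]] \<beta> by simp
  also have "\<dots> = v"
    unfolding vec_eq_iff forall_4 vector_4_nth t \<pi>(2-) using r0 \<rho>0
    by (simp add: distrib_left right_diff_distrib)
  finally show ?thesis by (simp add: \<pi>_def)
qed

lemma Kerr_DOC_pos:
  assumes "0 \<le> a" "a < M" "p \<in> Kerr_DOC M a"
  shows "0 < BL_r p" "0 < Kerr_Delta M a (BL_r p)" "0 < Kerr_rho2 a (BL_r p) c"
proof -
  have "r_plus M a < BL_r p" using assms(3) by (simp add: Kerr_DOC_def)
  then show "0 < BL_r p" "0 < Kerr_Delta M a (BL_r p)"
    using r_plus_pos[OF assms(1,2)] Kerr_Delta_pos[OF assms(1,2)] by auto
  then show "0 < Kerr_rho2 a (BL_r p) c" by (simp add: Kerr_rho2_pos)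
qed

lemma continuous_on_BL_r: "continuous_on A BL_r"
  unfolding BL_r_def by (intro continuous_intros)

lemma open_Kerr_DOC: "open (Kerr_DOC M a)"
  unfolding Kerr_DOC_def by (intro open_Collect_less continuous_on_const continuous_on_BL_r)

lemma Kerr_DOC_nonzero:
  assumes "0 \<le> a" "a < M" "p \<in> Kerr_DOC M a"
  shows "BL_r p \<noteq> 0" "(BL_r p)\<^sup>2 \<noteq> 0" "Kerr_Delta M a (BL_r p) \<noteq> 0"
    "Kerr_rho2 a (BL_r p) (p $ 4 / BL_r p) \<noteq> 0"
  using Kerr_DOC_pos[OF assms] by (force simp: less_le)+

lemma elementary_Kerr_coefficients:
  assumes "0 \<le> a" "a < M"
  shows "elementary (Kerr_DOC M a) (\<lambda>q. Kerr_rho2 a (BL_r q) (q $ 4 / BL_r q))"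
    and "elementary (Kerr_DOC M a) (\<lambda>q. Kerr_Delta M a (BL_r q))"
proof -
  show "elementary (Kerr_DOC M a) (\<lambda>q. Kerr_rho2 a (BL_r q) (q $ 4 / BL_r q))"
    unfolding Kerr_rho2_def by (intro elementary_intros Kerr_DOC_nonzero[OF assms])
  show "elementary (Kerr_DOC M a) (\<lambda>q. Kerr_Delta M a (BL_r q))"
    unfolding Kerr_Delta_def by (intro elementary_intros)
qed

lemma elementary_Kerr_flat:
  assumes "0 \<le> a" "a < M"
  shows "elementary (Kerr_DOC M a) (\<lambda>q. Kerr_flat M a q v $ i)"
  using exhaust_4[of i]
  by (elim disjE; simp only: Kerr_flat_def Let_def vector_4_nth;
      intro elementary_intros elementary_Kerr_coefficients[OF assms] Kerr_DOC_nonzero[OF assms])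

lemma elementary_Kerr_sharp:
  assumes "0 \<le> a" "a < M"
  shows "elementary (Kerr_DOC M a) (\<lambda>q. Kerr_sharp M a q \<pi> $ i)"
  using exhaust_4[of i]
  by (elim disjE; simp only: Kerr_sharp_def Let_def vector_4_nth Kerr_P_def
        radial_momentum_def axial_momentum_def;
      intro elementary_intros elementary_Kerr_coefficients[OF assms] Kerr_DOC_nonzero[OF assms])

lemma matrix_Kerr_flat_mult: "matrix (Kerr_flat M a p) *v v = Kerr_flat M a p v"
  using matrix_vector_mul(2)[OF linear_Kerr_flat] by metis

lemma matrix_Kerr_sharp_mult: "matrix (Kerr_sharp M a p) *v v = Kerr_sharp M a p v"
  using matrix_vector_mul(2)[OF linear_Kerr_sharp] by metis

lemma matrix_Kerr_sharp_nth: "matrix (Kerr_sharp M a p) $ i $ j = Kerr_sharp M a p (axis j 1) $ i"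
  by (simp add: matrix_def)

lemma metric_matrix_Kerr_nth:
  "metric_matrix (Kerr_metric M a) p $ i $ j = Kerr_flat M a p (axis j 1) $ i"
  by (simp add: metric_matrix_Kerr matrix_def)

lemma Kerr_sharp_matrix_inverse:
  assumes "0 \<le> a" "a < M" "p \<in> Kerr_DOC M a"
  shows "matrix (Kerr_sharp M a p) ** metric_matrix (Kerr_metric M a) p = mat 1"
proof -
  have "Kerr_sharp M a p \<circ> Kerr_flat M a p = id"
    using Kerr_sharp_flat[of p M a] Kerr_DOC_pos[OF assms] by (fastforce simp: fun_eq_iff)
  then show ?thesis
    unfolding metric_matrix_Kerr
    by (metis linear_Kerr_flat linear_Kerr_sharp matrix_compose matrix_id_mat_1)
qed

lemma Kerr_geodesic_field_locally_lipschitz: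
  assumes "0 \<le> a" "a < M"
  shows "locally_lipschitz (Kerr_DOC M a \<times> UNIV) (geodesic_field (Kerr_metric M a))"
proof (rule geodesic_field_locally_lipschitz)
  show "locally_lipschitz (Kerr_DOC M a) (christoffel (Kerr_metric M a) k i j)" for k i j
  proof (rule christoffel_locally_lipschitz[OF open_Kerr_DOC])
    show "elementary (Kerr_DOC M a) (\<lambda>q. metric_matrix (Kerr_metric M a) q $ i $ j)" for i j
      unfolding metric_matrix_Kerr_nth by (rule elementary_Kerr_flat[OF assms])
    show "elementary (Kerr_DOC M a) (\<lambda>q. matrix (Kerr_sharp M a q) $ i $ j)" for i j
      unfolding matrix_Kerr_sharp_nth by (rule elementary_Kerr_sharp[OF assms])
    show "matrix_inv (metric_matrix (Kerr_metric M a) q) = matrix (Kerr_sharp M a q)"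
      if "q \<in> Kerr_DOC M a" for q
      by (rule matrix_inv_eqI[OF Kerr_sharp_matrix_inverse[OF assms that]])
  qed (rule Kerr_DOC_pos(1)[OF assms])
qed


section \<open>The separable Hamiltonian of the Kerr metric\<close>

text \<open>The separable form of \<open>\<rho>\<^sup>2 g\<^sup>-\<^sup>1(\<pi>, \<pi>)\<close>; the difference
  \<open>r\<^sup>2 \<bar>\<Pi>\<bar>\<^sup>2 - ((x, y, z) \<bullet> \<Pi>)\<^sup>2\<close>, for the spatial momentum \<open>\<Pi>\<close>, is the square of
  the angular momentum \<open>(x, y, z) \<times> \<Pi>\<close>. The factors \<open>1 / r\<^sup>2\<close> and \<open>1 / \<Delta>\<close> are kept apart because they
  are differentiated as functions of \<open>r\<close> alone.\<close>

definition Kerr_Hamiltonian :: "real \<Rightarrow> real \<Rightarrow> real ^ 4 \<Rightarrow> real ^ 4 \<Rightarrow> real" where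
  "Kerr_Hamiltonian M a \<pi> p = (let r = BL_r p; \<Delta> = Kerr_Delta M a r; L = axial_momentum p \<pi> in
     \<Delta> / r\<^sup>2 * (radial_momentum p \<pi>)\<^sup>2
     + (r\<^sup>2 * ((\<pi> $ 2)\<^sup>2 + (\<pi> $ 3)\<^sup>2 + (\<pi> $ 4)\<^sup>2) - (radial_momentum p \<pi>)\<^sup>2)
     + 2 * a * \<pi> $ 1 * L + a\<^sup>2 * (1 - (p $ 4)\<^sup>2 * (1 / r\<^sup>2)) * (\<pi> $ 1)\<^sup>2
     - (Kerr_P a r (\<pi> $ 1) L)\<^sup>2 * (1 / \<Delta>))"

lemma Kerr_sharp_inner:
  "\<pi> \<bullet> Kerr_sharp M a p \<pi> = Kerr_Hamiltonian M a \<pi> p / Kerr_rho2 a (BL_r p) (p $ 4 / BL_r p)"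
proof -
  define r where "r = BL_r p"
  define D where "D = 1 / Kerr_Delta M a r"
  define \<alpha> where "\<alpha> = Kerr_Delta M a r / r\<^sup>2 - 1"
  have D: "x / Kerr_Delta M a r = x * D" for x by (simp add: D_def)
  have \<alpha>: "Kerr_Delta M a r / r\<^sup>2 = \<alpha> + 1" by (simp add: \<alpha>_def)
  have "\<pi> $ 1 * (a\<^sup>2 * (1 - (p $ 4 / r)\<^sup>2) * \<pi> $ 1 + a * axial_momentum p \<pi>
            - (r\<^sup>2 + a\<^sup>2) * Kerr_P a r (\<pi> $ 1) (axial_momentum p \<pi>) * D)
     + \<pi> $ 2 * (\<alpha> * radial_momentum p \<pi> * p $ 2 + r\<^sup>2 * \<pi> $ 2
            - (a * \<pi> $ 1 - a * Kerr_P a r (\<pi> $ 1) (axial_momentum p \<pi>) * D) * p $ 3)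
     + \<pi> $ 3 * (\<alpha> * radial_momentum p \<pi> * p $ 3 + r\<^sup>2 * \<pi> $ 3
            + (a * \<pi> $ 1 - a * Kerr_P a r (\<pi> $ 1) (axial_momentum p \<pi>) * D) * p $ 2)
     + \<pi> $ 4 * (\<alpha> * radial_momentum p \<pi> * p $ 4 + r\<^sup>2 * \<pi> $ 4) = Kerr_Hamiltonian M a \<pi> p"
    unfolding Kerr_Hamiltonian_def Let_def r_def[symmetric] \<alpha> D Kerr_P_def radial_momentum_def axial_momentum_def
    by (simp add: power_divide) algebra
  then show ?thesis
    unfolding Kerr_sharp_def Let_def inner_4 vector_4_nth r_def[symmetric] D \<alpha>_def[symmetric]
    by (simp add: add_divide_distrib[symmetric])
qed

lemma has_derivative_radial_function:
  assumes "(f has_real_derivative f') (at (BL_r p))" "0 < BL_r p"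
  shows "\<exists>c. ((\<lambda>q. f (BL_r q)) has_derivative (\<lambda>h. c * radial_momentum p h)) (at p)"
proof -
  have "((\<lambda>q. f (BL_r q)) has_derivative
      (\<lambda>h. f' * ((p $ 2 * h $ 2 + p $ 3 * h $ 3 + p $ 4 * h $ 4) / BL_r p))) (at p)"
    using has_derivative_compose[OF has_derivative_BL_r[OF assms(2)] assms(1)[unfolded has_field_derivative_def]]
    by simp
  then show ?thesis
    by (intro exI[of _ "f' / BL_r p"]) (simp add: radial_momentum_def)
qed

text \<open>All derivatives of functions of \<open>r\<close> alone are multiples of \<open>(x, y, z) \<bullet> h\<close>; they are collected in one
  coefficient \<open>\<mu>\<close>, the strength of a central force, which does not change the angular momentum.\<close>

lemma Kerr_Hamiltonian_has_derivative:
  assumes r: "0 < BL_r p" and \<Delta>: "Kerr_Delta M a (BL_r p) \<noteq> 0"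
  obtains \<mu> where "(Kerr_Hamiltonian M a \<pi> has_derivative (\<lambda>h. 2 *
     ((Kerr_Delta M a (BL_r p) / (BL_r p)\<^sup>2 - 1) * radial_momentum p \<pi> * radial_momentum \<pi> h
      + \<mu> * radial_momentum p h
      + (a * \<pi> $ 1 - a * Kerr_P a (BL_r p) (\<pi> $ 1) (axial_momentum p \<pi>) / Kerr_Delta M a (BL_r p))
         * (\<pi> $ 3 * h $ 2 - \<pi> $ 2 * h $ 3)
      - a\<^sup>2 * (\<pi> $ 1)\<^sup>2 * (p $ 4 / (BL_r p)\<^sup>2) * h $ 4))) (at p)"
proof -
  define r where "r = BL_r p"
  define S where "S = (\<lambda>q. radial_momentum q \<pi>)"
  define L where "L = (\<lambda>q. axial_momentum q \<pi>)"
  define N where "N = (\<pi> $ 2)\<^sup>2 + (\<pi> $ 3)\<^sup>2 + (\<pi> $ 4)\<^sup>2"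
  define A where "A q = Kerr_Delta M a (BL_r q) / (BL_r q)\<^sup>2" for q
  define B where "B q = 1 / Kerr_Delta M a (BL_r q)" for q
  define C where "C q = 1 / (BL_r q)\<^sup>2" for q
  define R where "R q = (BL_r q)\<^sup>2" for q
  have d\<Delta>: "(Kerr_Delta M a has_real_derivative (2 * r - 2 * M)) (at r)"
    unfolding Kerr_Delta_def by (auto intro!: derivative_eq_intros)
  obtain A' where A': "(A has_derivative (\<lambda>h. A' * radial_momentum p h)) (at p)"
    unfolding A_def using r
    by (atomize_elim, intro has_derivative_radial_function)
       (rule derivative_eq_intros d\<Delta>[unfolded r_def] | simp)+
  obtain B' where B': "(B has_derivative (\<lambda>h. B' * radial_momentum p h)) (at p)"
    unfolding B_def using r \<Delta>
    by (atomize_elim, intro has_derivative_radial_function)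
       (rule derivative_eq_intros d\<Delta>[unfolded r_def] | simp)+
  obtain C' where C': "(C has_derivative (\<lambda>h. C' * radial_momentum p h)) (at p)"
    unfolding C_def using r
    by (atomize_elim, intro has_derivative_radial_function)
       (rule derivative_eq_intros | simp)+
  have R': "(R has_derivative (\<lambda>h. 2 * radial_momentum p h)) (at p)"
    unfolding R_def BL_r_squared radial_momentum_def
    by (auto intro!: derivative_eq_intros has_derivative_vec_nth simp: algebra_simps)
  have S': "(S has_derivative (\<lambda>h. radial_momentum \<pi> h)) (at p)"
    unfolding S_def radial_momentum_def
    by (auto intro!: derivative_eq_intros has_derivative_vec_nth simp: algebra_simps)
  have L': "(L has_derivative (\<lambda>h. \<pi> $ 3 * h $ 2 - \<pi> $ 2 * h $ 3)) (at p)"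
    unfolding L_def axial_momentum_def
    by (auto intro!: derivative_eq_intros has_derivative_vec_nth simp: algebra_simps)
  define \<mu> where "\<mu> = (A' * (S p)\<^sup>2 - a\<^sup>2 * (\<pi> $ 1)\<^sup>2 * (p $ 4)\<^sup>2 * C'
      - 4 * \<pi> $ 1 * ((R p + a\<^sup>2) * \<pi> $ 1 + a * L p) * B p
      - ((R p + a\<^sup>2) * \<pi> $ 1 + a * L p)\<^sup>2 * B') / 2 + N"
  have G: "Kerr_Hamiltonian M a \<pi> = (\<lambda>q. A q * (S q)\<^sup>2 + (R q * N - (S q)\<^sup>2) + 2 * a * \<pi> $ 1 * L q
      + a\<^sup>2 * (1 - (q $ 4)\<^sup>2 * C q) * (\<pi> $ 1)\<^sup>2 - ((R q + a\<^sup>2) * \<pi> $ 1 + a * L q)\<^sup>2 * B q)"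
    by (simp add: fun_eq_iff Kerr_Hamiltonian_def Let_def A_def B_def C_def R_def S_def L_def N_def Kerr_P_def)
  have "(Kerr_Hamiltonian M a \<pi> has_derivative (\<lambda>h. 2 *
     ((A p - 1) * S p * radial_momentum \<pi> h + \<mu> * radial_momentum p h
      + (a * \<pi> $ 1 - a * ((R p + a\<^sup>2) * \<pi> $ 1 + a * L p) * B p) * (\<pi> $ 3 * h $ 2 - \<pi> $ 2 * h $ 3)
      - a\<^sup>2 * (\<pi> $ 1)\<^sup>2 * (p $ 4 * C p) * h $ 4))) (at p)"
    unfolding G
    by (rule has_derivative_eq_rhs,
        (rule derivative_intros A' B' C' R' S' L' has_derivative_vec_nth)+,
        rule ext, simp add: \<mu>_def, algebra)
  then show ?thesis
    by (intro that[of \<mu>]) (simp add: A_def B_def C_def R_def S_def L_def Kerr_P_def)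
qed

text \<open>The first three terms are the square of the angular momentum. In terms of Carter's \<open>Q\<close> and the energy
  \<open>E = - p\<^sub>t\<close> this is \<open>Q + (p\<^sub>\<phi> - a E)\<^sup>2\<close>.\<close>

definition Kerr_Carter :: "real \<Rightarrow> real ^ 4 \<Rightarrow> real ^ 4 \<Rightarrow> real" where
  "Kerr_Carter a p \<pi> =
     (p $ 3 * \<pi> $ 4 - p $ 4 * \<pi> $ 3)\<^sup>2 + (p $ 4 * \<pi> $ 2 - p $ 2 * \<pi> $ 4)\<^sup>2 + (axial_momentum p \<pi>)\<^sup>2
     + 2 * a * \<pi> $ 1 * axial_momentum p \<pi> + a\<^sup>2 * (1 - (p $ 4 / BL_r p)\<^sup>2) * (\<pi> $ 1)\<^sup>2"

lemma angular_momentum_squared: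
  "(p $ 3 * \<pi> $ 4 - p $ 4 * \<pi> $ 3)\<^sup>2 + (p $ 4 * \<pi> $ 2 - p $ 2 * \<pi> $ 4)\<^sup>2 + (axial_momentum p \<pi>)\<^sup>2
   = (BL_r p)\<^sup>2 * ((\<pi> $ 2)\<^sup>2 + (\<pi> $ 3)\<^sup>2 + (\<pi> $ 4)\<^sup>2) - (radial_momentum p \<pi>)\<^sup>2"
  unfolding BL_r_squared axial_momentum_def radial_momentum_def by algebra

text \<open>The equation \<open>g\<^sup>-\<^sup>1(\<pi>, \<pi>) = 0\<close> in separated form, solved for the radial momentum.\<close>

lemma radial_momentum_squared:
  assumes "Kerr_Delta M a (BL_r p) \<noteq> 0" "Kerr_Hamiltonian M a \<pi> p = 0"
  shows "(Kerr_Delta M a (BL_r p) * radial_momentum p \<pi> / BL_r p)\<^sup>2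
    = (Kerr_P a (BL_r p) (\<pi> $ 1) (axial_momentum p \<pi>))\<^sup>2 - Kerr_Delta M a (BL_r p) * Kerr_Carter a p \<pi>"
proof -
  define \<Delta> where "\<Delta> = Kerr_Delta M a (BL_r p)"
  define P where "P = Kerr_P a (BL_r p) (\<pi> $ 1) (axial_momentum p \<pi>)"
  define S where "S = radial_momentum p \<pi>"
  have "\<Delta> / (BL_r p)\<^sup>2 * S\<^sup>2 + Kerr_Carter a p \<pi> - P\<^sup>2 * (1 / \<Delta>) = 0"
    using assms(2) angular_momentum_squared[of p \<pi>]
    unfolding Kerr_Hamiltonian_def Let_def Kerr_Carter_def \<Delta>_def P_def S_def
    by (simp add: power_divide)
  then have "\<Delta> * (\<Delta> / (BL_r p)\<^sup>2 * S\<^sup>2) = \<Delta> * (P\<^sup>2 * (1 / \<Delta>)) - \<Delta> * Kerr_Carter a p \<pi>"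
    by algebra
  also have "\<Delta> * (P\<^sup>2 * (1 / \<Delta>)) = P\<^sup>2" using assms(1) by (simp add: \<Delta>_def)
  finally show ?thesis
    unfolding \<Delta>_def[symmetric] P_def[symmetric] S_def[symmetric]
    by (simp add: power_divide power_mult_distrib power2_eq_square mult_ac)
qed


section \<open>Constants of motion of null geodesics\<close>

lemma radial_momentum_axis:
  "radial_momentum p (axis 2 1) = p $ 2" "radial_momentum p (axis 3 1) = p $ 3"
  "radial_momentum p (axis 4 1) = p $ 4"
  by (simp_all add: radial_momentum_def axis_def)

text \<open>For the position \<open>X = (x, y, z)\<close> and the spatial momentum \<open>\<Pi>\<close>, the abbreviations \<open>\<alpha>\<close>, \<open>\<beta>\<close>, \<open>\<kappa>\<close>
  are the coefficients of Hamilton's equations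
  \<open>\<rho>\<^sup>2 X' = \<alpha> S X + r\<^sup>2 \<Pi> + \<beta> Z \<times> X\<close> and
  \<open>\<rho>\<^sup>2 \<Pi>' = - \<alpha> S \<Pi> - \<mu> X + \<beta> Z \<times> \<Pi> + \<kappa> Z\<close> with \<open>Z = (0, 0, 1)\<close>.\<close>

locale Kerr_null_geodesic =
  fixes M a :: real and I :: "real set" and \<gamma> :: "real \<Rightarrow> real ^ 4"
  assumes a: "0 \<le> a" "a < M"
    and geo: "geodesic (Kerr_metric M a) (Kerr_DOC M a) I \<gamma>"
    and null: "s \<in> I \<Longrightarrow> Kerr_metric M a (\<gamma> s) (velocity \<gamma> s) (velocity \<gamma> s) = 0"
begin

abbreviation mom :: "real \<Rightarrow> real ^ 4" where "mom s \<equiv> momentum (Kerr_metric M a) \<gamma> s"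
abbreviation rad :: "real \<Rightarrow> real" where "rad s \<equiv> BL_r (\<gamma> s)"
abbreviation rho2 :: "real \<Rightarrow> real" where "rho2 s \<equiv> Kerr_rho2 a (rad s) (\<gamma> s $ 4 / rad s)"
abbreviation Delta :: "real \<Rightarrow> real" where "Delta s \<equiv> Kerr_Delta M a (rad s)"
abbreviation \<alpha> :: "real \<Rightarrow> real" where "\<alpha> s \<equiv> Delta s / (rad s)\<^sup>2 - 1"
abbreviation S :: "real \<Rightarrow> real" where "S s \<equiv> radial_momentum (\<gamma> s) (mom s)"
abbreviation L :: "real \<Rightarrow> real" where "L s \<equiv> axial_momentum (\<gamma> s) (mom s)"
abbreviation P :: "real \<Rightarrow> real" where "P s \<equiv> Kerr_P a (rad s) (mom s $ 1) (L s)"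
abbreviation \<beta> :: "real \<Rightarrow> real" where "\<beta> s \<equiv> a * mom s $ 1 - a * P s / Delta s"
abbreviation \<kappa> :: "real \<Rightarrow> real" where "\<kappa> s \<equiv> a\<^sup>2 * (mom s $ 1)\<^sup>2 * (\<gamma> s $ 4 / (rad s)\<^sup>2)"

lemma in_DOC: "s \<in> I \<Longrightarrow> \<gamma> s \<in> Kerr_DOC M a"
  using geo by (auto simp: geodesic_def)

lemmas pos = Kerr_DOC_pos[OF a in_DOC]

lemma mom_eq_flat: "mom s = Kerr_flat M a (\<gamma> s) (velocity \<gamma> s)"
  unfolding momentum_def metric_matrix_Kerr by (rule matrix_Kerr_flat_mult)

lemma velocity_eq_sharp:
  assumes "s \<in> I"
  shows "velocity \<gamma> s = Kerr_sharp M a (\<gamma> s) (mom s)"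
  unfolding mom_eq_flat using pos[OF assms] by (intro Kerr_sharp_flat[symmetric]) auto

lemma Kerr_Hamiltonian_eq_0:
  assumes "s \<in> I"
  shows "Kerr_Hamiltonian M a (mom s) (\<gamma> s) = 0"
proof -
  have "mom s \<bullet> velocity \<gamma> s = 0"
    using null[OF assms] by (simp add: Kerr_metric_eq_inner_flat mom_eq_flat inner_commute)
  then have "mom s \<bullet> Kerr_sharp M a (\<gamma> s) (mom s) = 0"
    by (simp only: velocity_eq_sharp[OF assms, symmetric])
  then show ?thesis
    using pos(3)[OF assms, of "\<gamma> s $ 4 / rad s"] unfolding Kerr_sharp_inner by simp
qed

lemma velocity_components:
  assumes "s \<in> I"
  shows "velocity \<gamma> s $ 2 = (\<alpha> s * S s * \<gamma> s $ 2 + (rad s)\<^sup>2 * mom s $ 2 - \<beta> s * \<gamma> s $ 3) / rho2 s"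
    and "velocity \<gamma> s $ 3 = (\<alpha> s * S s * \<gamma> s $ 3 + (rad s)\<^sup>2 * mom s $ 3 + \<beta> s * \<gamma> s $ 2) / rho2 s"
    and "velocity \<gamma> s $ 4 = (\<alpha> s * S s * \<gamma> s $ 4 + (rad s)\<^sup>2 * mom s $ 4) / rho2 s"
  unfolding velocity_eq_sharp[OF assms] Kerr_sharp_def Let_def vector_4_nth by (rule refl)+

text \<open>On a null geodesic \<open>\<rho>\<^sup>2 g\<^sup>-\<^sup>1(\<pi>, \<pi>)\<close> vanishes, so the derivative of the factor
  \<open>1 / \<rho>\<^sup>2\<close> does not contribute to Hamilton's equation.\<close>

lemma momentum_components_derivative:
  assumes s: "s \<in> I"
  obtains \<mu> where "((\<lambda>s. mom s $ 1) has_real_derivative 0) (at s)"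
    "((\<lambda>s. mom s $ 2) has_real_derivative - (\<alpha> s * S s * mom s $ 2 + \<mu> * \<gamma> s $ 2 + \<beta> s * mom s $ 3) / rho2 s) (at s)"
    "((\<lambda>s. mom s $ 3) has_real_derivative - (\<alpha> s * S s * mom s $ 3 + \<mu> * \<gamma> s $ 3 - \<beta> s * mom s $ 2) / rho2 s) (at s)"
    "((\<lambda>s. mom s $ 4) has_real_derivative - (\<alpha> s * S s * mom s $ 4 + \<mu> * \<gamma> s $ 4 - \<kappa> s) / rho2 s) (at s)"
proof -
  let ?U = "Kerr_DOC M a"
  have r: "0 < rad s" and \<Delta>: "Delta s \<noteq> 0" and \<rho>: "rho2 s \<noteq> 0"
    using pos[OF s] by (auto simp: less_le)
  obtain \<mu> where G': "(Kerr_Hamiltonian M a (mom s) has_derivative (\<lambda>h. 2 *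
       (\<alpha> s * S s * radial_momentum (mom s) h + \<mu> * radial_momentum (\<gamma> s) h
        + \<beta> s * (mom s $ 3 * h $ 2 - mom s $ 2 * h $ 3) - \<kappa> s * h $ 4))) (at (\<gamma> s))"
    (is "(_ has_derivative (\<lambda>h. 2 * ?D h)) _")
    using Kerr_Hamiltonian_has_derivative[OF r \<Delta>] by blast
  have "(\<lambda>q. Kerr_rho2 a (BL_r q) (q $ 4 / BL_r q)) differentiable (at (\<gamma> s))"
    using elementary_differentiable[OF elementary_Kerr_coefficients(1)[OF a]] Kerr_DOC_pos(1)[OF a]
      in_DOC[OF s] by blast
  then obtain \<rho>' where "((\<lambda>q. Kerr_rho2 a (BL_r q) (q $ 4 / BL_r q)) has_derivative \<rho>') (at (\<gamma> s))"
    by (auto simp: differentiable_def)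
  from has_derivative_divide'[OF G' this \<rho>]
  have H: "((\<lambda>q. mom s \<bullet> (matrix (Kerr_sharp M a q) *v mom s)) has_derivative
      (\<lambda>h. 2 * ?D h / rho2 s)) (at (\<gamma> s))"
    using \<rho> by (simp add: Kerr_Hamiltonian_eq_0[OF s] matrix_Kerr_sharp_mult Kerr_sharp_inner[symmetric])
  have D: "((\<lambda>s. mom s $ m) has_real_derivative - (2 * ?D (axis m 1) / rho2 s) / 2) (at s)" for m
  proof (rule Hamilton_equation[OF open_Kerr_DOC geo s _ _ _ _ H])
    show "metric_matrix (Kerr_metric M a) q $ i $ j = metric_matrix (Kerr_metric M a) q $ j $ i" for q i j
      by (simp add: metric_matrix_def Kerr_metric_sym)
    show "(\<lambda>q. metric_matrix (Kerr_metric M a) q $ i $ j) differentiable at q" if "q \<in> ?U" for q i j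
      unfolding metric_matrix_Kerr_nth
      using elementary_differentiable[OF elementary_Kerr_flat[OF a]] Kerr_DOC_pos(1)[OF a] that by blast
    show "(\<lambda>q. matrix (Kerr_sharp M a q) $ i $ j) differentiable at q" if "q \<in> ?U" for q i j
      unfolding matrix_Kerr_sharp_nth
      using elementary_differentiable[OF elementary_Kerr_sharp[OF a]] Kerr_DOC_pos(1)[OF a] that by blast
  qed (rule Kerr_sharp_matrix_inverse[OF a])
  have half: "- (2 * u / c) / 2 = - u / c" for u c :: real by simp
  note D' = D[unfolded half]
  have axis_nth: "axis 2 1 $ (2 :: 4) = (1 :: real)" "axis 2 1 $ (3 :: 4) = (0 :: real)" "axis 2 1 $ (4 :: 4) = (0 :: real)"
    "axis 3 1 $ (2 :: 4) = (0 :: real)" "axis 3 1 $ (3 :: 4) = (1 :: real)" "axis 3 1 $ (4 :: 4) = (0 :: real)"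
    "axis 4 1 $ (2 :: 4) = (0 :: real)" "axis 4 1 $ (3 :: 4) = (0 :: real)" "axis 4 1 $ (4 :: 4) = (1 :: real)"
    by (simp_all add: axis_def)
  show ?thesis
  proof (rule that[of \<mu>])
    show "((\<lambda>s. mom s $ 1) has_real_derivative 0) (at s)"
      using D[of 1] by (simp add: radial_momentum_def axis_def)
    show "((\<lambda>s. mom s $ 2) has_real_derivative - (\<alpha> s * S s * mom s $ 2 + \<mu> * \<gamma> s $ 2 + \<beta> s * mom s $ 3) / rho2 s) (at s)"
      using D'[of 2] unfolding radial_momentum_axis axis_nth by simp
    show "((\<lambda>s. mom s $ 3) has_real_derivative - (\<alpha> s * S s * mom s $ 3 + \<mu> * \<gamma> s $ 3 - \<beta> s * mom s $ 2) / rho2 s) (at s)"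
      using D'[of 3] unfolding radial_momentum_axis axis_nth by simp
    show "((\<lambda>s. mom s $ 4) has_real_derivative - (\<alpha> s * S s * mom s $ 4 + \<mu> * \<gamma> s $ 4 - \<kappa> s) / rho2 s) (at s)"
      using D'[of 4] unfolding radial_momentum_axis axis_nth by simp
  qed
qed

lemma radius_derivative:
  assumes s: "s \<in> I"
  shows "(rad has_real_derivative Delta s * S s / (rad s * rho2 s)) (at s)"
proof -
  define i where "i = 1 / rho2 s"
  have r: "0 < rad s" using pos(1)[OF s] .
  have v: "velocity \<gamma> s $ 2 = i * (\<alpha> s * S s * \<gamma> s $ 2 + (rad s)\<^sup>2 * mom s $ 2 - \<beta> s * \<gamma> s $ 3)"
    "velocity \<gamma> s $ 3 = i * (\<alpha> s * S s * \<gamma> s $ 3 + (rad s)\<^sup>2 * mom s $ 3 + \<beta> s * \<gamma> s $ 2)"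
    "velocity \<gamma> s $ 4 = i * (\<alpha> s * S s * \<gamma> s $ 4 + (rad s)\<^sup>2 * mom s $ 4)"
    unfolding velocity_components[OF s] by (simp_all add: i_def)
  have "\<gamma> s $ 2 * velocity \<gamma> s $ 2 + \<gamma> s $ 3 * velocity \<gamma> s $ 3 + \<gamma> s $ 4 * velocity \<gamma> s $ 4
      = i * (\<alpha> s * S s * ((\<gamma> s $ 2)\<^sup>2 + (\<gamma> s $ 3)\<^sup>2 + (\<gamma> s $ 4)\<^sup>2)
             + (rad s)\<^sup>2 * (\<gamma> s $ 2 * mom s $ 2 + \<gamma> s $ 3 * mom s $ 3 + \<gamma> s $ 4 * mom s $ 4))"
    unfolding v by algebra
  also have "\<dots> = i * (\<alpha> s * S s * (rad s)\<^sup>2 + (rad s)\<^sup>2 * S s)"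
    by (simp only: BL_r_squared[symmetric] radial_momentum_def[symmetric])
  also have "\<dots> = i * ((\<alpha> s + 1) * (rad s)\<^sup>2) * S s" by algebra
  also have "(\<alpha> s + 1) * (rad s)\<^sup>2 = Delta s" using r by simp
  finally have e: "\<gamma> s $ 2 * velocity \<gamma> s $ 2 + \<gamma> s $ 3 * velocity \<gamma> s $ 3 + \<gamma> s $ 4 * velocity \<gamma> s $ 4
      = Delta s * S s / rho2 s" by (simp add: i_def)
  have "(rad has_derivative (\<lambda>t. (\<gamma> s $ 2 * (t *\<^sub>R velocity \<gamma> s) $ 2 + \<gamma> s $ 3 * (t *\<^sub>R velocity \<gamma> s) $ 3
      + \<gamma> s $ 4 * (t *\<^sub>R velocity \<gamma> s) $ 4) / rad s)) (at s)"
    using has_derivative_compose[OF geodesic_velocity(1)[OF geo s, unfolded has_vector_derivative_def]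
        has_derivative_BL_r[OF r]] .
  moreover have "(\<gamma> s $ 2 * (t *\<^sub>R velocity \<gamma> s) $ 2 + \<gamma> s $ 3 * (t *\<^sub>R velocity \<gamma> s) $ 3
      + \<gamma> s $ 4 * (t *\<^sub>R velocity \<gamma> s) $ 4) / rad s
      = t * (\<gamma> s $ 2 * velocity \<gamma> s $ 2 + \<gamma> s $ 3 * velocity \<gamma> s $ 3 + \<gamma> s $ 4 * velocity \<gamma> s $ 4) / rad s" for t
    by (simp add: algebra_simps)
  ultimately have "(rad has_derivative (\<lambda>t. t * (Delta s * S s / rho2 s) / rad s)) (at s)"
    unfolding e by simp
  then show ?thesis
    unfolding has_field_derivative_def
    by (rule has_derivative_eq_rhs) (simp add: fun_eq_iff mult_ac)
qed

text \<open>In the notation above, the angular momentum \<open>\<Lambda> = X \<times> \<Pi>\<close> satisfies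
  \<open>\<rho>\<^sup>2 \<Lambda>' = \<beta> Z \<times> \<Lambda> + \<kappa> X \<times> Z\<close>. Therefore
  \<open>\<Lambda>\<^sub>z\<close> is constant, and the derivative of \<open>\<bar>\<Lambda>\<bar>\<^sup>2\<close> comes from the second term only, which is
  compensated by the change of \<open>a\<^sup>2 p\<^sub>t\<^sup>2 z\<^sup>2 / r\<^sup>2\<close>.\<close>

lemma conserved:
  assumes s: "s \<in> I"
  shows "((\<lambda>s. mom s $ 1) has_real_derivative 0) (at s)"
    and "(L has_real_derivative 0) (at s)"
    and "((\<lambda>s. Kerr_Carter a (\<gamma> s) (mom s)) has_real_derivative 0) (at s)"
proof -
  obtain \<mu> where mom': "((\<lambda>s. mom s $ 1) has_real_derivative 0) (at s)"
    "((\<lambda>s. mom s $ 2) has_real_derivative - (\<alpha> s * S s * mom s $ 2 + \<mu> * \<gamma> s $ 2 + \<beta> s * mom s $ 3) / rho2 s) (at s)"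
    "((\<lambda>s. mom s $ 3) has_real_derivative - (\<alpha> s * S s * mom s $ 3 + \<mu> * \<gamma> s $ 3 - \<beta> s * mom s $ 2) / rho2 s) (at s)"
    "((\<lambda>s. mom s $ 4) has_real_derivative - (\<alpha> s * S s * mom s $ 4 + \<mu> * \<gamma> s $ 4 - \<kappa> s) / rho2 s) (at s)"
    using momentum_components_derivative[OF s] .
  define i where "i = 1 / rho2 s"
  have frac: "u / rho2 s = i * u" for u by (simp add: i_def)
  note vel' = has_real_derivative_vec_nth[OF geodesic_velocity(1)[OF geo s]]
  define A where "A = \<alpha> s * S s"
  define B where "B = \<beta> s"
  define k where "k = \<kappa> s"
  define r where "r = rad s"
  define x where "x = \<gamma> s $ 2"
  define y where "y = \<gamma> s $ 3"
  define z where "z = \<gamma> s $ 4"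
  define px where "px = mom s $ 2"
  define py where "py = mom s $ 3"
  define pz where "pz = mom s $ 4"
  define x' where "x' = i * (A * x + r\<^sup>2 * px - B * y)"
  define y' where "y' = i * (A * y + r\<^sup>2 * py + B * x)"
  define z' where "z' = i * (A * z + r\<^sup>2 * pz)"
  define px' where "px' = i * - (A * px + \<mu> * x + B * py)"
  define py' where "py' = i * - (A * py + \<mu> * y - B * px)"
  define pz' where "pz' = i * - (A * pz + \<mu> * z - k)"
  note defs = A_def B_def k_def r_def x_def y_def z_def px_def py_def pz_def
  have dx: "((\<lambda>s. \<gamma> s $ 2) has_real_derivative x') (at s)"
    using vel'[of 2] unfolding velocity_components[OF s] frac x'_def defs .
  have dy: "((\<lambda>s. \<gamma> s $ 3) has_real_derivative y') (at s)"
    using vel'[of 3] unfolding velocity_components[OF s] frac y'_def defs .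
  have dz: "((\<lambda>s. \<gamma> s $ 4) has_real_derivative z') (at s)"
    using vel'[of 4] unfolding velocity_components[OF s] frac z'_def defs .
  have dpx: "((\<lambda>s. mom s $ 2) has_real_derivative px') (at s)"
    using mom'(2) unfolding frac px'_def defs by simp
  have dpy: "((\<lambda>s. mom s $ 3) has_real_derivative py') (at s)"
    using mom'(3) unfolding frac py'_def defs by simp
  have dpz: "((\<lambda>s. mom s $ 4) has_real_derivative pz') (at s)"
    using mom'(4) unfolding frac pz'_def defs by simp
  show d1: "((\<lambda>s. mom s $ 1) has_real_derivative 0) (at s)" by (rule mom'(1))
  have "(L has_real_derivative (x' * py + x * py') - (y' * px + y * px')) (at s)"
    unfolding axial_momentum_def x_def y_def px_def py_def
    by (auto intro!: derivative_eq_intros dx dy dpx dpy simp: algebra_simps)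
  moreover have "(x' * py + x * py') - (y' * px + y * px') = 0"
    unfolding x'_def y'_def px'_def py'_def by algebra
  ultimately show dL: "(L has_real_derivative 0) (at s)" by simp
  define L1 where "L1 = y * pz - z * py"
  define L2 where "L2 = z * px - x * pz"
  have "((\<lambda>s. \<gamma> s $ 3 * mom s $ 4 - \<gamma> s $ 4 * mom s $ 3) has_real_derivative
      (y' * pz + y * pz') - (z' * py + z * py')) (at s)"
    unfolding y_def z_def py_def pz_def
    by (auto intro!: derivative_eq_intros dy dz dpy dpz simp: algebra_simps)
  moreover have "(y' * pz + y * pz') - (z' * py + z * py') = i * (k * y - B * L2)"
    unfolding y'_def z'_def py'_def pz'_def L2_def by algebra
  ultimately have dL1: "((\<lambda>s. \<gamma> s $ 3 * mom s $ 4 - \<gamma> s $ 4 * mom s $ 3) has_real_derivative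
      i * (k * y - B * L2)) (at s)" by simp
  have "((\<lambda>s. \<gamma> s $ 4 * mom s $ 2 - \<gamma> s $ 2 * mom s $ 4) has_real_derivative
      (z' * px + z * px') - (x' * pz + x * pz')) (at s)"
    unfolding x_def z_def px_def pz_def
    by (auto intro!: derivative_eq_intros dx dz dpx dpz simp: algebra_simps)
  moreover have "(z' * px + z * px') - (x' * pz + x * pz') = i * (B * L1 - k * x)"
    unfolding x'_def z'_def px'_def pz'_def L1_def by algebra
  ultimately have dL2: "((\<lambda>s. \<gamma> s $ 4 * mom s $ 2 - \<gamma> s $ 2 * mom s $ 4) has_real_derivative
      i * (B * L1 - k * x)) (at s)" by simp
  have r0: "r \<noteq> 0" using pos(1)[OF s] by (simp add: r_def)
  have r2: "r\<^sup>2 = x\<^sup>2 + y\<^sup>2 + z\<^sup>2" by (simp add: defs BL_r_squared)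
  have Sxyz: "S s = x * px + y * py + z * pz" by (simp add: radial_momentum_def defs)
  define q where "q = z' * r - z * (Delta s * S s / (r * rho2 s))"
  have dq: "((\<lambda>s. \<gamma> s $ 4 / rad s) has_real_derivative q / (r * r)) (at s)"
    unfolding q_def z_def r_def by (rule DERIV_divide[OF dz radius_derivative[OF s]]) (use r0 in \<open>simp add: r_def\<close>)
  have q: "q = r * i * (r\<^sup>2 * pz - z * S s)"
  proof -
    have "Delta s / r = (\<alpha> s + 1) * r" using r0 by (simp add: r_def power2_eq_square)
    then have "Delta s * S s / (r * rho2 s) = i * (\<alpha> s + 1) * r * S s"
    proof -
      have "Delta s * S s / (r * rho2 s) = i * (Delta s / r) * S s" by (simp add: i_def)
      then show ?thesis unfolding \<open>Delta s / r = (\<alpha> s + 1) * r\<close> by (simp only: mult.assoc)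
    qed
    then show ?thesis unfolding q_def z'_def A_def by algebra
  qed
  have "((\<lambda>s. (f s)\<^sup>2 + (g s)\<^sup>2 + (l s)\<^sup>2 + 2 * a * e s * l s + a\<^sup>2 * (1 - (c s)\<^sup>2) * (e s)\<^sup>2)
      has_real_derivative 2 * f s * f' + 2 * g s * g' - a\<^sup>2 * (e s)\<^sup>2 * (2 * c s * c')) (at s)"
    if "(f has_real_derivative f') (at s)" "(g has_real_derivative g') (at s)"
      "(l has_real_derivative 0) (at s)" "(e has_real_derivative 0) (at s)"
      "(c has_real_derivative c') (at s)" for f g l e c f' g' c'
    using that by (auto intro!: derivative_eq_intros)
  from this[OF dL1 dL2 dL d1 dq] have "((\<lambda>s. Kerr_Carter a (\<gamma> s) (mom s)) has_real_derivative
      2 * L1 * (i * (k * y - B * L2)) + 2 * L2 * (i * (B * L1 - k * x))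
      - a\<^sup>2 * (mom s $ 1)\<^sup>2 * (2 * (z / r) * (q / (r * r)))) (at s)"
    unfolding Kerr_Carter_def L1_def L2_def y_def z_def x_def px_def py_def pz_def r_def .
  moreover have "a\<^sup>2 * (mom s $ 1)\<^sup>2 * (2 * (z / r) * (q / (r * r))) = 2 * k * i * (r\<^sup>2 * pz - z * S s)"
    unfolding q k_def using r0 by (simp add: z_def r_def power2_eq_square)
  moreover have "2 * L1 * (i * (k * y - B * L2)) + 2 * L2 * (i * (B * L1 - k * x))
      = 2 * k * i * (r\<^sup>2 * pz - z * S s)"
    unfolding L1_def L2_def r2 Sxyz by algebra
  ultimately show "((\<lambda>s. Kerr_Carter a (\<gamma> s) (mom s)) has_real_derivative 0) (at s)" by simp
qed

lemma constants_of_motion: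
  obtains pt l K where "\<And>s. s \<in> I \<Longrightarrow> mom s $ 1 = pt" "\<And>s. s \<in> I \<Longrightarrow> L s = l"
    "\<And>s. s \<in> I \<Longrightarrow> Kerr_Carter a (\<gamma> s) (mom s) = K"
proof -
  have I: "convex I" using geo by (simp add: geodesic_def is_interval_convex)
  have const: "\<exists>c. \<forall>s\<in>I. f s = c" if "\<And>s. s \<in> I \<Longrightarrow> (f has_real_derivative 0) (at s)" for f
    using has_field_derivative_zero_constant[OF I, of f] that
    by (auto intro: has_field_derivative_at_within)
  obtain pt where "\<And>s. s \<in> I \<Longrightarrow> mom s $ 1 = pt"
    using const[OF conserved(1)] by blast
  moreover obtain l where "\<And>s. s \<in> I \<Longrightarrow> L s = l"
    using const[OF conserved(2)] by blast
  moreover obtain K where "\<And>s. s \<in> I \<Longrightarrow> Kerr_Carter a (\<gamma> s) (mom s) = K"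
    using const[OF conserved(3)] by blast
  ultimately show ?thesis by (rule that)
qed

end


section \<open>Trapped photons\<close>

lemma Kerr_sharp_time_flow: "Kerr_sharp M a (time_flow \<tau> p) \<pi> = Kerr_sharp M a p \<pi>"
proof -
  have nth: "time_flow \<tau> p $ 2 = p $ 2" "time_flow \<tau> p $ 3 = p $ 3" "time_flow \<tau> p $ 4 = p $ 4"
    by (simp_all add: time_flow_def axis_def)
  show ?thesis
    unfolding Kerr_sharp_def Let_def BL_r_def radial_momentum_def axial_momentum_def nth ..
qed

lemma continuous_on_Kerr_sharp:
  assumes "0 \<le> a" "a < M"
  shows "continuous_on (Kerr_DOC M a \<times> UNIV) (\<lambda>(p, \<pi>). Kerr_sharp M a p \<pi>)"
proof -
  have "continuous_on (Kerr_DOC M a) (\<lambda>p. matrix (Kerr_sharp M a p) $ i $ j)" for i j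
    unfolding matrix_Kerr_sharp_nth
    by (rule elementary_continuous_on[OF elementary_Kerr_sharp[OF assms] Kerr_DOC_pos(1)[OF assms]])
  then have entry: "continuous_on (Kerr_DOC M a \<times> UNIV) (\<lambda>q. matrix (Kerr_sharp M a (fst q)) $ i $ j)" for i j
    by (rule continuous_on_compose2[OF _ continuous_on_fst[OF continuous_on_id]]) auto
  have "continuous_on (Kerr_DOC M a \<times> UNIV) (\<lambda>q :: (real ^ 4) \<times> (real ^ 4). snd q $ j)" for j
    by (intro continuous_intros)
  with entry have "continuous_on (Kerr_DOC M a \<times> UNIV) (\<lambda>q. matrix (Kerr_sharp M a (fst q)) *v snd q)"
    unfolding matrix_vector_mult_def
    by (intro continuous_on_vec_lambda continuous_on_sum continuous_on_mult)
  then show ?thesis by (simp add: matrix_Kerr_sharp_mult case_prod_unfold)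
qed

context Kerr_null_geodesic begin

text \<open>The constants of motion bound the angular momentum, since \<open>a\<^sup>2 sin\<^sup>2 \<theta> p\<^sub>t\<^sup>2\<close> is nonnegative; the
  radial momentum is a continuous function of \<open>r\<close> up to sign, as \<open>\<Delta>\<close> has no zero on the compact set of
  radii.\<close>

lemma momentum_bounded:
  assumes C: "compact C" "C \<subseteq> {r_plus M a<..}" "rad ` I \<subseteq> C"
  obtains B where "\<And>s. s \<in> I \<Longrightarrow> norm (mom s) \<le> B"
proof -
  obtain pt l K where const: "\<And>s. s \<in> I \<Longrightarrow> mom s $ 1 = pt" "\<And>s. s \<in> I \<Longrightarrow> L s = l"
    "\<And>s. s \<in> I \<Longrightarrow> Kerr_Carter a (\<gamma> s) (mom s) = K"
    by (rule constants_of_motion) blast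
  \<comment> \<open>An upper bound for the square of the angular momentum; \<open>f r\<close> bounds the square of the spatial
    momentum.\<close>
  define Q where "Q = K - 2 * a * pt * l"
  define f where "f r = Q / r\<^sup>2 + ((Kerr_P a r pt l)\<^sup>2 - Kerr_Delta M a r * K) / (Kerr_Delta M a r)\<^sup>2" for r
  have nz: "r \<noteq> 0" "Kerr_Delta M a r \<noteq> 0" if "r \<in> C" for r
    using that C(2) r_plus_pos[OF a] Kerr_Delta_pos[OF a, of r] by (auto simp: less_le)
  have "continuous_on C f"
    unfolding f_def Kerr_P_def using nz
    by (auto intro!: continuous_intros simp: Kerr_Delta_def)
  then have "bounded (f ` C)" by (intro compact_imp_bounded compact_continuous_image C(1))
  then obtain B where B: "\<And>r. r \<in> C \<Longrightarrow> \<bar>f r\<bar> \<le> B"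
    unfolding bounded_iff by auto
  have "norm (mom s) \<le> sqrt (pt\<^sup>2 + B)" if s: "s \<in> I" for s
  proof -
    define r where "r = rad s"
    define N where "N = (mom s $ 2)\<^sup>2 + (mom s $ 3)\<^sup>2 + (mom s $ 4)\<^sup>2"
    have r: "0 < r" and \<Delta>: "0 < Kerr_Delta M a r" using pos[OF s] by (simp_all add: r_def)
    have "(\<gamma> s $ 4)\<^sup>2 \<le> r\<^sup>2" by (simp add: r_def BL_r_squared)
    then have "0 \<le> 1 - (\<gamma> s $ 4 / r)\<^sup>2" using r by (simp add: power_divide)
    then have "0 \<le> a\<^sup>2 * (1 - (\<gamma> s $ 4 / r)\<^sup>2) * pt\<^sup>2" by simp
    then have 1: "r\<^sup>2 * N - (S s)\<^sup>2 \<le> Q"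
      using const(3)[OF s] angular_momentum_squared[of "\<gamma> s" "mom s"]
      unfolding Kerr_Carter_def const(1)[OF s] const(2)[OF s] Q_def N_def r_def by simp
    have "(S s)\<^sup>2 * (Kerr_Delta M a r)\<^sup>2 / r\<^sup>2 = (Kerr_P a r pt l)\<^sup>2 - Kerr_Delta M a r * K"
      using radial_momentum_squared[of M a "\<gamma> s" "mom s"] \<Delta> Kerr_Hamiltonian_eq_0[OF s]
        const(1)[OF s] const(2)[OF s] const(3)[OF s]
      by (simp add: r_def power_divide power_mult_distrib mult.commute)
    then have 2: "(S s)\<^sup>2 / r\<^sup>2 = ((Kerr_P a r pt l)\<^sup>2 - Kerr_Delta M a r * K) / (Kerr_Delta M a r)\<^sup>2"
      using \<Delta> by (simp add: field_simps)
    have "N = (r\<^sup>2 * N - (S s)\<^sup>2) / r\<^sup>2 + (S s)\<^sup>2 / r\<^sup>2"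
      using r by (simp add: field_simps)
    also have "\<dots> \<le> Q / r\<^sup>2 + (S s)\<^sup>2 / r\<^sup>2"
      using 1 by (intro add_right_mono divide_right_mono) auto
    also have "\<dots> = f r" by (simp add: 2 f_def)
    also have "\<dots> \<le> B" using B[of r] C(3) s by (force simp: r_def)
    finally have "N \<le> B" .
    then have "(mom s $ 1)\<^sup>2 + N \<le> pt\<^sup>2 + B" using const(1)[OF s] by simp
    then show ?thesis
      unfolding norm_vec_def L2_set_def sum_4 N_def by (simp add: add.assoc)
  qed
  then show ?thesis by (rule that)
qed

text \<open>The inverse metric is invariant under the flow of \<open>\<partial>\<^sub>t\<close>, so it is bounded along the orbit by its values on
  a compact set that meets all the flow lines of the orbit.\<close>

lemma velocity_bounded:
  assumes "Kerr_trapped M a I \<gamma>"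
  obtains B where "\<And>s. s \<in> I \<Longrightarrow> norm (velocity \<gamma> s) \<le> B"
proof -
  obtain C where C: "compact C" "C \<subseteq> {r_plus M a<..}" "rad ` I \<subseteq> C"
    using assms by (auto simp: Kerr_trapped_def)
  obtain B where B: "\<And>s. s \<in> I \<Longrightarrow> norm (mom s) \<le> B"
    by (rule momentum_bounded[OF C]) blast
  obtain D where D: "compact D" "D \<subseteq> Kerr_DOC M a" "\<gamma> ` I \<subseteq> (\<Union>\<tau>. time_flow \<tau> ` D)"
    using assms unfolding Kerr_trapped_iff_orbit_space by blast
  have "continuous_on (D \<times> cball 0 B) (\<lambda>(p, \<pi>). Kerr_sharp M a p \<pi>)"
    by (rule continuous_on_subset[OF continuous_on_Kerr_sharp[OF a]]) (use D(2) in auto)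
  then have "bounded ((\<lambda>(p, \<pi>). Kerr_sharp M a p \<pi>) ` (D \<times> cball 0 B))"
    by (intro compact_imp_bounded compact_continuous_image compact_Times D(1) compact_cball)
  then obtain A where A: "\<And>p \<pi>. p \<in> D \<Longrightarrow> norm \<pi> \<le> B \<Longrightarrow> norm (Kerr_sharp M a p \<pi>) \<le> A"
    unfolding bounded_iff by fastforce
  have "norm (velocity \<gamma> s) \<le> A" if s: "s \<in> I" for s
  proof -
    obtain p \<tau> where p: "p \<in> D" "\<gamma> s = time_flow \<tau> p" using D(3) s by blast
    have "velocity \<gamma> s = Kerr_sharp M a p (mom s)"
      using velocity_eq_sharp[OF s] unfolding p(2) Kerr_sharp_time_flow .
    then show ?thesis using A[OF p(1) B[OF s]] by simp
  qed
  then show ?thesis by (rule that)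
qed

lemma radial_equation:
  assumes s: "s \<in> I"
  shows "(rho2 s * (Delta s * S s / (rad s * rho2 s)))\<^sup>2
    = (P s)\<^sup>2 - Delta s * Kerr_Carter a (\<gamma> s) (mom s)"
proof -
  have "Delta s \<noteq> 0" "rho2 s \<noteq> 0" using pos[OF s] by (auto simp: less_le)
  then show ?thesis
    using radial_momentum_squared[of M a "\<gamma> s" "mom s"] Kerr_Hamiltonian_eq_0[OF s] by simp
qed

lemma rho2_le:
  "rho2 s \<le> (rad s)\<^sup>2 + a\<^sup>2"
proof (cases "rad s = 0")
  case False
  have "(\<gamma> s $ 4)\<^sup>2 \<le> (rad s)\<^sup>2" by (simp add: BL_r_squared)
  then have "(\<gamma> s $ 4 / rad s)\<^sup>2 \<le> 1" using False by (simp add: power_divide)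
  then show ?thesis by (simp add: Kerr_rho2_def mult_left_le)
qed (simp add: Kerr_rho2_def)

end

theorem proposition2:
  fixes M a :: real and I :: "real set" and \<gamma> :: "real \<Rightarrow> real ^ 4"
  assumes "0 < a" and "a < M"
    and "Kerr_photon M a I \<gamma>"
    and "Kerr_trapped M a I \<gamma>"
  shows "spherical I \<gamma>"
proof -
  have inext: "inextendible_geodesic (Kerr_metric M a) (Kerr_DOC M a) I \<gamma>"
    and null: "\<And>s. s \<in> I \<Longrightarrow> Kerr_metric M a (\<gamma> s) (velocity \<gamma> s) (velocity \<gamma> s) = 0"
    using assms(3) by (auto simp: Kerr_photon_def photon_def)
  interpret Kerr_null_geodesic M a I \<gamma>
    using assms(1,2) inext null by unfold_locales (auto simp: inextendible_geodesic_def)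
  obtain C where C: "compact C" "C \<subseteq> {r_plus M a<..}" "rad ` I \<subseteq> C"
    using assms(4) by (auto simp: Kerr_trapped_def)
  obtain B where B: "\<And>s. s \<in> I \<Longrightarrow> norm (velocity \<gamma> s) \<le> B"
    by (rule velocity_bounded[OF assms(4)]) blast
  have I: "I = UNIV"
  proof (rule inextendible_bounded_velocity_complete[OF inext open_Kerr_DOC
        Kerr_geodesic_field_locally_lipschitz[OF a] _ _ _ B])
    show "closed (BL_r -` C)"
      using continuous_on_BL_r[of UNIV] C(1)
      by (intro continuous_closed_vimage compact_imp_closed) (simp_all add: continuous_on_eq_continuous_at)
    show "BL_r -` C \<subseteq> Kerr_DOC M a" using C(2) by (auto simp: Kerr_DOC_def)
    show "\<gamma> ` I \<subseteq> BL_r -` C" using C(3) by auto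
  qed
  obtain pt l K where const: "\<And>s. s \<in> I \<Longrightarrow> mom s $ 1 = pt" "\<And>s. s \<in> I \<Longrightarrow> L s = l"
    "\<And>s. s \<in> I \<Longrightarrow> Kerr_Carter a (\<gamma> s) (mom s) = K"
    by (rule constants_of_motion) blast
  define R where "R r = (Kerr_P a r pt l)\<^sup>2 - Kerr_Delta M a r * K" for r
  define rad' where "rad' s = Delta s * S s / (rad s * rho2 s)" for s
  have der: "(rad has_real_derivative rad' s) (at s)" for s
    unfolding rad'_def by (rule radius_derivative) (simp add: I)
  have energy: "(rho2 s * rad' s)\<^sup>2 = R (rad s)" for s
    unfolding rad'_def R_def using radial_equation[of s] const[of s] by (simp add: I)
  have rad_C: "range rad \<subseteq> C" using C(3) I by simp
  have bdd: "bdd_above C" "bdd_below C"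
    using compact_imp_bounded[OF C(1)] by (auto simp: bounded_imp_bdd_above bounded_imp_bdd_below)
  define lo where "lo = Inf (range rad)"
  define hi where "hi = Sup (range rad)"
  have bdd_rad: "bdd_above (range rad)" "bdd_below (range rad)"
    using bdd rad_C by (auto intro: bdd_above_mono bdd_below_mono)
  have "lo \<in> C"
    unfolding lo_def by (rule closed_subset_contains_Inf[OF compact_imp_closed[OF C(1)] rad_C])
      (use bdd_rad in auto)
  then have lo: "r_plus M a < lo" using C(2) by auto
  have between: "lo \<le> rad s" "rad s \<le> hi" for s
    unfolding lo_def hi_def using bdd_rad by (auto intro: cInf_lower cSup_upper)
  have rho2: "\<bar>rho2 s\<bar> \<le> hi\<^sup>2 + a\<^sup>2" for s
  proof -
    have "0 < rho2 s" "0 < rad s" using pos[of s] by (simp_all add: I)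
    moreover have "(rad s)\<^sup>2 \<le> hi\<^sup>2" using between(2)[of s] \<open>0 < rad s\<close> by (intro power_mono) auto
    ultimately show ?thesis using rho2_le[of s] by simp
  qed
  have cont: "isCont R r" for r
    unfolding R_def Kerr_P_def Kerr_Delta_def by (intro continuous_intros)
  have R_hi: "R hi = 0"
    unfolding hi_def by (rule potential_vanishes_at_Sup[OF der bdd_rad(1) energy rho2 cont])
  \<comment> \<open>The infimum is minus the supremum of the reflected motion, which has the potential \<open>\<lambda>r. R (- r)\<close>.\<close>
  have R_lo: "R lo = 0"
  proof -
    have Sup: "Sup (range (\<lambda>s. - rad s)) = - lo"
      by (simp add: lo_def Inf_real_def image_image)
    have "(\<lambda>r. R (- r)) (Sup (range (\<lambda>s. - rad s))) = 0"
    proof (rule potential_vanishes_at_Sup)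
      show "((\<lambda>s. - rad s) has_real_derivative - rad' s) (at s)" for s
        using der by (intro derivative_intros)
      show "bdd_above (range (\<lambda>s. - rad s))"
        using between(1) by (intro bdd_aboveI[of _ "- lo"]) auto
      show "(rho2 s * - rad' s)\<^sup>2 = R (- (- rad s))" for s
        using energy[of s] by simp
      show "isCont (\<lambda>r. R (- r)) (Sup (range (\<lambda>s. - rad s)))"
        unfolding R_def Kerr_P_def Kerr_Delta_def by (intro continuous_intros)
    qed (rule rho2)
    then show ?thesis by (simp add: Sup)
  qed
  have "rad' s = 0" for s
  proof (rule ccontr)
    assume "rad' s \<noteq> 0"
    moreover have "rho2 s \<noteq> 0" using pos(3)[of s "\<gamma> s $ 4 / rad s"] by (simp add: I)
    ultimately have R_pos: "0 < R (rad s)"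
      unfolding energy[symmetric] by simp
    then have "lo < rad s" "rad s < hi"
      using between[of s] R_lo R_hi by (auto simp: less_le)
    \<comment> \<open>There is no cubic term, as \<open>\<Delta>\<close> is quadratic and \<open>P\<close> has no linear term in \<open>r\<close>.\<close>
    moreover have "R r = pt\<^sup>2 * r ^ 4 + (2 * pt * (a\<^sup>2 * pt + a * l) - K) * r\<^sup>2 + (2 * M * K) * r
        + ((a\<^sup>2 * pt + a * l)\<^sup>2 - a\<^sup>2 * K)" for r
      unfolding R_def Kerr_P_def Kerr_Delta_def by algebra
    ultimately have "R (r_plus M a) < 0"
      using depressed_quartic_no_bump[of "pt\<^sup>2" "r_plus M a" lo "rad s" hi R] r_plus_pos[OF a] lo
        R_lo R_hi R_pos by simp
    moreover have "0 \<le> R (r_plus M a)"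
      by (simp add: R_def Kerr_Delta_r_plus[OF a])
    ultimately show False by simp
  qed
  then have "rad s = rad 0" for s
    using der by (intro DERIV_isconst_all) simp
  then show ?thesis unfolding spherical_def by blast
qed

end
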